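(* Away from umbilic points (i.e. near any point where $\mathrm{II}^0\ne0$), a strictly M\"obius-flat surface $\Sigma$ in the conformal $3$-sphere has conformal metric and tracefree second fundamental form given by $$c=\frac{dx_1^2+dx_2^2}{\lambda^2},\qquad \mathrm{II}^0=\lambda\,\frac{dx_1^2-dx_2^2}{\lambda^2}\otimes\xi$$ for some coordinates $x_1,x_2$, a weightless unit normal $\xi$ and a gauge $\lambda$ (a positive section of $\Lambda$), and the M\"obius structure given by $$\mathcal H=\mathrm{sym}_0(D^g)^2+\tfrac t2(dx_1^2-dx_2^2)$$ for a constant $t\in\mathbb R$, $D^g$ being the Levi-Civita connection of the flat metric $g=\lambda^2c$. Furthermore, $\Sigma$ is isothermic with holomorphic quadratic differential $q_0=dx_1^2-dx_2^2$, and is Willmore if and only if $t=0$.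
   Context: $\mathbb R^{4,1}$ has inner product $(\cdot,\cdot)$ of signature $(4,1)$; $S^3$ is the set of its null lines; a half of the light-cone is fixed; $d$ is flat differentiation. $\Sigma$ is a surface, $L$ its bundle of weight-one densities ($L^{-2}=|\Lambda^2T^*\Sigma|$); tensor signs with line bundles are omitted. An immersion in $S^3$ is a null line subbundle $\Lambda\subset\Sigma\times\mathbb R^{4,1}$, oriented by the half light-cone, with $X\mapsto d_X\sigma$ mod $\Lambda$ injective. It induces the conformal metric $c=\langle\cdot,\cdot\rangle\in S^2T^*\Sigma\,L^2$, $(d_X\sigma,d_Y\sigma)=\langle X,Y\rangle\sigma^2$, with $\Lambda=L^{-1}$ so that $c$ has volume form of modulus one. $\Lambda^{(1)}$ is the span of $\sigma,d\sigma$; $N\Sigma=\mathrm{Hom}(\Lambda,\Lambda^\perp/\Lambda^{(1)})$; the weightless normal bundle is the euclidean line bundle $N\Sigma\,\Lambda=\Lambda^\perp/\Lambda^{(1)}$, and a weightless unit normal is a unit section of it. An enveloped sphere congruence is a signature $(3,1)$ subbundle $V\supset\Lambda^{(1)}$; $V^\perp\cong N\Sigma\,\Lambda$, with the induced connection $\nabla$; $\mathrm{II}^V_XY\,\sigma=-(d_Xd_Y\sigma)^\perp$ ($V^\perp$-component). $V_\Sigma$ is the unique $V$ with $\mathrm{II}^V$ tracefree; $\mathrm{II}^0=\mathrm{II}^{V_\Sigma}\in S^2_0T^*\Sigma\otimes N\Sigma$; $\mathbb S^0$ is its transpose. M\"obius structure of $\Sigma$: for a positive section $\sigma$ of $\Lambda$,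 with $D$ and $K$ the Levi-Civita connection and Gauss curvature of $g_\sigma=(d\sigma,d\sigma)=\sigma^2c$, the $V_\Sigma$-component of the tracefree part of $D\,d\sigma$ is $-r_0\otimes\sigma$, $r_0\in S^2_0T^*\Sigma$, and $\mathcal H\ell=\mathrm{sym}_0D^2\ell+r_0\ell$ on sections $\ell$ of $L$ (independent of $\sigma$). $C^\Sigma=d^D(r_0+\frac12Kg_\sigma)$ with $(d^Dr)_{X,Y}=(D_Xr)(Y,\cdot)-(D_Yr)(X,\cdot)$ (independent of $\sigma$). $\Sigma$ is strictly M\"obius-flat if $C^\Sigma=0$ (the canonically induced conformal M\"obius structure is flat). A quadratic differential is a section $q$ of $S^2_0T^*\Sigma$; it is holomorphic if $d^Dq=0$. $\Sigma$ is isothermic, with holomorphic quadratic differential $q$, if $q\ne0$ is holomorphic and commutes with $\mathbb S^0$: $q(X,\mathbb S^0_YU)=q(Y,\mathbb S^0_XU)$ for tangent $X,Y$ and normal $U$. $\Sigma$ is Willmore if $(\mathcal H^\nabla)^*(\mathrm{II}^0):=\mathrm{div}\,\mathrm{div}\,\mathrm{II}^0+\langle r_0,\mathrm{II}^0\rangle=0$ (divergences with $c$, $D$ and $\nabla$). *)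

theory Defs
  imports "HOL-Analysis.Analysis"
begin

section \<open>Smooth maps and surfaces\<close>

text \<open>Infinitely often differentiable maps on an open set: all iterated directional derivatives
  exist and are continuous.\<close>

primrec Ck_on :: "nat \<Rightarrow> 'a::real_normed_vector set \<Rightarrow> ('a \<Rightarrow> 'b::real_normed_vector) \<Rightarrow> bool" where
  "Ck_on 0 S f \<longleftrightarrow> continuous_on S f"
| "Ck_on (Suc k) S f \<longleftrightarrow> (\<forall>x\<in>S. f differentiable (at x)) \<and>
     (\<forall>v. Ck_on k S (\<lambda>x. frechet_derivative f (at x) v))"

definition smooth_on :: "'a::real_normed_vector set \<Rightarrow> ('a \<Rightarrow> 'b::real_normed_vector) \<Rightarrow> bool" where
  "smooth_on S f \<longleftrightarrow> (\<forall>k. Ck_on k S f)"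

text \<open>A chart is a pair of a domain and a coordinate map; only the values of the coordinate map on
  the domain matter.  The underlying space of an atlas is the union of its chart domains, an open
  subset of the ambient topological type.\<close>

type_synonym 'a chart = "'a set \<times> ('a \<Rightarrow> real^2)"

definition is_chart :: "'a::topological_space chart \<Rightarrow> bool" where
  "is_chart = (\<lambda>(U, x). open U \<and> open (x ` U) \<and> homeomorphism U (x ` U) x (inv_into U x))"

definition compatible :: "'a chart \<Rightarrow> 'a chart \<Rightarrow> bool" where
  "compatible = (\<lambda>(U, x) (W, y).
     smooth_on (x ` (U \<inter> W)) (y \<circ> inv_into U x) \<and>
     smooth_on (y ` (U \<inter> W)) (x \<circ> inv_into W y))"

definition points :: "'a chart set \<Rightarrow> 'a set" where
  "points A = \<Union> (fst ` A)"

definition smooth_surface :: "'a::{t2_space, second_countable_topology} chart set \<Rightarrow> bool" where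
  "smooth_surface A \<longleftrightarrow> (\<forall>c\<in>A. is_chart c) \<and> (\<forall>c\<in>A. \<forall>d\<in>A. compatible c d)"

text \<open>The maximal atlas: all local coordinates of the surface.\<close>

definition coordinates :: "'a::{t2_space, second_countable_topology} chart set \<Rightarrow> 'a chart set" where
  "coordinates A = {c. is_chart c \<and> fst c \<subseteq> points A \<and> (\<forall>d\<in>A. compatible c d)}"


section \<open>The conformal 3-sphere\<close>

type_synonym mink = "(real^4) \<times> real"

definition lorentz :: "mink \<Rightarrow> mink \<Rightarrow> real" where
  "lorentz v w = fst v \<bullet> fst w - snd v * snd w"

text \<open>The chosen half of the light cone consists of the null vectors with positive last component.\<close>

definition conformal_sphere :: "mink set set" where
  "conformal_sphere = {span {v} | v. v \<noteq> 0 \<and> lorentz v v = 0}"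

definition has_signature :: "mink set \<Rightarrow> nat \<Rightarrow> nat \<Rightarrow> bool" where
  "has_signature V m n \<longleftrightarrow> (\<exists>P N. subspace P \<and> subspace N \<and> dim P = m \<and> dim N = n \<and>
     (\<forall>v\<in>P. v \<noteq> 0 \<longrightarrow> lorentz v v > 0) \<and> (\<forall>v\<in>N. v \<noteq> 0 \<longrightarrow> lorentz v v < 0) \<and>
     (\<forall>v\<in>P. \<forall>w\<in>N. lorentz v w = 0) \<and> V = {v + w | v w. v \<in> P \<and> w \<in> N})"

text \<open>Projections along \<open>\<real>\<^sup>4\<^sup>,\<^sup>1 = V \<oplus> V\<^sup>\<bottom>\<close>, meaningful when the form is nondegenerate on \<open>V\<close>.\<close>

definition tan_proj :: "mink set \<Rightarrow> mink \<Rightarrow> mink" where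
  "tan_proj V v = (THE w. w \<in> V \<and> (\<forall>z\<in>V. lorentz (v - w) z = 0))"

definition nor_proj :: "mink set \<Rightarrow> mink \<Rightarrow> mink" where
  "nor_proj V v = v - tan_proj V v"

definition lorentz_perp :: "mink set \<Rightarrow> mink set" where
  "lorentz_perp V = {n. \<forall>v\<in>V. lorentz n v = 0}"


section \<open>Tensor calculus in coordinates\<close>

text \<open>Tensors with values in a vector space are given by their components in a coordinate system,
  indexed by the two-element type \<open>2\<close> with elements \<open>1\<close> and \<open>2\<close>.\<close>

definition pd :: "2 \<Rightarrow> (real^2 \<Rightarrow> 'b::real_normed_vector) \<Rightarrow> real^2 \<Rightarrow> 'b" where
  "pd i f u = frechet_derivative f (at u) (axis i 1)"

definition bil :: "'b::real_vector^2^2 \<Rightarrow> real^2 \<Rightarrow> real^2 \<Rightarrow> 'b" where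
  "bil T X Y = (\<Sum>i\<in>UNIV. \<Sum>j\<in>UNIV. (X$i * Y$j) *\<^sub>R T$i$j)"

definition trace_wrt :: "real^2^2 \<Rightarrow> 'b::real_vector^2^2 \<Rightarrow> 'b" where
  "trace_wrt g T = (\<Sum>i\<in>UNIV. \<Sum>j\<in>UNIV. (matrix_inv g $ i $ j) *\<^sub>R T$i$j)"

definition sym0 :: "real^2^2 \<Rightarrow> 'b::real_vector^2^2 \<Rightarrow> 'b^2^2" where
  "sym0 g T = (\<chi> i j. (1/2) *\<^sub>R (T$i$j + T$j$i) - (g$i$j / 2) *\<^sub>R trace_wrt g T)"

definition christoffel :: "(real^2 \<Rightarrow> real^2^2) \<Rightarrow> real^2 \<Rightarrow> 2 \<Rightarrow> 2 \<Rightarrow> 2 \<Rightarrow> real" where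
  "christoffel g u k i j = (\<Sum>l\<in>UNIV. matrix_inv (g u) $ k $ l *
     (pd i (\<lambda>w. g w $ j $ l) u + pd j (\<lambda>w. g w $ i $ l) u - pd l (\<lambda>w. g w $ i $ j) u) / 2)"

definition hessian :: "(real^2 \<Rightarrow> real^2^2) \<Rightarrow> (real^2 \<Rightarrow> 'b::real_normed_vector) \<Rightarrow> real^2 \<Rightarrow> 'b^2^2" where
  "hessian g f u = (\<chi> i j. pd i (pd j f) u - (\<Sum>k\<in>UNIV. christoffel g u k i j *\<^sub>R pd k f u))"

text \<open>\<open>riemann g u l k i j\<close> is the \<open>\<partial>\<^sub>l\<close>-component of \<open>R(\<partial>\<^sub>i, \<partial>\<^sub>j)\<partial>\<^sub>k\<close>.\<close>

definition riemann :: "(real^2 \<Rightarrow> real^2^2) \<Rightarrow> real^2 \<Rightarrow> 2 \<Rightarrow> 2 \<Rightarrow> 2 \<Rightarrow> 2 \<Rightarrow> real" where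
  "riemann g u l k i j =
     pd i (\<lambda>w. christoffel g w l j k) u - pd j (\<lambda>w. christoffel g w l i k) u +
     (\<Sum>m\<in>UNIV. christoffel g u l i m * christoffel g u m j k
               - christoffel g u l j m * christoffel g u m i k)"

definition gauss_curvature :: "(real^2 \<Rightarrow> real^2^2) \<Rightarrow> real^2 \<Rightarrow> real" where
  "gauss_curvature g u = (\<Sum>l\<in>UNIV. g u $ 1 $ l * riemann g u l 2 1 2) / det (g u)"

text \<open>Covariant derivatives in direction \<open>\<partial>\<^sub>k\<close>, for the Levi-Civita connection of \<open>g\<close> coupled to the
  connection \<open>nab\<close> on the coefficients (\<open>pd\<close> for real coefficients).\<close>

definition cov1 :: "(2 \<Rightarrow> (real^2 \<Rightarrow> 'b) \<Rightarrow> real^2 \<Rightarrow> 'b) \<Rightarrow> (real^2 \<Rightarrow> real^2^2) \<Rightarrow>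
    (real^2 \<Rightarrow> 'b::real_normed_vector^2) \<Rightarrow> real^2 \<Rightarrow> 2 \<Rightarrow> 2 \<Rightarrow> 'b" where
  "cov1 nab g \<alpha> u k j = nab k (\<lambda>w. \<alpha> w $ j) u - (\<Sum>m\<in>UNIV. christoffel g u m k j *\<^sub>R \<alpha> u $ m)"

definition cov2 :: "(2 \<Rightarrow> (real^2 \<Rightarrow> 'b) \<Rightarrow> real^2 \<Rightarrow> 'b) \<Rightarrow> (real^2 \<Rightarrow> real^2^2) \<Rightarrow>
    (real^2 \<Rightarrow> 'b::real_normed_vector^2^2) \<Rightarrow> real^2 \<Rightarrow> 2 \<Rightarrow> 2 \<Rightarrow> 2 \<Rightarrow> 'b" where
  "cov2 nab g T u k i j = nab k (\<lambda>w. T w $ i $ j) u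
     - (\<Sum>m\<in>UNIV. christoffel g u m k i *\<^sub>R T u $ m $ j)
     - (\<Sum>m\<in>UNIV. christoffel g u m k j *\<^sub>R T u $ i $ m)"

definition div1 :: "(2 \<Rightarrow> (real^2 \<Rightarrow> 'b) \<Rightarrow> real^2 \<Rightarrow> 'b) \<Rightarrow> (real^2 \<Rightarrow> real^2^2) \<Rightarrow>
    (real^2 \<Rightarrow> 'b::real_normed_vector^2) \<Rightarrow> real^2 \<Rightarrow> 'b" where
  "div1 nab g \<alpha> u = trace_wrt (g u) (\<chi> k j. cov1 nab g \<alpha> u k j)"

definition div2 :: "(2 \<Rightarrow> (real^2 \<Rightarrow> 'b) \<Rightarrow> real^2 \<Rightarrow> 'b) \<Rightarrow> (real^2 \<Rightarrow> real^2^2) \<Rightarrow>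
    (real^2 \<Rightarrow> 'b::real_normed_vector^2^2) \<Rightarrow> real^2 \<Rightarrow> 'b^2" where
  "div2 nab g T u = (\<chi> j. trace_wrt (g u) (\<chi> k i. cov2 nab g T u k i j))"

text \<open>\<open>(d\<^sup>D r)\<^bsub>X,Y\<^esub> Z\<close> for \<open>X = \<partial>\<^sub>k\<close>, \<open>Y = \<partial>\<^sub>i\<close>, \<open>Z = \<partial>\<^sub>j\<close>.\<close>

definition ext_cov :: "(real^2 \<Rightarrow> real^2^2) \<Rightarrow> (real^2 \<Rightarrow> real^2^2) \<Rightarrow> real^2 \<Rightarrow> 2 \<Rightarrow> 2 \<Rightarrow> 2 \<Rightarrow> real" where
  "ext_cov g r u k i j = cov2 pd g r u k i j - cov2 pd g r u i k j"


section \<open>Immersions in the conformal 3-sphere, in coordinates\<close>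

text \<open>An open set \<open>S\<close> of coordinate values and a map \<open>L\<close> assigning a null line to each of them
  describe an immersed coordinate patch, and a positive section \<open>s\<close> of \<open>L\<close> is a gauge.  The gauge
  trivializes all density bundles: a section of a bundle tensored with \<open>\<Lambda>\<^sup>w\<close> is written \<open>a s\<^sup>w\<close> and
  represented by the weightless coefficient \<open>a\<close>.  Thus the conformal metric \<open>c = g\<^sub>s / s\<^sup>2\<close> is represented by
  \<open>g\<^sub>s\<close>, a section \<open>l s\<^sup>-\<^sup>1\<close> of \<open>\<Lambda>\<^sup>-\<^sup>1\<close> by the function \<open>l\<close>, and a normal-bundle-valued \<open>B\<close> by
  the \<open>V\<^sup>\<bottom>\<close>-valued \<open>B s\<close>, using \<open>\<Lambda>\<^sup>\<bottom>/\<Lambda>\<^sup>(\<^sup>1\<^sup>) \<cong> V\<^sup>\<bottom>\<close>.\<close>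

definition positive_section :: "(real^2) set \<Rightarrow> (real^2 \<Rightarrow> mink set) \<Rightarrow> (real^2 \<Rightarrow> mink) \<Rightarrow> bool" where
  "positive_section S L s \<longleftrightarrow> smooth_on S s \<and> (\<forall>u\<in>S. s u \<in> L u \<and> snd (s u) > 0)"

definition immersed_patch :: "(real^2) set \<Rightarrow> (real^2 \<Rightarrow> mink set) \<Rightarrow> bool" where
  "immersed_patch S L \<longleftrightarrow>
     (\<forall>u\<in>S. L u \<in> conformal_sphere) \<and>
     (\<forall>u\<in>S. \<exists>W s. open W \<and> u \<in> W \<and> W \<subseteq> S \<and> positive_section W L s) \<and>
     (\<forall>W s. open W \<and> W \<subseteq> S \<and> positive_section W L s \<longrightarrow>
        (\<forall>u\<in>W. \<forall>X. frechet_derivative s (at u) X \<in> L u \<longrightarrow> X = 0))"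

definition ind_metric :: "(real^2 \<Rightarrow> mink) \<Rightarrow> real^2 \<Rightarrow> real^2^2" where
  "ind_metric s u = (\<chi> i j. lorentz (pd i s u) (pd j s u))"

definition first_derived :: "(real^2 \<Rightarrow> mink) \<Rightarrow> real^2 \<Rightarrow> mink set" where
  "first_derived s u = span (insert (s u) (range (\<lambda>i. pd i s u)))"

definition enveloped :: "(real^2 \<Rightarrow> mink) \<Rightarrow> real^2 \<Rightarrow> mink set \<Rightarrow> bool" where
  "enveloped s u V \<longleftrightarrow> has_signature V 3 1 \<and> first_derived s u \<subseteq> V"

definition second_ff :: "(real^2 \<Rightarrow> mink) \<Rightarrow> real^2 \<Rightarrow> mink set \<Rightarrow> mink^2^2" where
  "second_ff s u V = (\<chi> i j. - nor_proj V (pd i (pd j s) u))"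

text \<open>The conditions defining \<open>V\<^sub>\<Sigma>\<close> are pointwise in \<open>V\<close>, so its fibre is characterized point by
  point; smooth dependence on the point is then automatic.\<close>

definition central_sphere :: "(real^2 \<Rightarrow> mink) \<Rightarrow> real^2 \<Rightarrow> mink set" where
  "central_sphere s u = (THE V. enveloped s u V \<and> trace_wrt (ind_metric s u) (second_ff s u V) = 0)"

definition II0 :: "(real^2 \<Rightarrow> mink) \<Rightarrow> real^2 \<Rightarrow> mink^2^2" where
  "II0 s u = second_ff s u (central_sphere s u)"

text \<open>\<open>shape0 s u Y n\<close> is \<open>\<S>\<^sup>0\<^sub>Y n\<close>, the transpose of \<open>II\<^sup>0\<close>, for \<open>n\<close> in the orthogonal complement of
  \<open>central_sphere s u\<close>.\<close>

definition shape0 :: "(real^2 \<Rightarrow> mink) \<Rightarrow> real^2 \<Rightarrow> real^2 \<Rightarrow> mink \<Rightarrow> real^2" where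
  "shape0 s u Y n = (THE Z. \<forall>X. bil (ind_metric s u) Z X = lorentz (bil (II0 s u) X Y) n)"

text \<open>The connection on \<open>V\<^sub>\<Sigma>\<^sup>\<bottom>\<close> induced by flat differentiation.\<close>

definition normal_conn :: "(real^2 \<Rightarrow> mink) \<Rightarrow> 2 \<Rightarrow> (real^2 \<Rightarrow> mink) \<Rightarrow> real^2 \<Rightarrow> mink" where
  "normal_conn s k f u = nor_proj (central_sphere s u) (pd k f u)"

definition unit_normal :: "(real^2) set \<Rightarrow> (real^2 \<Rightarrow> mink) \<Rightarrow> (real^2 \<Rightarrow> mink) \<Rightarrow> bool" where
  "unit_normal S s \<xi> \<longleftrightarrow> smooth_on S \<xi> \<and>
     (\<forall>u\<in>S. \<xi> u \<in> lorentz_perp (central_sphere s u) \<and> lorentz (\<xi> u) (\<xi> u) = 1)"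

definition r0 :: "(real^2 \<Rightarrow> mink) \<Rightarrow> real^2 \<Rightarrow> real^2^2" where
  "r0 s u = (\<chi> i j. THE a. tan_proj (central_sphere s u)
       (sym0 (ind_metric s u) (hessian (ind_metric s) s u) $ i $ j) = - (a *\<^sub>R s u))"

definition moebius_op :: "(real^2 \<Rightarrow> mink) \<Rightarrow> (real^2 \<Rightarrow> real) \<Rightarrow> real^2 \<Rightarrow> real^2^2" where
  "moebius_op s l u = sym0 (ind_metric s u) (hessian (ind_metric s) l u) + l u *\<^sub>R r0 s u"

definition cotton :: "(real^2 \<Rightarrow> mink) \<Rightarrow> real^2 \<Rightarrow> 2 \<Rightarrow> 2 \<Rightarrow> 2 \<Rightarrow> real" where
  "cotton s = ext_cov (ind_metric s)
     (\<lambda>w. r0 s w + (gauss_curvature (ind_metric s) w / 2) *\<^sub>R ind_metric s w)"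

definition willmore_expr :: "(real^2 \<Rightarrow> mink) \<Rightarrow> real^2 \<Rightarrow> mink" where
  "willmore_expr s u =
     div1 (normal_conn s) (ind_metric s) (div2 (normal_conn s) (ind_metric s) (II0 s)) u +
     (\<Sum>i\<in>UNIV. \<Sum>j\<in>UNIV. \<Sum>k\<in>UNIV. \<Sum>l\<in>UNIV.
        (matrix_inv (ind_metric s u) $ i $ k * matrix_inv (ind_metric s u) $ j $ l * r0 s u $ i $ j)
          *\<^sub>R II0 s u $ k $ l)"

definition willmore_patch :: "(real^2) set \<Rightarrow> (real^2 \<Rightarrow> mink set) \<Rightarrow> bool" where
  "willmore_patch S L \<longleftrightarrow> (\<forall>s. positive_section S L s \<longrightarrow> (\<forall>u\<in>S. willmore_expr s u = 0))"

definition isothermic_patch ::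
    "(real^2) set \<Rightarrow> (real^2 \<Rightarrow> mink set) \<Rightarrow> (real^2 \<Rightarrow> real^2^2) \<Rightarrow> bool" where
  "isothermic_patch S L q \<longleftrightarrow> smooth_on S q \<and> (\<exists>u\<in>S. q u \<noteq> 0) \<and>
     (\<forall>s. positive_section S L s \<longrightarrow> (\<forall>u\<in>S.
        transpose (q u) = q u \<and> trace_wrt (ind_metric s u) (q u) = 0 \<and>
        (\<forall>k i j. ext_cov (ind_metric s) q u k i j = 0) \<and>
        (\<forall>X Y. \<forall>n\<in>lorentz_perp (central_sphere s u).
           bil (q u) X (shape0 s u Y n) = bil (q u) Y (shape0 s u X n))))"


section \<open>Immersed surfaces\<close>

definition in_chart :: "('a \<Rightarrow> mink set) \<Rightarrow> 'a chart \<Rightarrow> real^2 \<Rightarrow> mink set" where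
  "in_chart \<Lambda> c = \<Lambda> \<circ> inv_into (fst c) (snd c)"

definition immersion :: "'a::{t2_space, second_countable_topology} chart set \<Rightarrow> ('a \<Rightarrow> mink set) \<Rightarrow> bool" where
  "immersion A \<Lambda> \<longleftrightarrow> (\<forall>(U, x)\<in>coordinates A. immersed_patch (x ` U) (in_chart \<Lambda> (U, x)))"

definition umbilic ::
    "'a::{t2_space, second_countable_topology} chart set \<Rightarrow> ('a \<Rightarrow> mink set) \<Rightarrow> 'a \<Rightarrow> bool" where
  "umbilic A \<Lambda> p \<longleftrightarrow> (\<forall>(U, x)\<in>coordinates A. p \<in> U \<longrightarrow>
     (\<forall>s. positive_section (x ` U) (in_chart \<Lambda> (U, x)) s \<longrightarrow> II0 s (x p) = 0))"

definition strictly_moebius_flat ::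
    "'a::{t2_space, second_countable_topology} chart set \<Rightarrow> ('a \<Rightarrow> mink set) \<Rightarrow> bool" where
  "strictly_moebius_flat A \<Lambda> \<longleftrightarrow> (\<forall>(U, x)\<in>coordinates A.
     \<forall>s. positive_section (x ` U) (in_chart \<Lambda> (U, x)) s \<longrightarrow>
       (\<forall>u\<in>x ` U. \<forall>k i j. cotton s u k i j = 0))"

text \<open>The components of \<open>dx\<^sub>1\<^sup>2 - dx\<^sub>2\<^sup>2\<close> in the coordinates \<open>x\<^sub>1, x\<^sub>2\<close>.\<close>

definition q0 :: "real^2^2" where
  "q0 = (\<chi> i j. if i = j then (if i = 1 then 1 else -1) else 0)"

end

theory Submission
  imports Defs
begin

text \<open>Away from umbilics there is a unique gauge \<open>\<lambda>\<close> with \<open>|II\<^sup>0|\<^sup>2 = 2\<close>; let \<open>\<xi>\<close> be the unit normal of the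
  central sphere congruence and \<open>\<nu>\<close> the null section with \<open>(\<nu>, \<lambda>) = -1\<close> orthogonal to \<open>d\<lambda>\<close> and \<open>\<xi>\<close>.  In
  this gauge the Gauss equation shows that \<open>r\<^sub>0 + K g / 2\<close> is \<open>- (d\<nu>, d\<lambda>) - g / 2\<close>, and the Codazzi equation
  then expresses its exterior derivative as the wedge product of \<open>II\<^sup>0\<close> with the one-form \<open>(d\<xi>, \<nu>)\<close>.  As
  \<open>II\<^sup>0\<close> is nondegenerate, strict Moebius-flatness forces \<open>(d\<xi>, \<nu>) = 0\<close>, hence \<open>d\<xi>\<close> is \<open>d\<lambda>\<close> composed with the
  shape operator, whose eigenvalues are \<open>\<plusminus>1\<close>.  So \<open>d(\<lambda> + \<xi>)\<close> and \<open>d(\<lambda> - \<xi>)\<close> have rank one, which makes the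
  two principal unit coframe forms closed; their primitives are the coordinates \<open>x\<^sub>1, x\<^sub>2\<close>.  In these
  \<open>\<lambda>\<^sub>1\<^sub>2 = 0\<close> and \<open>\<lambda>\<^sub>1\<^sub>1 - \<lambda>\<^sub>2\<^sub>2 = -t \<lambda> - 2 \<xi>\<close> with \<open>t\<close> constant, and in a gauge \<open>\<mu> \<lambda>\<close> the Willmore
  expression equals \<open>t \<mu>\<^sup>-\<^sup>3 \<xi>\<close>.\<close>

section \<open>Calculus of smooth maps\<close>

text \<open>The normalization of the gauge removes the Gauss curvature from the Cotton tensor. The
  Gauss equation reads \<open>K = - trace A + det B / det g\<close>, where \<open>A\<close> and
  \<open>B\<close> are, up to sign, the coefficients of the second derivatives of the gauge along
  itself and along the normal. With \<open>det B = - det g\<close> the last term is the constant -1,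
  and the trace of \<open>A\<close> in \<open>K g / 2\<close> cancels the one in \<open>r0\<close>.
  The same normalization makes the shape operator an involution.

  Two obstacles come from the definitions. Flatness and umbilicity speak of gauges on a whole chart
  domain, while the normalized gauge exists only near the point; hence charts are restricted and
  composed with coordinate changes. The isothermic and Willmore conditions quantify over every gauge
  of the patch, so the flat gauge alone does not settle them, and the invariants are also computed
  for the flat gauge times an arbitrary positive function \<mu>.\<close>

lemma Ck_on_cong:
  assumes "Ck_on k S f" "open S" "\<And>x. x \<in> S \<Longrightarrow> f x = g x"
  shows "Ck_on k S g"
  using assms(1,3)
proof (induction k arbitrary: f g)
  case 0
  then show ?case using continuous_on_cong by (metis Ck_on.simps(1))
next
  case (Suc k)
  have d: "g differentiable (at x)" if "x \<in> S" for x
    using that Suc.prems assms(2) unfolding differentiable_def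
    by (metis Ck_on.simps(2) differentiable_def has_derivative_transform_within_open)
  have "frechet_derivative f (at x) = frechet_derivative g (at x)" if "x \<in> S" for x
    using that Suc.prems assms(2) by (intro frechet_derivative_transform_within_open[where X = S]) auto
  then have "Ck_on k S (\<lambda>x. frechet_derivative g (at x) v)" for v
    using Suc.IH[of "\<lambda>x. frechet_derivative f (at x) v"] Suc.prems(1) by auto
  then show ?case using d by simp
qed

lemma Ck_on_subset: "Ck_on k S f \<Longrightarrow> T \<subseteq> S \<Longrightarrow> Ck_on k T f"
  by (induction k arbitrary: f) (auto intro: continuous_on_subset)

lemma Ck_on_Suc_imp: "Ck_on (Suc k) S f \<Longrightarrow> Ck_on k S f"
proof (induction k arbitrary: f)
  case 0
  then show ?case
    by (auto intro!: continuous_at_imp_continuous_on differentiable_imp_continuous_within)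
next
  case (Suc k)
  then show ?case using Ck_on.simps(2) by blast
qed

text \<open>Uniqueness of derivatives lets an explicit formula stand in for the choice-based
  \<open>frechet_derivative\<close> of the definition; most closure properties below go through this
  rule.\<close>

lemma Ck_on_SucI:
  assumes "open S" "\<And>x. x \<in> S \<Longrightarrow> (f has_derivative f' x) (at x)"
    and "\<And>v. Ck_on k S (\<lambda>x. f' x v)"
  shows "Ck_on (Suc k) S f"
proof -
  have "f' x = frechet_derivative f (at x)" if "x \<in> S" for x
    using frechet_derivative_at assms(2) that by blast
  then have "Ck_on k S (\<lambda>x. frechet_derivative f (at x) v)" for v
    by (intro Ck_on_cong[OF assms(3)[of v] assms(1)]) auto
  then show ?thesis using assms(2) by (auto simp: differentiable_def)
qed

lemma Ck_on_SucD:
  assumes "Ck_on (Suc k) S f"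
  shows "\<And>x. x \<in> S \<Longrightarrow> (f has_derivative frechet_derivative f (at x)) (at x)"
    and "\<And>v. Ck_on k S (\<lambda>x. frechet_derivative f (at x) v)"
  using assms by (auto simp: frechet_derivative_works)

lemma Ck_on_const: "Ck_on k S (\<lambda>x. c)"
  by (induction k arbitrary: c) auto

lemma Ck_on_add:
  "open S \<Longrightarrow> Ck_on k S f \<Longrightarrow> Ck_on k S g \<Longrightarrow> Ck_on k S (\<lambda>x. f x + g x)"
proof (induction k arbitrary: f g)
  case (Suc k)
  show ?case
    by (rule Ck_on_SucI[OF Suc.prems(1) has_derivative_add[OF Ck_on_SucD(1)[OF Suc.prems(2)]
          Ck_on_SucD(1)[OF Suc.prems(3)]]])
      (use Suc.IH[OF Suc.prems(1)] Ck_on_SucD(2)[OF Suc.prems(2)] Ck_on_SucD(2)[OF Suc.prems(3)] in auto)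
qed (simp add: continuous_on_add)

text \<open>Both terms of the product rule are again bilinear expressions in maps of lower order, so
  the induction closes. One proof covers scalar multiplication, real products and the Lorentz
  form.\<close>

lemma Ck_on_bilinear:
  assumes "bounded_bilinear B" "open S"
  shows "Ck_on k S f \<Longrightarrow> Ck_on k S g \<Longrightarrow> Ck_on k S (\<lambda>x. B (f x) (g x))"
proof (induction k arbitrary: f g)
  case 0
  then show ?case using bounded_bilinear.continuous_on[OF assms(1)] by auto
next
  case (Suc k)
  show ?case
  proof (rule Ck_on_SucI[OF assms(2) bounded_bilinear.FDERIV[OF assms(1)
        Ck_on_SucD(1)[OF Suc.prems(1)] Ck_on_SucD(1)[OF Suc.prems(2)]]])
    fix v
    show "Ck_on k S (\<lambda>x. B (f x) (frechet_derivative g (at x) v) + B (frechet_derivative f (at x) v) (g x))"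
      by (intro Ck_on_add assms(2) Suc.IH Ck_on_Suc_imp[OF Suc.prems(1)] Ck_on_Suc_imp[OF Suc.prems(2)]
          Ck_on_SucD(2)[OF Suc.prems(1)] Ck_on_SucD(2)[OF Suc.prems(2)])
  qed auto
qed

lemma Ck_on_linear:
  assumes "bounded_linear L" "open S"
  shows "Ck_on k S f \<Longrightarrow> Ck_on k S (\<lambda>x. L (f x))"
proof (induction k arbitrary: f)
  case 0
  then show ?case using bounded_linear.continuous_on[OF assms(1)] by auto
next
  case (Suc k)
  show ?case
    by (rule Ck_on_SucI[OF assms(2) bounded_linear.has_derivative[OF assms(1) Ck_on_SucD(1)[OF Suc.prems]]])
      (use Suc.IH Ck_on_SucD(2)[OF Suc.prems] in auto)
qed

lemma Ck_on_sum:
  "open S \<Longrightarrow> (\<And>i. i \<in> I \<Longrightarrow> Ck_on k S (f i)) \<Longrightarrow> Ck_on k S (\<lambda>x. \<Sum>i\<in>I. f i x)"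
  by (induction I rule: infinite_finite_induct) (auto intro: Ck_on_const Ck_on_add)

lemma smooth_on_cong:
  "smooth_on S f \<Longrightarrow> open S \<Longrightarrow> (\<And>x. x \<in> S \<Longrightarrow> f x = g x) \<Longrightarrow> smooth_on S g"
  unfolding smooth_on_def using Ck_on_cong by metis

lemma smooth_on_subset: "smooth_on S f \<Longrightarrow> T \<subseteq> S \<Longrightarrow> smooth_on T f"
  unfolding smooth_on_def using Ck_on_subset by blast

lemma smooth_on_deriv: "smooth_on S f \<Longrightarrow> smooth_on S (\<lambda>x. frechet_derivative f (at x) v)"
  unfolding smooth_on_def using Ck_on_SucD(2) by blast

lemma smooth_on_has_derivative:
  "smooth_on S f \<Longrightarrow> x \<in> S \<Longrightarrow> (f has_derivative frechet_derivative f (at x)) (at x)"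
  unfolding smooth_on_def using Ck_on_SucD(1)[of 0] by blast

lemma smooth_on_derivI:
  assumes "open S" "\<And>x. x \<in> S \<Longrightarrow> (f has_derivative f' x) (at x)"
    and "\<And>v. smooth_on S (\<lambda>x. f' x v)"
  shows "smooth_on S f"
  unfolding smooth_on_def
proof
  fix k show "Ck_on k S f"
    using Ck_on_Suc_imp[OF Ck_on_SucI[OF assms(1,2)]] assms(3) by (simp add: smooth_on_def)
qed

lemma smooth_on_imp_continuous_on: "smooth_on S f \<Longrightarrow> continuous_on S f"
  unfolding smooth_on_def using Ck_on.simps(1)[of S f] by blast

lemma smooth_on_const: "smooth_on S (\<lambda>x. c)"
  by (simp add: smooth_on_def Ck_on_const)

lemma smooth_on_id: "open S \<Longrightarrow> smooth_on S (\<lambda>x. x)"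
  by (rule smooth_on_derivI[where f' = "\<lambda>x v. v"]) (auto intro: smooth_on_const)

lemma smooth_on_add: "open S \<Longrightarrow> smooth_on S f \<Longrightarrow> smooth_on S g \<Longrightarrow> smooth_on S (\<lambda>x. f x + g x)"
  by (simp add: smooth_on_def Ck_on_add)

lemma smooth_on_bilinear:
  "bounded_bilinear B \<Longrightarrow> open S \<Longrightarrow> smooth_on S f \<Longrightarrow> smooth_on S g \<Longrightarrow> smooth_on S (\<lambda>x. B (f x) (g x))"
  by (simp add: smooth_on_def Ck_on_bilinear)

lemma smooth_on_linear:
  "bounded_linear L \<Longrightarrow> open S \<Longrightarrow> smooth_on S f \<Longrightarrow> smooth_on S (\<lambda>x. L (f x))"
  by (simp add: smooth_on_def Ck_on_linear)

lemma smooth_on_sum: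
  "open S \<Longrightarrow> (\<And>i. i \<in> I \<Longrightarrow> smooth_on S (f i)) \<Longrightarrow> smooth_on S (\<lambda>x. \<Sum>i\<in>I. f i x)"
  by (simp add: smooth_on_def Ck_on_sum)

lemmas smooth_on_scaleR = smooth_on_bilinear[OF bounded_bilinear_scaleR]
lemmas smooth_on_mult = smooth_on_bilinear[OF bounded_bilinear_mult]
lemmas smooth_on_minus = smooth_on_linear[OF bounded_linear_minus[OF bounded_linear_ident]]
lemmas smooth_on_snd = smooth_on_linear[OF bounded_linear_snd]

lemma smooth_on_diff: "open S \<Longrightarrow> smooth_on S f \<Longrightarrow> smooth_on S g \<Longrightarrow> smooth_on S (\<lambda>x. f x - g x)"
  using smooth_on_add[OF _ _ smooth_on_minus] by fastforce

lemma smooth_on_power: "open S \<Longrightarrow> smooth_on S f \<Longrightarrow> smooth_on S (\<lambda>x. f x ^ n :: real)"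
  by (induction n) (auto intro: smooth_on_const smooth_on_mult)

section \<open>Reciprocals, square roots, composition and inverse maps\<close>

lemma Ck_on_inverse:
  fixes f :: "_ \<Rightarrow> real"
  assumes "open S" "\<And>x. x \<in> S \<Longrightarrow> f x \<noteq> 0"
  shows "Ck_on k S f \<Longrightarrow> Ck_on k S (\<lambda>x. inverse (f x))"
proof (induction k)
  case 0
  then show ?case using assms by (auto intro: continuous_on_inverse)
next
  case (Suc k)
  show ?case
  proof (rule Ck_on_SucI[OF assms(1) Deriv.has_derivative_inverse[OF _ Ck_on_SucD(1)[OF Suc.prems(1)]]])
    fix v
    let ?i = "\<lambda>x. inverse (f x)"
    have i: "Ck_on k S ?i" using Suc Ck_on_Suc_imp by blast
    have "Ck_on k S (\<lambda>x. - (?i x * frechet_derivative f (at x) v * ?i x))"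
      by (intro Ck_on_linear[OF bounded_linear_minus[OF bounded_linear_ident] assms(1)]
          Ck_on_bilinear[OF bounded_bilinear_mult assms(1)] i Ck_on_SucD(2)[OF Suc.prems])
    then show "Ck_on k S (\<lambda>x. - (inverse (f x) * frechet_derivative f (at x) v * inverse (f x)))" .
  qed (use assms in auto)
qed

lemma smooth_on_inverse:
  fixes f :: "_ \<Rightarrow> real"
  shows "open S \<Longrightarrow> (\<And>x. x \<in> S \<Longrightarrow> f x \<noteq> 0) \<Longrightarrow> smooth_on S f \<Longrightarrow> smooth_on S (\<lambda>x. inverse (f x))"
  by (simp add: smooth_on_def Ck_on_inverse)

lemma smooth_on_divide:
  fixes f g :: "_ \<Rightarrow> real"
  shows "open S \<Longrightarrow> (\<And>x. x \<in> S \<Longrightarrow> g x \<noteq> 0) \<Longrightarrow> smooth_on S f \<Longrightarrow> smooth_on S g \<Longrightarrow> smooth_on S (\<lambda>x. f x / g x)"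
  unfolding divide_inverse by (intro smooth_on_mult smooth_on_inverse) auto

lemma Ck_on_sqrt:
  assumes "open S" "\<And>x. x \<in> S \<Longrightarrow> f x > 0"
  shows "Ck_on k S f \<Longrightarrow> Ck_on k S (\<lambda>x. sqrt (f x))"
proof (induction k)
  case 0
  then show ?case using assms by (auto intro: continuous_on_real_sqrt)
next
  case (Suc k)
  show ?case
  proof (rule Ck_on_SucI[OF assms(1)])
    fix x assume x: "x \<in> S"
    show "((\<lambda>x. sqrt (f x)) has_derivative (\<lambda>v. frechet_derivative f (at x) v * (inverse (sqrt (f x)) / 2))) (at x)"
      using Ck_on_SucD(1)[OF Suc.prems x] assms(2)[OF x]
      by (auto intro!: derivative_eq_intros simp: field_simps)
  next
    fix v
    have i: "Ck_on k S (\<lambda>x. sqrt (f x))" using Suc Ck_on_Suc_imp by blast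
    have "Ck_on k S (\<lambda>x. inverse (sqrt (f x)) * (1/2))"
      by (intro Ck_on_bilinear[OF bounded_bilinear_mult assms(1)] Ck_on_inverse Ck_on_const i assms)
        (use assms in force)
    then show "Ck_on k S (\<lambda>x. frechet_derivative f (at x) v * (inverse (sqrt (f x)) / 2))"
      using Ck_on_bilinear[OF bounded_bilinear_mult assms(1) Ck_on_SucD(2)[OF Suc.prems], of "\<lambda>x. inverse (sqrt (f x)) * (1/2)" v] by simp
  qed
qed

lemma smooth_on_sqrt:
  "open S \<Longrightarrow> (\<And>x. x \<in> S \<Longrightarrow> f x > 0) \<Longrightarrow> smooth_on S f \<Longrightarrow> smooth_on S (\<lambda>x. sqrt (f x))"
  by (simp add: smooth_on_def Ck_on_sqrt)

text \<open>In the chain rule the derivative of \<open>g\<close> is applied to a moving vector,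
  whereas \<open>Ck_on\<close> controls derivatives in fixed directions only. Expanding that vector
  in the finite basis turns the derivative into a sum of products, to which the induction hypothesis
  applies with \<open>g\<close> replaced by its directional derivatives.\<close>

lemma Ck_on_compose:
  fixes f :: "'a::real_normed_vector \<Rightarrow> 'b::euclidean_space" and g :: "'b \<Rightarrow> 'c::real_normed_vector"
  assumes "open S" "f ` S \<subseteq> T"
  shows "Ck_on k T g \<Longrightarrow> Ck_on k S f \<Longrightarrow> Ck_on k S (\<lambda>x. g (f x))"
proof (induction k arbitrary: g)
  case 0
  then show ?case using assms by (auto intro: continuous_on_compose2)
next
  case (Suc k)
  let ?g' = "\<lambda>b y. frechet_derivative g (at y) b"
  let ?f' = "\<lambda>x v. frechet_derivative f (at x) v"
  show ?case
  proof (rule Ck_on_SucI[OF assms(1)])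
    fix x assume x: "x \<in> S"
    then have fx: "f x \<in> T" using assms by auto
    have l: "linear (\<lambda>v. ?g' v (f x))"
      using has_derivative_linear[OF Ck_on_SucD(1)[OF Suc.prems(1) fx]] .
    have "(\<lambda>v. ?g' (?f' x v) (f x)) = (\<lambda>v. \<Sum>b\<in>Basis. (?f' x v \<bullet> b) *\<^sub>R ?g' b (f x))"
    proof
      fix v
      define w where "w = ?f' x v"
      have "?g' w (f x) = (\<Sum>b\<in>Basis. (w \<bullet> b) *\<^sub>R ?g' b (f x))"
        using linear_sum[OF l, of "\<lambda>b. (w \<bullet> b) *\<^sub>R b" Basis] linear_cmul[OF l] by (simp add: euclidean_representation)
      then show "?g' (?f' x v) (f x) = (\<Sum>b\<in>Basis. (?f' x v \<bullet> b) *\<^sub>R ?g' b (f x))"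
        by (simp only: w_def)
    qed
    then show "((\<lambda>x. g (f x)) has_derivative (\<lambda>v. \<Sum>b\<in>Basis. (?f' x v \<bullet> b) *\<^sub>R ?g' b (f x))) (at x)"
      using has_derivative_compose[OF Ck_on_SucD(1)[OF Suc.prems(2) x] Ck_on_SucD(1)[OF Suc.prems(1) fx]]
      by (simp only:)
  next
    fix v
    show "Ck_on k S (\<lambda>x. \<Sum>b\<in>Basis. (?f' x v \<bullet> b) *\<^sub>R ?g' b (f x))"
      by (intro Ck_on_sum Ck_on_bilinear[OF bounded_bilinear_scaleR] assms(1)
          Ck_on_linear[OF bounded_linear_inner_left] Ck_on_SucD(2)[OF Suc.prems(2)] Suc.IH[of "?g' _"]
          Ck_on_SucD(2)[OF Suc.prems(1)] Ck_on_Suc_imp[OF Suc.prems(2)])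
  qed
qed

lemma smooth_on_compose:
  fixes f :: "'a::real_normed_vector \<Rightarrow> 'b::euclidean_space" and g :: "'b \<Rightarrow> 'c::real_normed_vector"
  shows "smooth_on T g \<Longrightarrow> smooth_on S f \<Longrightarrow> open S \<Longrightarrow> f ` S \<subseteq> T \<Longrightarrow> smooth_on S (\<lambda>x. g (f x))"
  by (simp add: smooth_on_def Ck_on_compose)

lemma vec_eq_sum_axis: "(\<chi> i. a i) = (\<Sum>i\<in>UNIV. axis i (a i))" for a :: "'n::finite \<Rightarrow> 'a::comm_monoid_add"
  by (simp add: vec_eq_iff axis_def if_distrib sum.delta cong: if_cong)

lemma smooth_on_vec:
  fixes f :: "'n::finite \<Rightarrow> 'a::real_normed_vector \<Rightarrow> 'b::real_normed_vector"
  assumes "open S" "\<And>i. smooth_on S (f i)"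
  shows "smooth_on S (\<lambda>x. \<chi> i. f i x)"
proof -
  have norm_axis: "norm (axis i z :: 'b^'n) \<le> norm z" for i :: 'n and z
    using L2_set_le_sum[of UNIV "\<lambda>j. norm (axis i z $ j)"]
    by (simp add: norm_vec_def axis_def if_distrib sum.delta cong: if_cong)
  have "bounded_linear (axis i :: 'b \<Rightarrow> 'b^'n)" for i :: 'n
    by (rule bounded_linear_intro[where K = 1])
      (auto simp: norm_axis, auto simp: vec_eq_iff axis_def)
  then show ?thesis unfolding vec_eq_sum_axis
    by (intro smooth_on_sum assms(1) smooth_on_linear[where L = "axis _"] assms(2))
qed

text \<open>For each order of differentiability, the chain rule applied to \<open>Dg = (Df)\<^sup>-\<^sup>1 \<circ> g\<close> gains one derivative.\<close>

lemma smooth_on_inverse_map: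
  fixes g :: "'b::real_normed_vector \<Rightarrow> 'a::euclidean_space"
  assumes "open T" "\<And>y. y \<in> T \<Longrightarrow> (g has_derivative (\<lambda>v. h v (g y))) (at y)"
    and "g ` T \<subseteq> S" "\<And>v. smooth_on S (h v)"
  shows "smooth_on T g"
proof -
  have "Ck_on k T g" for k
  proof (induction k)
    case 0
    show ?case unfolding Ck_on.simps
      by (intro continuous_at_imp_continuous_on ballI has_derivative_continuous[OF assms(2)])
  next
    case (Suc k)
    have "Ck_on k T (\<lambda>y. h v (g y))" for v
      using Ck_on_compose[OF assms(1,3) _ Suc] assms(4) unfolding smooth_on_def by blast
    then show ?case by (intro Ck_on_SucI[OF assms(1), where f' = "\<lambda>y v. h v (g y)"] assms(2))
  qed
  then show ?thesis by (simp add: smooth_on_def)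
qed

text \<open>The difference in direction \<open>b\<close> is differentiated along \<open>a\<close>
  and the result along \<open>b\<close>, each by the one-variable mean value theorem. The second
  difference is symmetric in \<open>a\<close> and \<open>b\<close>, which is its use.\<close>

lemma second_difference_mvt:
  fixes f :: "'a::real_normed_vector \<Rightarrow> real"
  assumes f: "smooth_on S f" and h: "h > 0"
    and seg: "\<And>s t. 0 \<le> s \<Longrightarrow> s \<le> h \<Longrightarrow> 0 \<le> t \<Longrightarrow> t \<le> h \<Longrightarrow> u + s *\<^sub>R a + t *\<^sub>R b \<in> S"
  shows "\<exists>s t. 0 < s \<and> s < h \<and> 0 < t \<and> t < h \<and>
     f (u + h *\<^sub>R a + h *\<^sub>R b) - f (u + h *\<^sub>R a) - f (u + h *\<^sub>R b) + f u =
     h\<^sup>2 * frechet_derivative (\<lambda>x. frechet_derivative f (at x) a) (at (u + s *\<^sub>R a + t *\<^sub>R b)) b"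
proof -
  let ?Da = "\<lambda>x. frechet_derivative f (at x) a"
  have line: "((\<lambda>s. g (p + s *\<^sub>R v)) has_real_derivative frechet_derivative g (at (p + s *\<^sub>R v)) v) (at s)"
    if "smooth_on S g" "p + s *\<^sub>R v \<in> S" for g :: "'a \<Rightarrow> real" and p s v
  proof -
    have d: "(g has_derivative frechet_derivative g (at (p + s *\<^sub>R v))) (at (p + s *\<^sub>R v))"
      using smooth_on_has_derivative that by blast
    have "((\<lambda>s. g (p + s *\<^sub>R v)) has_derivative (\<lambda>k. frechet_derivative g (at (p + s *\<^sub>R v)) (k *\<^sub>R v))) (at s)"
      by (rule has_derivative_compose[where g = g and f = "\<lambda>s. p + s *\<^sub>R v", OF _ d]) (auto intro!: derivative_eq_intros)
    moreover have "(\<lambda>k. frechet_derivative g (at (p + s *\<^sub>R v)) (k *\<^sub>R v)) = (*) (frechet_derivative g (at (p + s *\<^sub>R v)) v)"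
      using linear_cmul[OF has_derivative_linear[OF d]] by (auto simp: mult.commute)
    ultimately show ?thesis unfolding has_field_derivative_def by (simp only:)
  qed
  define \<phi> where "\<phi> s = f ((u + h *\<^sub>R b) + s *\<^sub>R a) - f (u + s *\<^sub>R a)" for s
  have "\<exists>s. 0 < s \<and> s < h \<and> \<phi> h - \<phi> 0 = (h - 0) * (?Da ((u + h *\<^sub>R b) + s *\<^sub>R a) - ?Da (u + s *\<^sub>R a))"
    unfolding \<phi>_def
  proof (rule MVT2[OF h], rule DERIV_diff)
    fix s assume s: "0 \<le> s" "s \<le> h"
    show "((\<lambda>s. f ((u + h *\<^sub>R b) + s *\<^sub>R a)) has_real_derivative ?Da ((u + h *\<^sub>R b) + s *\<^sub>R a)) (at s)"
      by (rule line[OF f]) (use seg[OF s, of h] h in \<open>simp add: algebra_simps\<close>)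
    show "((\<lambda>s. f (u + s *\<^sub>R a)) has_real_derivative ?Da (u + s *\<^sub>R a)) (at s)"
      by (rule line[OF f]) (use seg[OF s, of 0] h in simp)
  qed
  then obtain s where s: "0 < s" "s < h"
    and 1: "\<phi> h - \<phi> 0 = h * (?Da ((u + s *\<^sub>R a) + h *\<^sub>R b) - ?Da (u + s *\<^sub>R a))"
    by (auto simp: algebra_simps)
  have "\<exists>t. 0 < t \<and> t < h \<and> ?Da ((u + s *\<^sub>R a) + h *\<^sub>R b) - ?Da ((u + s *\<^sub>R a) + 0 *\<^sub>R b) =
      (h - 0) * frechet_derivative ?Da (at ((u + s *\<^sub>R a) + t *\<^sub>R b)) b"
  proof (rule MVT2[OF h])
    fix t assume t: "0 \<le> t" "t \<le> h"
    show "((\<lambda>t. ?Da ((u + s *\<^sub>R a) + t *\<^sub>R b)) has_real_derivative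
        frechet_derivative ?Da (at ((u + s *\<^sub>R a) + t *\<^sub>R b)) b) (at t)"
      by (rule line[OF smooth_on_deriv[OF f]]) (use seg[of s t] s t in simp)
  qed
  then obtain t where t: "0 < t" "t < h" and 2: "?Da ((u + s *\<^sub>R a) + h *\<^sub>R b) - ?Da (u + s *\<^sub>R a) =
      h * frechet_derivative ?Da (at (u + s *\<^sub>R a + t *\<^sub>R b)) b"
    by auto
  have "f (u + h *\<^sub>R a + h *\<^sub>R b) - f (u + h *\<^sub>R a) - f (u + h *\<^sub>R b) + f u = \<phi> h - \<phi> 0"
    by (simp add: \<phi>_def algebra_simps)
  also have "\<dots> = h\<^sup>2 * frechet_derivative ?Da (at (u + s *\<^sub>R a + t *\<^sub>R b)) b"
    unfolding 1 2 by (simp add: power2_eq_square)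
  finally show ?thesis using s t by blast
qed

text \<open>Each mixed derivative, taken at some point near \<open>u\<close>, equals the same second
  difference divided by \<open>h\<^sup>2\<close>; continuity of the second derivatives moves both
  points to \<open>u\<close>.\<close>

lemma second_derivative_symmetric_real:
  fixes f :: "'a::real_normed_vector \<Rightarrow> real"
  assumes f: "smooth_on S f" and S: "open S" and u: "u \<in> S"
  shows "frechet_derivative (\<lambda>x. frechet_derivative f (at x) a) (at u) b =
         frechet_derivative (\<lambda>x. frechet_derivative f (at x) b) (at u) a"
proof -
  define P where "P x = frechet_derivative (\<lambda>x. frechet_derivative f (at x) a) (at x) b" for x
  define Q where "Q x = frechet_derivative (\<lambda>x. frechet_derivative f (at x) b) (at x) a" for x
  have "continuous_on S P" "continuous_on S Q"
    unfolding P_def Q_def by (intro smooth_on_imp_continuous_on smooth_on_deriv f)+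
  then have PQ: "isCont P u" "isCont Q u"
    using S u continuous_on_eq_continuous_at by blast+
  have "\<bar>P u - Q u\<bar> \<le> 2 * e" if e: "e > 0" for e
  proof -
    obtain d1 where d1: "d1 > 0" "\<And>x. dist x u < d1 \<Longrightarrow> \<bar>P x - P u\<bar> < e"
      using PQ(1) e unfolding continuous_at_eps_delta dist_real_def by metis
    obtain d2 where d2: "d2 > 0" "\<And>x. dist x u < d2 \<Longrightarrow> \<bar>Q x - Q u\<bar> < e"
      using PQ(2) e unfolding continuous_at_eps_delta dist_real_def by metis
    obtain d3 where d3: "d3 > 0" "\<And>x. dist x u < d3 \<Longrightarrow> x \<in> S"
      using S u unfolding open_dist by blast
    define d where "d = min d1 (min d2 d3)"
    \<comment> \<open>The summand 1 keeps \<open>N\<close> positive when both directions vanish;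
      with this \<open>h\<close> the whole parallelogram stays within distance \<open>d / 2\<close>
      of \<open>u\<close>.\<close>
    define N where "N = norm a + norm b + 1"
    define h where "h = d / (2 * N)"
    have pos: "N > 0" by (simp add: N_def add_nonneg_pos)
    have d: "d > 0" using d1 d2 d3 by (simp add: d_def)
    then have h: "h > 0" using pos by (simp add: h_def)
    have near: "dist (u + s *\<^sub>R a + t *\<^sub>R b) u < d" if "0 \<le> s" "s \<le> h" "0 \<le> t" "t \<le> h" for s t
    proof -
      have "dist (u + s *\<^sub>R a + t *\<^sub>R b) u = norm (s *\<^sub>R a + t *\<^sub>R b)" by (simp add: dist_norm)
      also have "\<dots> \<le> s * norm a + t * norm b"
        using that by (intro norm_triangle_le) simp
      also have "\<dots> \<le> h * norm a + h * norm b"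
        using that by (intro add_mono mult_right_mono) auto
      also have "\<dots> \<le> h * N" using h by (simp add: N_def algebra_simps)
      also have "\<dots> = d / 2" using pos by (simp add: h_def)
      finally show ?thesis using d by simp
    qed
    have near': "dist (u + s *\<^sub>R b + t *\<^sub>R a) u < d" if "0 \<le> s" "s \<le> h" "0 \<le> t" "t \<le> h" for s t
      using near[of t s] that by (simp add: algebra_simps)
    define \<Delta> where "\<Delta> = f (u + h *\<^sub>R a + h *\<^sub>R b) - f (u + h *\<^sub>R a) - f (u + h *\<^sub>R b) + f u"
    obtain s t where st: "0 < s" "s < h" "0 < t" "t < h" "\<Delta> = h\<^sup>2 * P (u + s *\<^sub>R a + t *\<^sub>R b)"
      using second_difference_mvt[OF f h, of u a b] near d3(2) unfolding P_def \<Delta>_def d_def by auto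
    have "\<Delta> = f (u + h *\<^sub>R b + h *\<^sub>R a) - f (u + h *\<^sub>R b) - f (u + h *\<^sub>R a) + f u"
      by (simp add: \<Delta>_def algebra_simps)
    then obtain s' t' where st': "0 < s'" "s' < h" "0 < t'" "t' < h" "\<Delta> = h\<^sup>2 * Q (u + s' *\<^sub>R b + t' *\<^sub>R a)"
      using second_difference_mvt[OF f h, of u b a] near' d3(2) unfolding Q_def d_def by auto
    have "P (u + s *\<^sub>R a + t *\<^sub>R b) = Q (u + s' *\<^sub>R b + t' *\<^sub>R a)"
      using st(5) st'(5) h by simp
    moreover have "\<bar>P (u + s *\<^sub>R a + t *\<^sub>R b) - P u\<bar> < e"
      using near[of s t] st by (intro d1(2)) (simp add: d_def)
    moreover have "\<bar>Q (u + s' *\<^sub>R b + t' *\<^sub>R a) - Q u\<bar> < e"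
      using near'[of s' t'] st' by (intro d2(2)) (simp add: d_def)
    ultimately show ?thesis by linarith
  qed
  then have "\<bar>P u - Q u\<bar> \<le> 0 + e" if "e > 0" for e
    using that by (metis add_0 field_sum_of_halves half_gt_zero mult_2)
  then have "\<bar>P u - Q u\<bar> \<le> 0" by (rule field_le_epsilon)
  then show ?thesis by (simp add: P_def Q_def)
qed

lemma frechet_derivative_linear:
  assumes "bounded_linear L" "(f has_derivative f') (at x)"
  shows "frechet_derivative (\<lambda>x. L (f x)) (at x) v = L (f' v)"
  using frechet_derivative_at[OF bounded_linear.has_derivative[OF assms]] by metis

lemma second_derivative_symmetric:
  fixes f :: "'a::real_normed_vector \<Rightarrow> 'b::euclidean_space"
  assumes f: "smooth_on S f" and S: "open S" and u: "u \<in> S"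
  shows "frechet_derivative (\<lambda>x. frechet_derivative f (at x) a) (at u) b =
         frechet_derivative (\<lambda>x. frechet_derivative f (at x) b) (at u) a"
proof (rule euclidean_eqI)
  fix c :: 'b
  let ?f = "\<lambda>x. f x \<bullet> c"
  note bl = bounded_linear_inner_left[of c]
  have *: "frechet_derivative (\<lambda>x. frechet_derivative ?f (at x) v) (at u) w =
      frechet_derivative (\<lambda>x. frechet_derivative f (at x) v) (at u) w \<bullet> c" for v w
  proof -
    let ?g = "\<lambda>x. frechet_derivative f (at x) v"
    have g: "smooth_on S ?g" by (intro smooth_on_deriv f)
    have "((\<lambda>x. ?g x \<bullet> c) has_derivative (\<lambda>w. frechet_derivative ?g (at u) w \<bullet> c)) (at u)"
      by (rule bounded_linear.has_derivative[OF bl smooth_on_has_derivative[OF g u]])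
    then have "((\<lambda>x. frechet_derivative ?f (at x) v) has_derivative (\<lambda>w. frechet_derivative ?g (at u) w \<bullet> c)) (at u)"
      by (rule has_derivative_transform_within_open[OF _ S u])
        (simp add: frechet_derivative_linear[OF bl smooth_on_has_derivative[OF f]])
    then show ?thesis using frechet_derivative_at by metis
  qed
  show "frechet_derivative (\<lambda>x. frechet_derivative f (at x) a) (at u) b \<bullet> c =
        frechet_derivative (\<lambda>x. frechet_derivative f (at x) b) (at u) a \<bullet> c"
    using second_derivative_symmetric_real[OF smooth_on_linear[OF bl S f] S u, of a b] unfolding * .
qed

text \<open>The primitive is the radial integral of \<open>P\<close> from \<open>u0\<close>. After
  differentiation under the integral, symmetry of the derivative of \<open>P\<close> turns the
  integrand into a total derivative in the path parameter. The one-form is encoded by its euclidean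
  dual field \<open>P\<close>, so closedness is that symmetry.\<close>

lemma poincare_lemma:
  fixes P :: "'a::euclidean_space \<Rightarrow> 'a"
  assumes B: "open B" "convex B" "u0 \<in> B" and P: "smooth_on B P"
    and closed: "\<And>x v w. x \<in> B \<Longrightarrow> frechet_derivative P (at x) v \<bullet> w = frechet_derivative P (at x) w \<bullet> v"
  shows "\<exists>X. \<forall>x\<in>B. (X has_derivative (\<lambda>h. P x \<bullet> h)) (at x)"
proof -
  let ?DP = "\<lambda>x. frechet_derivative P (at x)"
  define \<gamma> where "\<gamma> x t = u0 + t *\<^sub>R (x - u0)" for x and t :: real
  have \<gamma>B: "\<gamma> x t \<in> B" if "x \<in> B" "t \<in> cbox 0 1" for x t
  proof -
    have "\<gamma> x t = (1 - t) *\<^sub>R u0 + t *\<^sub>R x" by (simp add: \<gamma>_def algebra_simps)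
    then show ?thesis using that B convexD_alt[of B u0 x t] by simp
  qed
  \<comment> \<open>\<open>a b\<close> is the derivative of the integrand in direction
    \<open>b\<close>; \<open>fx\<close> collects these into a bounded linear functional, the form in
    which the Leibniz rule takes a derivative.\<close>
  define a where "a b x t = t * (?DP (\<gamma> x t) b \<bullet> (x - u0)) + P (\<gamma> x t) \<bullet> b" for b x t
  define fx where "fx x t = (\<Sum>b\<in>Basis. a b x t *\<^sub>R blinfun_inner_right b)" for x t
  have DPlin: "linear (?DP x)" if "x \<in> B" for x
    using has_derivative_linear[OF smooth_on_has_derivative[OF P that]] .
  have fx_apply: "blinfun_apply (fx x t) h = t * (?DP (\<gamma> x t) h \<bullet> (x - u0)) + P (\<gamma> x t) \<bullet> h"
    if "x \<in> B" "t \<in> cbox 0 1" for x t h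
  proof -
    have "blinfun_apply (fx x t) h = (\<Sum>b\<in>Basis. a b x t * (b \<bullet> h))"
      by (simp add: fx_def blinfun.sum_left blinfun.scaleR_left)
    also have "\<dots> = t * ((\<Sum>b\<in>Basis. (h \<bullet> b) *\<^sub>R ?DP (\<gamma> x t) b) \<bullet> (x - u0)) + P (\<gamma> x t) \<bullet> (\<Sum>b\<in>Basis. (h \<bullet> b) *\<^sub>R b)"
      by (simp add: a_def inner_sum_left inner_sum_right sum.distrib sum_subtractf sum_distrib_left algebra_simps inner_commute)
    also have "(\<Sum>b\<in>Basis. (h \<bullet> b) *\<^sub>R ?DP (\<gamma> x t) b) = ?DP (\<gamma> x t) h"
      using linear_sum[OF DPlin[OF \<gamma>B[OF that]], of "\<lambda>b. (h \<bullet> b) *\<^sub>R b" Basis]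
        linear_cmul[OF DPlin[OF \<gamma>B[OF that]]] by (simp add: euclidean_representation)
    finally show ?thesis by (simp add: euclidean_representation)
  qed
  have cont_comp: "continuous_on (B \<times> cbox 0 1) (\<lambda>p. g (\<gamma> (fst p) (snd p)))"
    if "continuous_on B g" for g :: "'a \<Rightarrow> 'a"
    by (rule continuous_on_compose2[OF that]) (auto simp: \<gamma>B intro!: continuous_intros, auto simp: \<gamma>_def intro!: continuous_intros)
  have cont_fx: "continuous_on (B \<times> cbox 0 1) (\<lambda>(x, t). fx x t)"
    unfolding fx_def a_def split_def
    by (intro continuous_intros cont_comp smooth_on_imp_continuous_on[OF P]
        smooth_on_imp_continuous_on[OF smooth_on_deriv[OF P]])
  define f where "f x t = P (\<gamma> x t) \<bullet> (x - u0)" for x t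
  define X where "X x = integral (cbox 0 1) (f x)" for x
  have derf: "((\<lambda>x. f x t) has_derivative blinfun_apply (fx x t)) (at x within B)"
    if "x \<in> B" "t \<in> cbox 0 1" for x t
  proof -
    have "((\<lambda>x. \<gamma> x t) has_derivative (\<lambda>h. t *\<^sub>R h)) (at x within B)"
      unfolding \<gamma>_def by (auto intro!: derivative_eq_intros)
    from has_derivative_compose[OF this smooth_on_has_derivative[OF P \<gamma>B[OF that]]]
    have "((\<lambda>x. P (\<gamma> x t)) has_derivative (\<lambda>h. t *\<^sub>R ?DP (\<gamma> x t) h)) (at x within B)"
      using linear_cmul[OF DPlin[OF \<gamma>B[OF that]]] by simp
    then have "((\<lambda>x. f x t) has_derivative (\<lambda>h. P (\<gamma> x t) \<bullet> h + (t *\<^sub>R ?DP (\<gamma> x t) h) \<bullet> (x - u0))) (at x within B)"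
      unfolding f_def by (auto intro!: derivative_eq_intros)
    moreover have "(\<lambda>h. P (\<gamma> x t) \<bullet> h + (t *\<^sub>R ?DP (\<gamma> x t) h) \<bullet> (x - u0)) = blinfun_apply (fx x t)"
      by (simp add: fx_apply[OF that] fun_eq_iff)
    ultimately show ?thesis by simp
  qed
  have contf: "f x integrable_on cbox 0 1" if "x \<in> B" for x
  proof (rule integrable_continuous)
    have "continuous_on (cbox 0 1) (\<lambda>t. P (\<gamma> x t))"
      by (rule continuous_on_compose2[OF smooth_on_imp_continuous_on[OF P]])
        (use \<gamma>B[OF that] in \<open>auto simp: \<gamma>_def intro!: continuous_intros\<close>)
    then show "continuous_on (cbox 0 1) (f x)" unfolding f_def by (intro continuous_intros)
  qed
  have int: "(fx x has_integral (\<Sum>b\<in>Basis. (P x \<bullet> b) *\<^sub>R blinfun_inner_right b)) (cbox 0 1)" if x: "x \<in> B" for x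
  proof -
    \<comment> \<open>An antiderivative of \<open>fx x\<close>: the factor \<open>t\<close> makes it
      vanish at 0, and at 1 the path has reached \<open>x\<close>.\<close>
    define \<Phi> where "\<Phi> t = (\<Sum>b\<in>Basis. (t * (P (\<gamma> x t) \<bullet> b)) *\<^sub>R blinfun_inner_right b)" for t
    have "(\<Phi> has_vector_derivative fx x t) (at t within {0..1})" if t: "t \<in> {0..1}" for t
    proof -
      have t': "t \<in> cbox 0 1" using t by simp
      have "((\<lambda>t. \<gamma> x t) has_derivative (\<lambda>k. k *\<^sub>R (x - u0))) (at t within {0..1})"
        unfolding \<gamma>_def by (auto intro!: derivative_eq_intros)
      from has_derivative_compose[OF this smooth_on_has_derivative[OF P \<gamma>B[OF x t']]]
      have "((\<lambda>t. P (\<gamma> x t)) has_vector_derivative ?DP (\<gamma> x t) (x - u0)) (at t within {0..1})"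
        using linear_cmul[OF DPlin[OF \<gamma>B[OF x t']]] by (simp add: has_vector_derivative_def)
      then have "((\<lambda>t. P (\<gamma> x t) \<bullet> b) has_real_derivative ?DP (\<gamma> x t) (x - u0) \<bullet> b) (at t within {0..1})" for b
        using bounded_linear.has_vector_derivative[OF bounded_linear_inner_left]
        by (auto simp: has_real_derivative_iff_has_vector_derivative)
      then have "((\<lambda>t. t * (P (\<gamma> x t) \<bullet> b)) has_real_derivative a b x t) (at t within {0..1})" for b
        using closed[OF \<gamma>B[OF x t'], of b "x - u0"]
        by (auto simp: a_def intro!: derivative_eq_intros)
      then show ?thesis unfolding \<Phi>_def fx_def has_real_derivative_iff_has_vector_derivative
        by (intro has_vector_derivative_sum bounded_linear.has_vector_derivative[OF bounded_linear_scaleR_left])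
    qed
    then have "(fx x has_integral (\<Phi> 1 - \<Phi> 0)) {0..1}"
      by (intro fundamental_theorem_of_calculus) auto
    then show ?thesis by (simp add: \<Phi>_def \<gamma>_def)
  qed
  have "(X has_derivative (\<lambda>h. P x \<bullet> h)) (at x)" if x: "x \<in> B" for x
  proof -
    have "(X has_derivative blinfun_apply (integral (cbox 0 1) (fx x))) (at x within B)"
      unfolding X_def[abs_def] by (rule leibniz_rule[OF derf contf cont_fx x B(2)])
    moreover have "blinfun_apply (integral (cbox 0 1) (fx x)) = (\<lambda>h. P x \<bullet> h)"
    proof
      fix h
      have "blinfun_apply (integral (cbox 0 1) (fx x)) h = (\<Sum>b\<in>Basis. (P x \<bullet> b) * (h \<bullet> b))"
        unfolding integral_unique[OF int[OF x]]
        by (simp add: blinfun.sum_left blinfun.scaleR_left inner_commute)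
      then show "blinfun_apply (integral (cbox 0 1) (fx x)) h = P x \<bullet> h"
        by (simp only: euclidean_inner[of "P x" h])
    qed
    ultimately show ?thesis by (simp only: at_within_open[OF x B(1)])
  qed
  then show ?thesis by blast
qed

section \<open>Null vectors and adapted frames\<close>

lemma matrix_inv_2:
  fixes g :: "real^2^2"
  assumes "det g \<noteq> 0"
  shows "matrix_inv g = (\<chi> i j. (if i = j then (if i = 1 then g$2$2 else g$1$1) else - g$i$j) / det g)" (is "_ = ?h")
proof -
  define d where "d = det g"
  have d: "g$1$1 * g$2$2 - g$1$2 * g$2$1 = d" "d \<noteq> 0" using assms by (simp_all add: d_def det_2)
  have h: "g ** ?h = mat 1" "?h ** g = mat 1"
    using d(2) unfolding d_def[symmetric]
    by (simp_all add: vec_eq_iff forall_2 matrix_matrix_mult_def sum_2 mat_def add_divide_distrib[symmetric]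
        diff_divide_distrib[symmetric] divide_eq_eq) (use d(1) in \<open>simp_all add: algebra_simps\<close>)
  then have inv: "invertible g" unfolding invertible_def by blast
  have "matrix_inv g ** g = mat 1"
    unfolding matrix_inv_def using someI_ex[OF inv[unfolded invertible_def]] by blast
  then have "?h = (matrix_inv g ** g) ** ?h" by simp
  also have "\<dots> = matrix_inv g" by (simp add: matrix_mul_assoc[symmetric] h)
  finally show ?thesis by simp
qed

lemma trace_wrt_2:
  fixes g :: "real^2^2" and T :: "'b::real_vector^2^2"
  assumes "det g \<noteq> 0"
  shows "trace_wrt g T = (1 / det g) *\<^sub>R (g$2$2 *\<^sub>R T$1$1 - g$1$2 *\<^sub>R T$1$2 - g$2$1 *\<^sub>R T$2$1 + g$1$1 *\<^sub>R T$2$2)"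
  unfolding trace_wrt_def matrix_inv_2[OF assms] by (simp add: sum_2 algebra_simps)

section \<open>The Lorentz form and null vectors\<close>

lemma bounded_bilinear_lorentz: "bounded_bilinear lorentz"
proof -
  have "bounded_linear (\<lambda>w :: mink. (fst w, - snd w))"
    by (intro bounded_linear_Pair bounded_linear_fst bounded_linear_minus bounded_linear_snd)
  from bounded_bilinear.comp[OF bounded_bilinear_inner bounded_linear_ident this]
  show ?thesis by (simp add: lorentz_def[abs_def] inner_prod_def)
qed

interpretation lorentz: bounded_bilinear lorentz
  by (rule bounded_bilinear_lorentz)

lemmas smooth_on_lorentz = smooth_on_bilinear[OF bounded_bilinear_lorentz]

lemmas lorentz_simps = lorentz.add_left lorentz.add_right lorentz.diff_left lorentz.diff_right
  lorentz.scaleR_left lorentz.scaleR_right lorentz.minus_left lorentz.minus_right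
  lorentz.zero_left lorentz.zero_right

lemma lorentz_commute: "lorentz v w = lorentz w v"
  by (simp add: lorentz_def inner_commute)

lemma lorentz_nondegenerate:
  assumes "\<And>w. lorentz v w = 0" shows "v = 0"
proof -
  have "v \<bullet> v = lorentz v (fst v, - snd v)" by (simp add: lorentz_def inner_prod_def)
  then show ?thesis using assms by simp
qed

text \<open>Subtracting the multiple of \<open>s\<close> that removes the last coordinate does not
  change the square of \<open>w\<close>, because \<open>s\<close> is null and orthogonal to
  \<open>w\<close>; what is left is an ordinary euclidean vector. So the form is semidefinite on the
  complement of a null line and degenerate only along that line.\<close>

lemma null_perp:
  assumes s: "lorentz s s = 0" "snd s \<noteq> 0" and w: "lorentz w s = 0"
  shows "lorentz w w \<ge> 0" and "lorentz w w = 0 \<Longrightarrow> w = (snd w / snd s) *\<^sub>R s"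
proof -
  define z where "z = w - (snd w / snd s) *\<^sub>R s"
  have z0: "snd z = 0" using s(2) by (simp add: z_def)
  have "lorentz w w = lorentz z z"
    using s(1) w by (simp add: z_def lorentz_simps lorentz_commute[of s w])
  also have "\<dots> = fst z \<bullet> fst z" by (simp add: lorentz_def z0)
  finally have *: "lorentz w w = fst z \<bullet> fst z" .
  show "lorentz w w \<ge> 0" by (simp add: *)
  show "w = (snd w / snd s) *\<^sub>R s" if "lorentz w w = 0"
  proof -
    have "fst z = 0" using that * by simp
    then have "z = 0" using z0 by (simp add: prod_eq_iff)
    then show ?thesis by (simp add: z_def)
  qed
qed

definition gram2 :: "mink \<Rightarrow> mink \<Rightarrow> real" where
  "gram2 a b = lorentz a a * lorentz b b - (lorentz a b)\<^sup>2"

text \<open>Cramer's rule for the orthogonal projection to the plane of \<open>a\<close> and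
  \<open>b\<close>. With explicit quotients, smooth dependence on the three vectors is
  immediate.\<close>

definition proj2 :: "mink \<Rightarrow> mink \<Rightarrow> mink \<Rightarrow> mink" where
  "proj2 a b v = ((lorentz v a * lorentz b b - lorentz v b * lorentz a b) / gram2 a b) *\<^sub>R a +
                 ((lorentz v b * lorentz a a - lorentz v a * lorentz a b) / gram2 a b) *\<^sub>R b"

lemma lorentz_proj2:
  assumes "gram2 a b \<noteq> 0"
  shows "lorentz (proj2 a b v) a = lorentz v a" "lorentz (proj2 a b v) b = lorentz v b"
proof -
  define D where "D = gram2 a b"
  have D: "D = lorentz a a * lorentz b b - lorentz a b * lorentz a b" "D \<noteq> 0"
    using assms by (simp_all add: D_def gram2_def power2_eq_square)
  have "lorentz (proj2 a b v) a = ((lorentz v a * lorentz b b - lorentz v b * lorentz a b) * lorentz a a +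
      (lorentz v b * lorentz a a - lorentz v a * lorentz a b) * lorentz a b) / D"
    by (simp only: proj2_def D_def[symmetric] lorentz_simps lorentz_commute[of b a] times_divide_eq_left add_divide_distrib real_scaleR_def)
  also have "\<dots> = (lorentz v a * D) / D" by (simp add: D(1) algebra_simps)
  finally show "lorentz (proj2 a b v) a = lorentz v a" using D(2) by simp
  have "lorentz (proj2 a b v) b = ((lorentz v a * lorentz b b - lorentz v b * lorentz a b) * lorentz a b +
      (lorentz v b * lorentz a a - lorentz v a * lorentz a b) * lorentz b b) / D"
    by (simp only: proj2_def D_def[symmetric] lorentz_simps lorentz_commute[of b a] times_divide_eq_left add_divide_distrib real_scaleR_def)
  also have "\<dots> = (lorentz v b * D) / D" by (simp add: D(1) algebra_simps)
  finally show "lorentz (proj2 a b v) b = lorentz v b" using D(2) by simp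
qed

lemma lorentz_proj2_perp:
  assumes "lorentz a c = 0" "lorentz b c = 0"
  shows "lorentz (proj2 a b v) c = 0"
  by (simp add: proj2_def lorentz_simps assms)

text \<open>The adapted frame at a point: \<open>s\<close> is the gauge, \<open>a\<close> and
  \<open>b\<close> its partial derivatives, \<open>n\<close> the normal of a sphere and
  \<open>h\<close> the complementary null vector. The two inequalities say that \<open>a\<close> and
  \<open>b\<close> span a positive definite plane.\<close>

definition frame :: "mink \<Rightarrow> mink \<Rightarrow> mink \<Rightarrow> mink \<Rightarrow> mink \<Rightarrow> bool" where
  "frame s a b n h \<longleftrightarrow> lorentz s s = 0 \<and> lorentz a s = 0 \<and> lorentz b s = 0 \<and> lorentz n s = 0 \<and> lorentz h s = -1 \<and>
     lorentz n n = 1 \<and> lorentz n a = 0 \<and> lorentz n b = 0 \<and> lorentz n h = 0 \<and>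
     lorentz h h = 0 \<and> lorentz h a = 0 \<and> lorentz h b = 0 \<and> lorentz a a > 0 \<and> gram2 a b > 0"

lemma frame_simps:
  assumes "frame s a b n h"
  shows "lorentz s s = 0" "lorentz a s = 0" "lorentz b s = 0" "lorentz n s = 0" "lorentz h s = -1"
    "lorentz s a = 0" "lorentz s b = 0" "lorentz s n = 0" "lorentz s h = -1"
    "lorentz n n = 1" "lorentz n a = 0" "lorentz n b = 0" "lorentz n h = 0"
    "lorentz a n = 0" "lorentz b n = 0" "lorentz h n = 0"
    "lorentz h h = 0" "lorentz h a = 0" "lorentz h b = 0" "lorentz a h = 0" "lorentz b h = 0"
    "lorentz a a > 0" "gram2 a b > 0" "gram2 a b \<noteq> 0"
  using assms unfolding frame_def by (simp_all add: lorentz_commute)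

text \<open>The coefficients of \<open>s\<close> and \<open>h\<close> are exchanged and negated
  because both vectors are null with product -1.\<close>

definition frame_comb :: "mink \<Rightarrow> mink \<Rightarrow> mink \<Rightarrow> mink \<Rightarrow> mink \<Rightarrow> mink \<Rightarrow> mink" where
  "frame_comb s a b n h v = proj2 a b v + lorentz v n *\<^sub>R n - lorentz v h *\<^sub>R s - lorentz v s *\<^sub>R h"

lemma vector_4:
  "(vector [x, y, z, w] :: 'a::zero^4) $ 1 = x" "(vector [x, y, z, w] :: 'a^4) $ 2 = y"
  "(vector [x, y, z, w] :: 'a^4) $ 3 = z" "(vector [x, y, z, w] :: 'a^4) $ 4 = w"
  unfolding vector_def by simp_all

text \<open>The five products form a linear map from \<open>mink\<close> to itself. Explicit
  preimages, with the tangential part found by Cramer's rule, show surjectivity, and finite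
  dimension gives injectivity.\<close>

lemma frame_zero:
  assumes f: "frame s a b n h"
    and v: "lorentz v s = 0" "lorentz v a = 0" "lorentz v b = 0" "lorentz v n = 0" "lorentz v h = 0"
  shows "v = 0"
proof -
  note fs = frame_simps[OF f]
  define \<phi> :: "mink \<Rightarrow> mink" where
    "\<phi> v = (vector [lorentz v s, lorentz v a, lorentz v b, lorentz v n], lorentz v h)" for v
  have lin: "linear \<phi>"
    by (rule linearI) (simp_all add: \<phi>_def lorentz_simps vec_eq_iff forall_4 vector_4)
  have "surj \<phi>"
  proof (rule surjI)
    fix t :: mink
    let ?p = "\<lambda>i. fst t $ i"
    let ?D = "gram2 a b"
    define x where "x = (?p 2 * lorentz b b - ?p 3 * lorentz a b) / ?D"
    define y where "y = (?p 3 * lorentz a a - ?p 2 * lorentz a b) / ?D"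
    have 1: "x * lorentz a a + y * lorentz a b = ?p 2"
      using fs(24) by (simp add: x_def y_def divide_simps) (simp add: gram2_def power2_eq_square algebra_simps)
    have 2: "x * lorentz a b + y * lorentz b b = ?p 3"
      using fs(24) by (simp add: x_def y_def divide_simps) (simp add: gram2_def power2_eq_square algebra_simps)
    show "\<phi> ((- ?p 1) *\<^sub>R h + (- snd t) *\<^sub>R s + ?p 4 *\<^sub>R n + x *\<^sub>R a + y *\<^sub>R b) = t"
      using 1 2 by (simp add: \<phi>_def prod_eq_iff vec_eq_iff forall_4 vector_4 lorentz_simps fs lorentz_commute[of b a])
  qed
  then have inj: "inj \<phi>" by (rule linear_surjective_imp_injective[OF lin]) simp
  have "\<phi> v = \<phi> 0" using v by (simp add: \<phi>_def lorentz_simps)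
  then show ?thesis using injD[OF inj] by blast
qed

lemma frame_expand:
  assumes f: "frame s a b n h"
  shows "v = frame_comb s a b n h v"
proof -
  note fs = frame_simps[OF f] lorentz_proj2[OF frame_simps(24)[OF f]]
  have "v - frame_comb s a b n h v = 0"
    by (rule frame_zero[OF f]) (simp_all add: frame_comb_def lorentz_simps fs lorentz_proj2_perp)
  then show ?thesis by simp
qed

text \<open>The timelike vector \<open>(0, 1)\<close> is made orthogonal to \<open>a\<close>, \<open>b\<close> and then moved along \<open>s\<close> onto the light cone.\<close>

definition dual0 :: "mink \<Rightarrow> mink \<Rightarrow> mink \<Rightarrow> mink" where
  "dual0 s a b = (let y = (0, 1) - proj2 a b (0, 1) in (1 / snd s) *\<^sub>R y + (lorentz y y / (2 * (snd s)\<^sup>2)) *\<^sub>R s)"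

lemma dual0_props:
  assumes "lorentz s s = 0" "lorentz a s = 0" "lorentz b s = 0" "snd s \<noteq> 0" "gram2 a b \<noteq> 0"
  shows "lorentz (dual0 s a b) s = -1" "lorentz (dual0 s a b) a = 0" "lorentz (dual0 s a b) b = 0"
    "lorentz (dual0 s a b) (dual0 s a b) = 0"
proof -
  define y where "y = (0, 1) - proj2 a b (0, 1)"
  have ya: "lorentz y a = 0" "lorentz y b = 0"
    by (simp_all add: y_def lorentz_simps lorentz_proj2[OF assms(5)])
  have ys: "lorentz y s = - snd s"
    by (simp add: y_def lorentz_simps lorentz_proj2_perp[OF assms(2,3)]) (simp add: lorentz_def)
  have sc: "lorentz s a = 0" "lorentz s b = 0" using assms(2,3) by (simp_all add: lorentz_commute)
  have d: "dual0 s a b = (1 / snd s) *\<^sub>R y + (lorentz y y / (2 * (snd s)\<^sup>2)) *\<^sub>R s"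
    by (simp add: dual0_def y_def Let_def)
  show "lorentz (dual0 s a b) s = -1" "lorentz (dual0 s a b) a = 0" "lorentz (dual0 s a b) b = 0"
    using assms(4) sc by (simp_all add: d lorentz_simps ya ys assms(1))
  show "lorentz (dual0 s a b) (dual0 s a b) = 0"
    using assms(1,4) by (simp add: d lorentz_simps ys lorentz_commute[of s y] field_simps power2_eq_square)
qed

text \<open>A null rotation fixing \<open>s\<close>: subtracting \<open>d\<close> times
  \<open>n\<close> restores orthogonality to \<open>n\<close>, and \<open>d\<^sup>2 / 2\<close> is
  the multiple of \<open>s\<close> whose subtraction restores nullity.\<close>

definition dual :: "mink \<Rightarrow> mink \<Rightarrow> mink \<Rightarrow> mink \<Rightarrow> mink" where
  "dual s a b n = (let h = dual0 s a b; d = lorentz h n in h - d *\<^sub>R n - (d\<^sup>2 / 2) *\<^sub>R s)"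

lemma frame_dual:
  assumes "lorentz s s = 0" "lorentz a s = 0" "lorentz b s = 0" "snd s \<noteq> 0" "lorentz a a > 0" "gram2 a b > 0"
    and n: "lorentz n n = 1" "lorentz n s = 0" "lorentz n a = 0" "lorentz n b = 0"
  shows "frame s a b n (dual s a b n)"
proof -
  define h where "h = dual0 s a b"
  have g: "gram2 a b \<noteq> 0" using assms(6) by simp
  note h = dual0_props[OF assms(1-4) g, folded h_def]
  have d: "dual s a b n = h - lorentz h n *\<^sub>R n - ((lorentz h n)\<^sup>2 / 2) *\<^sub>R s"
    by (simp add: dual_def h_def Let_def)
  show ?thesis
    unfolding frame_def d using assms
    by (simp add: lorentz_simps h assms lorentz_commute[of s a] lorentz_commute[of s b] lorentz_commute[of s n]
        lorentz_commute[of s h] lorentz_commute[of n h] power2_eq_square)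
qed

text \<open>Removes from \<open>v\<close> its components along \<open>a\<close>, \<open>b\<close>,
  \<open>s\<close> and \<open>dual0\<close>, leaving the line orthogonal to all four. Applied to a
  fixed \<open>v\<close> along a surface it gives a smooth normal field without a choice of
  basis.\<close>

definition normal_proj :: "mink \<Rightarrow> mink \<Rightarrow> mink \<Rightarrow> mink \<Rightarrow> mink" where
  "normal_proj s a b v = (let h = dual0 s a b in v - proj2 a b v + lorentz v h *\<^sub>R s + lorentz v s *\<^sub>R h)"

lemma normal_proj_props:
  assumes "lorentz s s = 0" "lorentz a s = 0" "lorentz b s = 0" "snd s \<noteq> 0" "gram2 a b \<noteq> 0"
  shows "lorentz (normal_proj s a b v) s = 0" "lorentz (normal_proj s a b v) a = 0"
    "lorentz (normal_proj s a b v) b = 0" "lorentz (normal_proj s a b v) (dual0 s a b) = 0"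
proof -
  define h where "h = dual0 s a b"
  note h = dual0_props[OF assms, folded h_def]
  have sc: "lorentz s a = 0" "lorentz s b = 0" "lorentz s h = -1" "lorentz a h = 0" "lorentz b h = 0"
    using assms(2,3) h by (simp_all add: lorentz_commute)
  have n: "normal_proj s a b v = v - proj2 a b v + lorentz v h *\<^sub>R s + lorentz v s *\<^sub>R h"
    by (simp add: normal_proj_def Let_def h_def)
  show "lorentz (normal_proj s a b v) s = 0" "lorentz (normal_proj s a b v) a = 0"
    "lorentz (normal_proj s a b v) b = 0" "lorentz (normal_proj s a b v) (dual0 s a b) = 0"
    unfolding h_def[symmetric] n
    by (simp_all add: lorentz_simps assms h sc lorentz_proj2_perp lorentz_proj2[OF assms(5)])
qed

text \<open>Otherwise four vectors would span the five-dimensional \<open>mink\<close>.\<close>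

lemma normal_proj_nonzero:
  assumes "lorentz s s = 0" "lorentz a s = 0" "lorentz b s = 0" "snd s \<noteq> 0" "gram2 a b \<noteq> 0"
  shows "\<exists>v. normal_proj s a b v \<noteq> 0"
proof (rule ccontr)
  assume "\<not> ?thesis"
  then have z: "normal_proj s a b v = 0" for v by blast
  have "v \<in> span {a, b, s, dual0 s a b}" for v
  proof -
    have "v = proj2 a b v - lorentz v (dual0 s a b) *\<^sub>R s - lorentz v s *\<^sub>R dual0 s a b"
      using z[of v] by (simp add: normal_proj_def Let_def algebra_simps add_eq_0_iff)
    moreover have "\<dots> \<in> span {a, b, s, dual0 s a b}"
      unfolding proj2_def by (intro span_diff span_add span_scale span_base) auto
    ultimately show ?thesis by simp
  qed
  then have "span {a, b, s, dual0 s a b} = UNIV" by blast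
  then have "dim {a, b, s, dual0 s a b} = DIM(mink)" by (metis dim_UNIV dim_span)
  moreover have "dim {a, b, s, dual0 s a b} \<le> card {a, b, s, dual0 s a b}"
    by (rule dim_le_card') simp
  moreover have "card {a, b, s, dual0 s a b} \<le> 4"
    using card_length[of "[a, b, s, dual0 s a b]"] by simp
  ultimately show False by simp
qed

text \<open>Vectors orthogonal to the null \<open>s\<close> have nonnegative square, and one of
  square zero is a multiple of \<open>s\<close>; the product with \<open>dual0\<close> excludes
  every multiple but zero.\<close>

lemma normal_proj_pos:
  assumes "lorentz s s = 0" "lorentz a s = 0" "lorentz b s = 0" "snd s \<noteq> 0" "gram2 a b \<noteq> 0"
    and "normal_proj s a b v \<noteq> 0"
  shows "lorentz (normal_proj s a b v) (normal_proj s a b v) > 0"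
proof -
  let ?w = "normal_proj s a b v"
  note p = normal_proj_props[OF assms(1-5), of v]
  note q = null_perp[OF assms(1,4) p(1)]
  have "lorentz ?w ?w \<noteq> 0"
  proof
    assume 0: "lorentz ?w ?w = 0"
    then have w: "?w = (snd ?w / snd s) *\<^sub>R s" by (rule q(2))
    have "lorentz ?w (dual0 s a b) = - (snd ?w / snd s)"
      by (subst w) (simp add: lorentz_simps lorentz_commute[of s "dual0 s a b"] dual0_props[OF assms(1-5)])
    then have c: "snd ?w / snd s = 0" using p(4) by simp
    from w have "?w = 0" unfolding c by simp
    then show False using assms(6) by simp
  qed
  then show ?thesis using q(1) by simp
qed

section \<open>The central sphere congruence\<close>

lemma perp_proj:
  assumes n: "lorentz n n = 1"
  shows tan_proj_perp: "tan_proj (lorentz_perp {n}) v = v - lorentz v n *\<^sub>R n"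
    and nor_proj_perp: "nor_proj (lorentz_perp {n}) v = lorentz v n *\<^sub>R n"
proof -
  show t: "tan_proj (lorentz_perp {n}) v = v - lorentz v n *\<^sub>R n"
    unfolding tan_proj_def
  proof (rule the_equality)
    show "v - lorentz v n *\<^sub>R n \<in> lorentz_perp {n} \<and>
        (\<forall>z\<in>lorentz_perp {n}. lorentz (v - (v - lorentz v n *\<^sub>R n)) z = 0)"
      using n by (simp add: lorentz_perp_def lorentz_simps lorentz_commute)
  next
    fix w assume w: "w \<in> lorentz_perp {n} \<and> (\<forall>z\<in>lorentz_perp {n}. lorentz (v - w) z = 0)"
    define d where "d = v - lorentz v n *\<^sub>R n - w"
    have dn: "lorentz d n = 0" using w n by (simp add: d_def lorentz_perp_def lorentz_simps)
    have "lorentz d x = 0" for x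
    proof -
      define z where "z = x - lorentz x n *\<^sub>R n"
      have nz: "lorentz n z = 0" using n by (simp add: z_def lorentz_simps lorentz_commute)
      then have "z \<in> lorentz_perp {n}" by (simp add: lorentz_perp_def lorentz_commute)
      then have "lorentz d z = 0" using w nz by (simp add: d_def lorentz_simps)
      then show ?thesis using dn by (simp add: z_def lorentz_simps)
    qed
    then have "d = 0" by (rule lorentz_nondegenerate)
    then show "w = v - lorentz v n *\<^sub>R n" by (simp add: d_def)
  qed
  show "nor_proj (lorentz_perp {n}) v = lorentz v n *\<^sub>R n" by (simp add: nor_proj_def t)
qed

lemma lorentz_perp_perp:
  assumes n: "lorentz n n = 1" and x: "x \<in> lorentz_perp (lorentz_perp {n})"
  shows "x = lorentz x n *\<^sub>R n"
proof -
  have "lorentz (x - lorentz x n *\<^sub>R n) y = 0" for y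
  proof -
    define z where "z = y - lorentz y n *\<^sub>R n"
    have nz: "lorentz n z = 0" using n by (simp add: z_def lorentz_simps lorentz_commute)
    then have "z \<in> lorentz_perp {n}" by (simp add: lorentz_perp_def lorentz_commute)
    then have "lorentz x z = 0" using x unfolding lorentz_perp_def[of "lorentz_perp {n}"] by blast
    then show ?thesis using n nz by (simp add: z_def lorentz_simps lorentz_commute)
  qed
  from lorentz_nondegenerate[OF this] show ?thesis by simp
qed

lemma dim_lorentz_perp:
  assumes "n \<noteq> 0" shows "dim (lorentz_perp {n}) = 4" "subspace (lorentz_perp {n})"
proof -
  have eq: "lorentz_perp {n} = {x. (fst n, - snd n) \<bullet> x = 0}"
    by (auto simp: lorentz_perp_def lorentz_def inner_prod_def inner_commute mult.commute)
  have "(fst n, - snd n) \<noteq> 0" using assms by (simp add: prod_eq_iff)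
  then show "dim (lorentz_perp {n}) = 4"
    unfolding eq by (subst dim_hyperplane) auto
  show "subspace (lorentz_perp {n})" unfolding eq by (rule subspace_hyperplane)
qed

text \<open>A four-dimensional subspace is the complement of a vector \<open>m\<close>.
  Orthogonality to the null \<open>s\<close> keeps \<open>m\<close> from being timelike. A null
  \<open>m\<close> would lie in \<open>V\<close>; its parts in \<open>P\<close> and \<open>N\<close>
  would then have square zero and vanish.\<close>

lemma has_signature_3_1_perp:
  assumes V: "has_signature V 3 1" and s: "s \<in> V" "lorentz s s = 0" "snd s \<noteq> 0"
  obtains n where "lorentz n n = 1" "V = lorentz_perp {n}"
proof -
  obtain P N where PN: "subspace P" "subspace N" "dim P = 3" "dim N = 1"
    and pos: "\<forall>v\<in>P. v \<noteq> 0 \<longrightarrow> lorentz v v > 0" and neg: "\<forall>v\<in>N. v \<noteq> 0 \<longrightarrow> lorentz v v < 0"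
    and orth: "\<forall>v\<in>P. \<forall>w\<in>N. lorentz v w = 0" and Veq: "V = {v + w | v w. v \<in> P \<and> w \<in> N}"
    using V unfolding has_signature_def by auto
  have "P \<inter> N = {0}" using pos neg subspace_0[OF PN(1)] subspace_0[OF PN(2)] by force
  then have dimV: "dim V = 4" using dim_sums_Int[OF PN(1,2)] PN(3,4) Veq by simp
  have subV: "subspace V" unfolding Veq by (rule subspace_sums[OF PN(1,2)])
  have "dim V < DIM(mink)" using dimV by simp
  then obtain a where a: "a \<noteq> 0" "\<And>y. y \<in> V \<Longrightarrow> orthogonal a y"
    using orthogonal_to_subspace_exists span_base by metis
  \<comment> \<open>Flipping the last sign converts euclidean orthogonality into Lorentz
    orthogonality.\<close>
  define m where "m = (fst a, - snd a)"
  have m0: "m \<noteq> 0" using a(1) by (auto simp: m_def prod_eq_iff)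
  have mV: "lorentz m y = 0" if "y \<in> V" for y
    using a(2)[OF that] by (simp add: m_def lorentz_def orthogonal_def inner_prod_def)
  then have "V \<subseteq> lorentz_perp {m}" by (auto simp: lorentz_perp_def lorentz_commute)
  then have Vm: "V = lorentz_perp {m}"
    using subspace_dim_equal[OF subV dim_lorentz_perp(2)[OF m0]] dim_lorentz_perp(1)[OF m0] dimV by simp
  have "lorentz m m \<ge> 0" using null_perp(1)[OF s(2,3) mV[OF s(1)]] .
  moreover have "lorentz m m \<noteq> 0"
  proof
    assume "lorentz m m = 0"
    then have "m \<in> V" by (simp add: Vm lorentz_perp_def)
    then obtain p q where pq: "m = p + q" "p \<in> P" "q \<in> N" using Veq by blast
    have "p + 0 \<in> V" "0 + q \<in> V"
      unfolding Veq using pq(2,3) subspace_0[OF PN(1)] subspace_0[OF PN(2)] by blast+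
    then have "p \<in> V" "q \<in> V" by simp_all
    then have "lorentz p p + lorentz q p = 0" "lorentz p q + lorentz q q = 0"
      using mV[of p] mV[of q] pq(1) by (simp_all add: lorentz_simps)
    then have "lorentz p p = 0" "lorentz q q = 0" using orth pq by (simp_all add: lorentz_commute)
    then have "p = 0" "q = 0" using pos neg pq by force+
    then show False using m0 pq by simp
  qed
  ultimately have mp: "lorentz m m > 0" by simp
  define n where "n = (1 / sqrt (lorentz m m)) *\<^sub>R m"
  have "lorentz n n = 1" using mp by (simp add: n_def lorentz_simps)
  moreover have "V = lorentz_perp {n}" using mp by (simp add: Vm n_def lorentz_perp_def lorentz_simps)
  ultimately show ?thesis using that by blast
qed

text \<open>\<open>s - h\<close> and \<open>s + h\<close> have squares 2 and -2, so
  \<open>a\<close>, \<open>b\<close>, \<open>s - h\<close> span the positive part and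
  \<open>s + h\<close> the negative one.\<close>

lemma has_signature_frame:
  assumes f: "frame s a b n h"
  shows "has_signature (lorentz_perp {n}) 3 1"
proof -
  note fs = frame_simps[OF f]
  define \<phi> :: "real^3 \<Rightarrow> mink" where "\<phi> x = (x$1) *\<^sub>R a + (x$2) *\<^sub>R b + (x$3) *\<^sub>R (s - h)" for x
  define \<psi> :: "real \<Rightarrow> mink" where "\<psi> x = x *\<^sub>R (s + h)" for x
  have lin: "linear \<phi>" "linear \<psi>"
    by (auto intro!: linearI simp: \<phi>_def \<psi>_def algebra_simps)
  have quad: "lorentz (\<phi> x) (\<phi> x) = (x$1 * lorentz a a + x$2 * lorentz a b)\<^sup>2 / lorentz a a
      + (x$2)\<^sup>2 * gram2 a b / lorentz a a + 2 * (x$3)\<^sup>2" for x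
    using less_imp_neq[OF fs(22)] by (simp add: \<phi>_def lorentz_simps fs lorentz_commute[of b a])
      (simp add: gram2_def power2_eq_square algebra_simps add_divide_distrib diff_divide_distrib)
  have pos: "lorentz (\<phi> x) (\<phi> x) > 0" if "x \<noteq> 0" for x
  proof (cases "x$2 = 0 \<and> x$3 = 0")
    case True
    then have "x$1 \<noteq> 0" using that by (simp add: vec_eq_iff forall_3)
    then show ?thesis unfolding quad using True fs(22) by simp
  next
    case False
    have "(x$2)\<^sup>2 * gram2 a b / lorentz a a + 2 * (x$3)\<^sup>2 > 0"
      using False fs(22,23) by (cases "x$2 = 0") (auto intro: add_pos_nonneg)
    moreover have "(x$1 * lorentz a a + x$2 * lorentz a b)\<^sup>2 / lorentz a a \<ge> 0" using fs(22) by simp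
    ultimately show ?thesis unfolding quad by linarith
  qed
  have neg: "lorentz (\<psi> x) (\<psi> x) = - 2 * x\<^sup>2" for x
    by (simp add: \<psi>_def lorentz_simps fs power2_eq_square)
  have inj: "inj \<phi>" "inj \<psi>"
    unfolding linear_injective_0[OF lin(1)] linear_injective_0[OF lin(2)]
    by (metis lorentz.zero_left order_less_irrefl pos, 
      metis lorentz.zero_left mult_eq_0_iff neg neg_equal_0_iff_equal power_eq_0_iff zero_neq_numeral)
  have "dim (range \<phi>) = dim (UNIV :: (real^3) set)" "dim (range \<psi>) = dim (UNIV :: real set)"
    using dim_image_eq[OF lin(1)] dim_image_eq[OF lin(2)] inj by (auto intro: inj_on_subset)
  then have dims: "dim (range \<phi>) = 3" "dim (range \<psi>) = 1" by simp_all
  have orth: "lorentz (\<phi> x) (\<psi> y) = 0" for x y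
    by (simp add: \<phi>_def \<psi>_def lorentz_simps fs)
  have eq: "lorentz_perp {n} = {v + w | v w. v \<in> range \<phi> \<and> w \<in> range \<psi>}"
  proof (intro set_eqI iffI)
    fix v assume "v \<in> lorentz_perp {n}"
    then have vn: "lorentz v n = 0" by (simp add: lorentz_perp_def)
    define x :: "real^3" where "x = vector [(lorentz v a * lorentz b b - lorentz v b * lorentz a b) / gram2 a b,
       (lorentz v b * lorentz a a - lorentz v a * lorentz a b) / gram2 a b, (lorentz v s - lorentz v h) / 2]"
    define y where "y = - (lorentz v h + lorentz v s) / 2"
    have "- lorentz v h *\<^sub>R s - lorentz v s *\<^sub>R h = (x$3) *\<^sub>R (s - h) + y *\<^sub>R (s + h)"
    proof -
      have "(x$3) *\<^sub>R (s - h) + y *\<^sub>R (s + h) = (x$3 + y) *\<^sub>R s + (y - x$3) *\<^sub>R h"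
        by (simp add: algebra_simps)
      moreover have "x$3 + y = - lorentz v h" "y - x$3 = - lorentz v s"
        by (simp_all add: x_def y_def field_simps)
      ultimately show ?thesis by simp
    qed
    then have "frame_comb s a b n h v = \<phi> x + \<psi> y"
      by (simp add: frame_comb_def vn \<phi>_def \<psi>_def proj2_def x_def)
    then have "v = \<phi> x + \<psi> y" using frame_expand[OF f, of v] by simp
    then show "v \<in> {v + w | v w. v \<in> range \<phi> \<and> w \<in> range \<psi>}" by blast
  next
    fix v assume "v \<in> {v + w | v w. v \<in> range \<phi> \<and> w \<in> range \<psi>}"
    then obtain x y where "v = \<phi> x + \<psi> y" by blast
    then show "v \<in> lorentz_perp {n}" by (simp add: lorentz_perp_def \<phi>_def \<psi>_def lorentz_simps fs)
  qed
  show ?thesis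
    unfolding has_signature_def
  proof (intro exI conjI)
    show "\<forall>v\<in>range \<phi>. v \<noteq> 0 \<longrightarrow> lorentz v v > 0"
      by (metis pos linear_0[OF lin(1)] imageE)
    show "\<forall>v\<in>range \<psi>. v \<noteq> 0 \<longrightarrow> lorentz v v < 0" using neg linear_0[OF lin(2)] by force
  qed (use lin dims orth eq in \<open>auto intro: linear_subspace_image\<close>)
qed

text \<open>What a positive section of an immersed patch satisfies at a single point. The conditions
  on derivatives come from differentiating \<open>lorentz (s u) (s u) = 0\<close> once and twice;
  the last two are positive definiteness of the induced metric. The pointwise form lets the sphere
  congruence be determined one fibre at a time.\<close>

definition regular :: "(real^2 \<Rightarrow> mink) \<Rightarrow> real^2 \<Rightarrow> bool" where
  "regular s u \<longleftrightarrow> lorentz (s u) (s u) = 0 \<and> snd (s u) > 0 \<and> (\<forall>i. lorentz (pd i s u) (s u) = 0) \<and>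
     (\<forall>i j. lorentz (pd i (pd j s) u) (s u) = - ind_metric s u $ i $ j) \<and>
     ind_metric s u $ 1 $ 1 > 0 \<and> det (ind_metric s u) > 0"

text \<open>The conditions under which the complement of \<open>n\<close> is the fibre of the
  central sphere congruence; they determine \<open>n\<close> up to sign.\<close>

definition normal_at :: "(real^2 \<Rightarrow> mink) \<Rightarrow> real^2 \<Rightarrow> mink \<Rightarrow> bool" where
  "normal_at s u n \<longleftrightarrow> lorentz n n = 1 \<and> lorentz n (s u) = 0 \<and> (\<forall>i. lorentz n (pd i s u) = 0) \<and>
     trace_wrt (ind_metric s u) (\<chi> i j. lorentz (pd i (pd j s) u) n) = 0"

lemma det_ind_metric: "det (ind_metric s u) = gram2 (pd 1 s u) (pd 2 s u)"
  by (simp add: det_2 ind_metric_def gram2_def lorentz_commute power2_eq_square)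

definition dual_at :: "(real^2 \<Rightarrow> mink) \<Rightarrow> real^2 \<Rightarrow> mink \<Rightarrow> mink" where
  "dual_at s u n = dual (s u) (pd 1 s u) (pd 2 s u) n"

lemma frame_at:
  assumes "regular s u" "lorentz n n = 1" "lorentz n (s u) = 0" "\<And>i. lorentz n (pd i s u) = 0"
  shows "frame (s u) (pd 1 s u) (pd 2 s u) n (dual_at s u n)"
  unfolding dual_at_def using assms
  by (intro frame_dual) (auto simp: regular_def det_ind_metric, simp add: ind_metric_def)

lemma frame_normal_at: "regular s u \<Longrightarrow> normal_at s u n \<Longrightarrow> frame (s u) (pd 1 s u) (pd 2 s u) n (dual_at s u n)"
  by (rule frame_at) (auto simp: normal_at_def)

lemma trace_second_ff:
  assumes "det (ind_metric s u) \<noteq> 0" "lorentz n n = 1"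
  shows "trace_wrt (ind_metric s u) (second_ff s u (lorentz_perp {n})) =
    - (trace_wrt (ind_metric s u) (\<chi> i j. lorentz (pd i (pd j s) u) n)) *\<^sub>R n"
  unfolding trace_wrt_2[OF assms(1)] second_ff_def
  by (simp add: nor_proj_perp[OF assms(2)] algebra_simps)

text \<open>Another enveloped sphere has a unit normal \<open>m\<close> that is a multiple of
  \<open>n\<close> plus a multiple of \<open>s u\<close>. Since second derivatives of
  \<open>s\<close> pair with \<open>s\<close> to minus the metric, whose trace is 2, the trace
  condition forces the second coefficient to vanish.\<close>

theorem central_sphere_eq:
  assumes r: "regular s u" and n: "normal_at s u n"
  shows "central_sphere s u = lorentz_perp {n}"
  unfolding central_sphere_def
proof (rule the_equality)
  have det: "det (ind_metric s u) \<noteq> 0" using r by (simp add: regular_def)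
  have sym: "ind_metric s u $ 2 $ 1 = ind_metric s u $ 1 $ 2" by (simp add: ind_metric_def lorentz_commute)
  note f = frame_normal_at[OF r n]
  note fs = frame_simps[OF f]
  have nn: "lorentz n n = 1" by (rule fs)
  have "subspace (lorentz_perp {n})" using fs(10) by (intro dim_lorentz_perp(2)) (auto simp: lorentz_simps)
  moreover have "pd i s u \<in> lorentz_perp {n}" for i using n by (simp add: normal_at_def lorentz_perp_def lorentz_commute)
  ultimately have "first_derived s u \<subseteq> lorentz_perp {n}"
    unfolding first_derived_def using fs by (intro span_minimal) (auto simp: lorentz_perp_def)
  then have "enveloped s u (lorentz_perp {n})" using has_signature_frame[OF f] by (simp add: enveloped_def)
  moreover have "trace_wrt (ind_metric s u) (second_ff s u (lorentz_perp {n})) = 0"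
    using n by (simp add: trace_second_ff[OF det nn] normal_at_def)
  ultimately show "enveloped s u (lorentz_perp {n}) \<and> trace_wrt (ind_metric s u) (second_ff s u (lorentz_perp {n})) = 0" ..
  fix V assume V: "enveloped s u V \<and> trace_wrt (ind_metric s u) (second_ff s u V) = 0"
  then have sV: "s u \<in> V" "\<And>i. pd i s u \<in> V"
    by (auto simp: enveloped_def first_derived_def intro: span_base)
  obtain m where m: "lorentz m m = 1" "V = lorentz_perp {m}"
    using has_signature_3_1_perp[of V "s u"] V sV r by (auto simp: enveloped_def regular_def)
  let ?h = "dual_at s u n"
  have ms: "lorentz m (s u) = 0" "\<And>i. lorentz m (pd i s u) = 0"
    using sV m(2) by (auto simp: lorentz_perp_def lorentz_commute)
  have "m \<noteq> 0" using m(1) by (auto simp: lorentz_simps)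
  then have "trace_wrt (ind_metric s u) (\<chi> i j. lorentz (pd i (pd j s) u) m) = 0"
    using V m(1) by (auto simp: m(2) trace_second_ff[OF det m(1)])
  moreover have me: "m = lorentz m n *\<^sub>R n - lorentz m ?h *\<^sub>R s u"
    using frame_expand[OF f, of m] ms by (simp add: frame_comb_def proj2_def)
  have "lorentz (pd i (pd j s) u) m = lorentz m n * lorentz (pd i (pd j s) u) n + lorentz m ?h * ind_metric s u $ i $ j" for i j
    using r by (subst me) (simp add: lorentz_simps regular_def)
  then have "trace_wrt (ind_metric s u) (\<chi> i j. lorentz (pd i (pd j s) u) m) =
     lorentz m n * trace_wrt (ind_metric s u) (\<chi> i j. lorentz (pd i (pd j s) u) n) + lorentz m ?h * 2"
    using det unfolding trace_wrt_2[OF det] by (simp add: field_simps) (simp add: det_2 sym algebra_simps)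
  ultimately have "lorentz m ?h = 0" using n by (simp add: normal_at_def)
  then have mn: "m = lorentz m n *\<^sub>R n" using me by simp
  then have "lorentz m n \<noteq> 0" using \<open>m \<noteq> 0\<close> by auto
  then show "V = lorentz_perp {n}"
    unfolding m(2) lorentz_perp_def by (subst mn) (simp add: lorentz_simps)
qed

lemma II0_eq:
  assumes "regular s u" "normal_at s u n"
  shows "II0 s u = (\<chi> i j. - lorentz (pd i (pd j s) u) n *\<^sub>R n)"
  using assms(2) unfolding II0_def central_sphere_eq[OF assms] second_ff_def
  by (simp add: nor_proj_perp normal_at_def)

section \<open>Gauges and normal sections\<close>

lemma trace_wrt_scaleR:
  fixes g :: "real^2^2" and T :: "'b::real_vector^2^2"
  assumes "det g \<noteq> 0" "c \<noteq> 0"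
  shows "trace_wrt (c *\<^sub>R g) T = (1 / c) *\<^sub>R trace_wrt g T"
proof -
  have d: "det (c *\<^sub>R g) = c * c * det g" by (simp add: det_2 algebra_simps)
  show ?thesis
    using assms by (subst (1 2) trace_wrt_2) (simp_all add: d scaleR_right_diff_distrib scaleR_add_right)
qed

lemma trace_wrt_mult: "trace_wrt g (\<chi> i j. c * T i j) = c * trace_wrt g (\<chi> i j. T i j)" for c :: real
  by (simp add: trace_wrt_def sum_distrib_left mult.left_commute)

lemma trace_wrt_add: "trace_wrt g (\<chi> i j. S i j + T i j) = trace_wrt g (\<chi> i j. S i j) + trace_wrt g (\<chi> i j. T i j)"
  by (simp add: trace_wrt_def sum.distrib scaleR_add_right)

section \<open>Rules for partial derivatives\<close>

lemma pd_eqI: "(f has_derivative f') (at u) \<Longrightarrow> pd i f u = f' (axis i 1)"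
  unfolding pd_def using frechet_derivative_at by metis

lemma smooth_on_pd: "smooth_on W f \<Longrightarrow> smooth_on W (pd i f)"
  unfolding pd_def[abs_def] by (rule smooth_on_deriv)

lemma pd_cong:
  assumes "open W" "u \<in> W" "\<And>w. w \<in> W \<Longrightarrow> f w = g w"
  shows "pd i f u = pd i g u"
proof -
  have "(f has_derivative F) (at u) \<longleftrightarrow> (g has_derivative F) (at u)" for F
    using has_derivative_transform_within_open[of f F u UNIV W g] has_derivative_transform_within_open[of g F u UNIV W f] assms
    by auto
  then show ?thesis by (simp add: pd_def frechet_derivative_def)
qed

lemma pd_const [simp]: "pd i (\<lambda>u. c) u = 0"
  by (simp add: pd_def)

lemma pd_const_on: "open W \<Longrightarrow> u \<in> W \<Longrightarrow> (\<And>w. w \<in> W \<Longrightarrow> f w = c) \<Longrightarrow> pd i f u = 0"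
  using pd_cong[of W u f "\<lambda>_. c" i] by simp

lemma pd_add: "smooth_on W f \<Longrightarrow> smooth_on W g \<Longrightarrow> u \<in> W \<Longrightarrow> pd i (\<lambda>w. f w + g w) u = pd i f u + pd i g u"
  using pd_eqI[OF has_derivative_add[OF smooth_on_has_derivative smooth_on_has_derivative]]
  by (fastforce simp: pd_def)

lemma pd_bilinear:
  assumes "bounded_bilinear B" "smooth_on W f" "smooth_on W g" "u \<in> W"
  shows "pd i (\<lambda>w. B (f w) (g w)) u = B (pd i f u) (g u) + B (f u) (pd i g u)"
  using pd_eqI[OF bounded_bilinear.FDERIV[OF assms(1) smooth_on_has_derivative[OF assms(2,4)]
      smooth_on_has_derivative[OF assms(3,4)]]]
  by (simp add: pd_def)

lemmas pd_lorentz = pd_bilinear[OF bounded_bilinear_lorentz]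
lemmas pd_scaleR = pd_bilinear[OF bounded_bilinear_scaleR]
lemmas pd_mult = pd_bilinear[OF bounded_bilinear_mult]

lemma pd_linear:
  assumes "bounded_linear L" "smooth_on W f" "u \<in> W"
  shows "pd i (\<lambda>w. L (f w)) u = L (pd i f u)"
  using pd_eqI[OF bounded_linear.has_derivative[OF assms(1) smooth_on_has_derivative[OF assms(2,3)]]]
  by (simp add: pd_def)

lemmas pd_minus = pd_linear[OF bounded_linear_minus[OF bounded_linear_ident]]
lemmas pd_scaleR_const = pd_linear[OF bounded_linear_scaleR_right]

lemma pd_diff: "smooth_on W f \<Longrightarrow> smooth_on W g \<Longrightarrow> u \<in> W \<Longrightarrow> pd i (\<lambda>w. f w - g w) u = pd i f u - pd i g u"
  using pd_eqI[OF has_derivative_diff[OF smooth_on_has_derivative smooth_on_has_derivative]]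
  by (fastforce simp: pd_def)

lemma pd_divide:
  fixes f g :: "real^2 \<Rightarrow> real"
  assumes "smooth_on W f" "smooth_on W g" "u \<in> W" "g u \<noteq> 0"
  shows "pd i (\<lambda>w. f w / g w) u = (pd i f u * g u - f u * pd i g u) / (g u)\<^sup>2"
  using pd_eqI[OF has_derivative_divide'[OF smooth_on_has_derivative[OF assms(1,3)] smooth_on_has_derivative[OF assms(2,3)] assms(4)]]
  by (simp add: pd_def power2_eq_square)

lemma pd_commute:
  fixes f :: "real^2 \<Rightarrow> 'b::euclidean_space"
  assumes "smooth_on W f" "open W" "u \<in> W"
  shows "pd i (pd j f) u = pd j (pd i f) u"
  unfolding pd_def[abs_def] by (rule second_derivative_symmetric[OF assms])

lemma frechet_derivative_pd:
  assumes "smooth_on W f" "u \<in> W"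
  shows "frechet_derivative f (at u) X = (X$1) *\<^sub>R pd 1 f u + (X$2) *\<^sub>R pd 2 f u"
proof -
  have l: "linear (frechet_derivative f (at u))"
    using has_derivative_linear[OF smooth_on_has_derivative[OF assms]] .
  have "X = (X$1) *\<^sub>R axis 1 1 + (X$2) *\<^sub>R axis 2 1"
    by (simp add: vec_eq_iff forall_2 axis_def)
  then have "frechet_derivative f (at u) X = frechet_derivative f (at u) ((X$1) *\<^sub>R axis 1 1 + (X$2) *\<^sub>R axis 2 1)"
    by simp
  then show ?thesis by (simp add: pd_def linear_add[OF l] linear_cmul[OF l])
qed

lemma has_derivative_pd:
  assumes "smooth_on W f" "u \<in> W"
  shows "(f has_derivative (\<lambda>X. (X$1) *\<^sub>R pd 1 f u + (X$2) *\<^sub>R pd 2 f u)) (at u)"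
  using smooth_on_has_derivative[OF assms] by (simp add: frechet_derivative_pd[OF assms, symmetric, abs_def])

section \<open>Gauges of an immersed patch and their smooth normals\<close>

definition section_on :: "(real^2) set \<Rightarrow> (real^2 \<Rightarrow> mink) \<Rightarrow> bool" where
  "section_on W s \<longleftrightarrow> open W \<and> smooth_on W s \<and> (\<forall>u\<in>W. regular s u)"

lemma section_onD:
  assumes "section_on W s"
  shows "open W" "smooth_on W s" "\<And>i. smooth_on W (pd i s)" "\<And>i j. smooth_on W (pd i (pd j s))"
    "\<And>u. u \<in> W \<Longrightarrow> regular s u"
  using assms by (auto simp: section_on_def intro: smooth_on_pd)

lemma section_on_subset: "section_on W s \<Longrightarrow> open V \<Longrightarrow> V \<subseteq> W \<Longrightarrow> section_on V s"
  by (auto simp: section_on_def intro: smooth_on_subset)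

lemma null_deriv:
  assumes "open W" "smooth_on W s" "\<And>w. w \<in> W \<Longrightarrow> lorentz (s w) (s w) = 0" "u \<in> W"
  shows "lorentz (pd i s u) (s u) = 0" "lorentz (pd i (pd j s) u) (s u) = - ind_metric s u $ i $ j"
proof -
  have 1: "lorentz (pd i s u) (s u) = 0" if "u \<in> W" for i u
    using pd_lorentz[OF assms(2,2) that, of i] pd_const_on[OF assms(1) that, of "\<lambda>w. lorentz (s w) (s w)" 0 i] assms(3)
    by (simp add: lorentz_commute)
  show "lorentz (pd i s u) (s u) = 0" using 1 assms(4) .
  have "lorentz (pd i (pd j s) u) (s u) + lorentz (pd j s u) (pd i s u) = 0"
    using pd_lorentz[OF smooth_on_pd[OF assms(2)] assms(2,4), of i j]
      pd_const_on[OF assms(1,4), of "\<lambda>w. lorentz (pd j s w) (s w)" 0 i] 1 by simp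
  then show "lorentz (pd i (pd j s) u) (s u) = - ind_metric s u $ i $ j"
    by (simp add: ind_metric_def lorentz_commute)
qed

text \<open>Images of tangent vectors are orthogonal to the null \<open>s u\<close>, so their
  squares are nonnegative; square zero would put them on the line of \<open>s u\<close>, against the
  immersion hypothesis. Hence the induced form is positive definite.\<close>

lemma regularI:
  assumes "open W" "smooth_on W s" "\<And>w. w \<in> W \<Longrightarrow> lorentz (s w) (s w) = 0" "u \<in> W"
    and snd: "snd (s u) > 0"
    and imm: "\<And>X. frechet_derivative s (at u) X \<in> span {s u} \<Longrightarrow> X = 0"
  shows "regular s u"
proof -
  let ?a = "pd 1 s u" and ?b = "pd 2 s u"
  note n = null_deriv[OF assms(1-4)]
  have pos: "lorentz v v > 0" if "v = x *\<^sub>R ?a + y *\<^sub>R ?b" "x \<noteq> 0 \<or> y \<noteq> 0" for v x y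
  proof -
    define X :: "real^2" where "X = vector [x, y]"
    have X0: "X \<noteq> 0" using that(2) by (auto simp: X_def vec_eq_iff forall_2)
    have v: "frechet_derivative s (at u) X = v"
      using that by (simp add: frechet_derivative_pd[OF assms(2,4)] X_def)
    have vs: "lorentz v (s u) = 0" using that(1) by (simp add: lorentz_simps n)
    have "lorentz v v \<noteq> 0"
    proof
      assume "lorentz v v = 0"
      then have "v = (snd v / snd (s u)) *\<^sub>R s u"
        using null_perp(2)[OF assms(3)[OF assms(4)] _ vs] snd by auto
      then have "v \<in> span {s u}" by (metis span_base span_scale singletonI)
      then show False using imm X0 v by auto
    qed
    then show ?thesis using null_perp(1)[OF assms(3)[OF assms(4)] _ vs] snd by auto
  qed
  have aa: "lorentz ?a ?a > 0" using pos[of ?a 1 0] by simp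
  \<comment> \<open>These coefficients make the test vector orthogonal to \<open>?a\<close>, so its
    square is \<open>lorentz ?a ?a\<close> times the Gram determinant.\<close>
  have "lorentz ?a ?a * gram2 ?a ?b > 0"
    using pos[of _ "- lorentz ?a ?b" "lorentz ?a ?a", OF refl] aa
    by (simp add: lorentz_simps lorentz_commute[of ?b ?a] gram2_def power2_eq_square algebra_simps)
  then have "gram2 ?a ?b > 0" using aa by (simp add: zero_less_mult_iff)
  then show ?thesis
    using aa n snd assms(3,4) by (auto simp: regular_def det_ind_metric) (simp add: ind_metric_def)
qed

lemma section_onI:
  assumes imm: "immersed_patch S L" and W: "open W" "W \<subseteq> S" and s: "positive_section W L s"
  shows "section_on W s" "\<And>u. u \<in> W \<Longrightarrow> L u = span {s u}"
proof -
  have sm: "smooth_on W s" "\<And>u. u \<in> W \<Longrightarrow> s u \<in> L u" "\<And>u. u \<in> W \<Longrightarrow> snd (s u) > 0"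
    using s by (auto simp: positive_section_def)
  have *: "lorentz (s u) (s u) = 0 \<and> L u = span {s u}" if u: "u \<in> W" for u
  proof -
    have "L u \<in> conformal_sphere" using imm u W(2) by (auto simp: immersed_patch_def)
    then obtain v where v: "L u = span {v}" "v \<noteq> 0" "lorentz v v = 0" by (auto simp: conformal_sphere_def)
    then obtain c where c: "s u = c *\<^sub>R v" using sm(2)[OF u] by (auto simp: span_singleton)
    have "c \<noteq> 0" using sm(3)[OF u] c by auto
    then have "v = (1 / c) *\<^sub>R s u" by (simp add: c)
    then have "v \<in> span {s u}" by (metis span_base span_scale singletonI)
    moreover have "s u \<in> span {v}" by (simp add: c span_base span_scale)
    ultimately have "span {v} = span {s u}" by (intro subset_antisym span_minimal) (auto intro: subspace_span)
    then show ?thesis using v c by (simp add: lorentz_simps)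
  qed
  then show "L u = span {s u}" if "u \<in> W" for u using that by blast
  have inj: "\<forall>u\<in>W. \<forall>X. frechet_derivative s (at u) X \<in> L u \<longrightarrow> X = 0"
    using imm W s unfolding immersed_patch_def by blast
  have "regular s u" if "u \<in> W" for u
  proof (intro regularI[OF W(1) sm(1)])
    show "X = 0" if "frechet_derivative s (at u) X \<in> span {s u}" for X
      using inj *[OF \<open>u \<in> W\<close>] \<open>u \<in> W\<close> that by blast
    show "lorentz (s w) (s w) = 0" if "w \<in> W" for w using *[OF that] ..
  qed (use that sm(3) in auto)
  then show "section_on W s" using W sm by (simp add: section_on_def)
qed

lemma smooth_on_ind_metric:
  assumes "section_on W s"
  shows "smooth_on W (\<lambda>u. ind_metric s u $ i $ j)" "smooth_on W (\<lambda>u. det (ind_metric s u))"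
proof -
  show *: "smooth_on W (\<lambda>u. ind_metric s u $ i $ j)" for i j
    using section_onD[OF assms] unfolding ind_metric_def by (simp add: smooth_on_lorentz)
  show "smooth_on W (\<lambda>u. det (ind_metric s u))"
    unfolding det_2 by (intro smooth_on_diff smooth_on_mult * section_onD(1)[OF assms])
qed

lemma smooth_on_proj2:
  assumes "open W" "smooth_on W a" "smooth_on W b" "smooth_on W v" "\<And>u. u \<in> W \<Longrightarrow> gram2 (a u) (b u) \<noteq> 0"
  shows "smooth_on W (\<lambda>u. proj2 (a u) (b u) (v u))"
  unfolding proj2_def using assms(5) unfolding gram2_def
  by (intro smooth_on_add smooth_on_scaleR smooth_on_divide smooth_on_diff smooth_on_mult smooth_on_power
      smooth_on_lorentz assms(1-4)) auto

lemma smooth_on_dual0: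
  assumes "section_on W s"
  shows "smooth_on W (\<lambda>u. dual0 (s u) (pd 1 s u) (pd 2 s u))"
proof -
  have nz: "gram2 (pd 1 s u) (pd 2 s u) \<noteq> 0" "snd (s u) \<noteq> 0" if "u \<in> W" for u
    using section_onD(5)[OF assms that] by (auto simp: regular_def det_ind_metric)
  have y: "smooth_on W (\<lambda>u. (0, 1) - proj2 (pd 1 s u) (pd 2 s u) (0, 1))"
    by (intro smooth_on_diff smooth_on_proj2 smooth_on_const section_onD[OF assms] nz)
  show ?thesis unfolding dual0_def Let_def
    by (intro smooth_on_add smooth_on_scaleR smooth_on_divide smooth_on_mult smooth_on_power smooth_on_lorentz
        smooth_on_snd smooth_on_const y section_onD[OF assms]) (use nz in auto)
qed

lemma smooth_on_dual_at:
  assumes "section_on W s" "smooth_on W n"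
  shows "smooth_on W (\<lambda>u. dual_at s u (n u))"
  unfolding dual_at_def dual_def Let_def
  by (intro smooth_on_diff smooth_on_scaleR smooth_on_divide smooth_on_power smooth_on_lorentz
      smooth_on_const smooth_on_dual0 section_onD[OF assms(1)] assms) auto

lemma smooth_on_normal_proj:
  assumes "section_on W s"
  shows "smooth_on W (\<lambda>u. normal_proj (s u) (pd 1 s u) (pd 2 s u) v)"
proof -
  have nz: "gram2 (pd 1 s u) (pd 2 s u) \<noteq> 0" if "u \<in> W" for u
    using section_onD(5)[OF assms that] by (auto simp: regular_def det_ind_metric)
  show ?thesis unfolding normal_proj_def Let_def
    by (intro smooth_on_add smooth_on_diff smooth_on_scaleR smooth_on_lorentz smooth_on_proj2
        smooth_on_const smooth_on_dual0 section_onD[OF assms(1)] assms nz)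
qed

lemma open_positive:
  assumes "open W" "smooth_on W f" shows "open {u \<in> W. f u > (0::real)}"
proof -
  have "{u \<in> W. f u > 0} = f -` {0<..} \<inter> W" by auto
  then show ?thesis
    using continuous_on_open_vimage[OF assms(1), of f] smooth_on_imp_continuous_on[OF assms(2)] open_greaterThan[of 0]
    by metis
qed

text \<open>Positivity of the square of a projected fixed vector is an open condition, which gives a
  smooth unit normal near \<open>u0\<close>. Adding multiples of \<open>s\<close> keeps it a unit
  normal, and one such multiple makes the trace zero.\<close>

lemma exists_normal:
  assumes s: "section_on W s" and u0: "u0 \<in> W"
  obtains V n where "open V" "u0 \<in> V" "V \<subseteq> W" "smooth_on V n" "\<And>u. u \<in> V \<Longrightarrow> normal_at s u (n u)"
proof -
  note sd = section_onD[OF s]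
  have r: "lorentz (s u) (s u) = 0" "lorentz (pd i s u) (s u) = 0" "snd (s u) \<noteq> 0"
    "gram2 (pd 1 s u) (pd 2 s u) \<noteq> 0" if "u \<in> W" for u i
    using sd(5)[OF that] by (auto simp: regular_def det_ind_metric)
  note rr = r(1) r(2)[of _ 1] r(2)[of _ 2] r(3,4)
  obtain v where v: "normal_proj (s u0) (pd 1 s u0) (pd 2 s u0) v \<noteq> 0"
    using normal_proj_nonzero[OF rr[OF u0]] by blast
  define N where "N u = normal_proj (s u) (pd 1 s u) (pd 2 s u) v" for u
  have smN: "smooth_on W N" unfolding N_def by (rule smooth_on_normal_proj[OF s])
  define V where "V = {u \<in> W. lorentz (N u) (N u) > 0}"
  have V: "open V" "V \<subseteq> W"
    unfolding V_def using open_positive[OF sd(1) smooth_on_lorentz[OF sd(1) smN smN]] by auto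
  have u0V: "u0 \<in> V" using normal_proj_pos[OF rr[OF u0] v] u0 by (simp add: V_def N_def)
  have sV: "section_on V s" by (rule section_on_subset[OF s V])
  note sVd = section_onD[OF sV]
  define m where "m u = (1 / sqrt (lorentz (N u) (N u))) *\<^sub>R N u" for u
  have smNV: "smooth_on V N" by (rule smooth_on_subset[OF smN V(2)])
  have smm: "smooth_on V m" unfolding m_def
    by (intro smooth_on_scaleR smooth_on_divide smooth_on_sqrt smooth_on_const smooth_on_lorentz smNV V(1))
      (auto simp: V_def)
  have mm: "lorentz (m u) (m u) = 1" "lorentz (m u) (s u) = 0" "lorentz (m u) (pd i s u) = 0" if u: "u \<in> V" for u i
  proof -
    have uW: "u \<in> W" using u V by blast
    note p = normal_proj_props[OF rr[OF uW], of v, folded N_def]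
    show "lorentz (m u) (m u) = 1" using u by (simp add: m_def V_def lorentz_simps)
    show "lorentz (m u) (s u) = 0" "lorentz (m u) (pd i s u) = 0"
      using p exhaust_2[of i] by (auto simp: m_def lorentz_simps)
  qed
  define tr where "tr u = trace_wrt (ind_metric s u) (\<chi> i j. lorentz (pd i (pd j s) u) (m u))" for u
  have det: "det (ind_metric s u) \<noteq> 0" if "u \<in> V" for u
    using sVd(5)[OF that] by (auto simp: regular_def)
  have "smooth_on V (\<lambda>u. (1 / det (ind_metric s u)) *\<^sub>R
      (ind_metric s u $2$2 *\<^sub>R lorentz (pd 1 (pd 1 s) u) (m u) - ind_metric s u $1$2 *\<^sub>R lorentz (pd 1 (pd 2 s) u) (m u)
     - ind_metric s u $2$1 *\<^sub>R lorentz (pd 2 (pd 1 s) u) (m u) + ind_metric s u $1$1 *\<^sub>R lorentz (pd 2 (pd 2 s) u) (m u)))"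
    by (intro smooth_on_scaleR smooth_on_divide smooth_on_add smooth_on_diff smooth_on_ind_metric[OF sV]
        smooth_on_const smooth_on_lorentz sVd smm V(1)) (use det in auto)
  then have smtr: "smooth_on V tr"
    by (rule smooth_on_cong[OF _ V(1)]) (simp add: tr_def trace_wrt_2[OF det])
  \<comment> \<open>A summand \<open>c s\<close> changes the trace by \<open>-2 c\<close>, since
    second derivatives of \<open>s\<close> pair with \<open>s\<close> to minus the metric; hence the
    coefficient \<open>tr u / 2\<close>.\<close>
  define n where "n u = m u + (tr u / 2) *\<^sub>R s u" for u
  have "smooth_on V n" unfolding n_def
    by (intro smooth_on_add smooth_on_scaleR smooth_on_divide smooth_on_const smm smtr sVd V(1)) auto
  moreover have "normal_at s u (n u)" if u: "u \<in> V" for u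
  proof -
    note mu = mm[OF u] and ru = sVd(5)[OF u, unfolded regular_def]
    note e = trace_wrt_2[OF det[OF u]]
    have sym: "ind_metric s u $ 2 $ 1 = ind_metric s u $ 1 $ 2" by (simp add: ind_metric_def lorentz_commute)
    have c: "lorentz (s u) (m u) = 0" "lorentz (s u) (pd i s u) = 0" for i
      using mu ru by (simp_all add: lorentz_commute)
    have "trace_wrt (ind_metric s u) (\<chi> i j. lorentz (pd i (pd j s) u) (n u)) =
        tr u - (tr u / 2) * trace_wrt (ind_metric s u) (ind_metric s u)"
    proof -
      have "lorentz (pd i (pd j s) u) (n u) = lorentz (pd i (pd j s) u) (m u) + (- tr u / 2) * (ind_metric s u $ i $ j)" for i j
        using ru by (simp add: n_def lorentz_simps)
      then show ?thesis by (simp only: trace_wrt_add trace_wrt_mult vec_lambda_eta) (simp add: tr_def)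
    qed
    also have "trace_wrt (ind_metric s u) (ind_metric s u) = 2"
      using det[OF u] unfolding e by (simp add: field_simps) (simp add: det_2 sym algebra_simps)
    finally show ?thesis
      using mu ru c by (simp add: normal_at_def n_def lorentz_simps)
  qed
  ultimately show ?thesis using that V u0V by blast
qed

lemma pd_gauge:
  fixes \<mu> :: "real^2 \<Rightarrow> real"
  assumes s: "section_on W s" and \<mu>: "smooth_on W \<mu>" and u: "u \<in> W"
  shows "pd i (\<lambda>w. \<mu> w *\<^sub>R s w) u = \<mu> u *\<^sub>R pd i s u + pd i \<mu> u *\<^sub>R s u"
    and "pd i (pd j (\<lambda>w. \<mu> w *\<^sub>R s w)) u = \<mu> u *\<^sub>R pd i (pd j s) u + pd i \<mu> u *\<^sub>R pd j s u
      + pd j \<mu> u *\<^sub>R pd i s u + pd i (pd j \<mu>) u *\<^sub>R s u"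
    and "ind_metric (\<lambda>w. \<mu> w *\<^sub>R s w) u = (\<mu> u)\<^sup>2 *\<^sub>R ind_metric s u"
proof -
  note sd = section_onD[OF s]
  have 1: "pd i (\<lambda>w. \<mu> w *\<^sub>R s w) u = \<mu> u *\<^sub>R pd i s u + pd i \<mu> u *\<^sub>R s u" if "u \<in> W" for u i
    using pd_scaleR[OF \<mu> sd(2) that, of i] by simp
  then show "pd i (\<lambda>w. \<mu> w *\<^sub>R s w) u = \<mu> u *\<^sub>R pd i s u + pd i \<mu> u *\<^sub>R s u" using u .
  have "pd i (pd j (\<lambda>w. \<mu> w *\<^sub>R s w)) u = pd i (\<lambda>w. \<mu> w *\<^sub>R pd j s w + pd j \<mu> w *\<^sub>R s w) u"
    by (rule pd_cong[OF sd(1) u]) (rule 1)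
  also have "\<dots> = pd i (\<lambda>w. \<mu> w *\<^sub>R pd j s w) u + pd i (\<lambda>w. pd j \<mu> w *\<^sub>R s w) u"
    by (rule pd_add[OF _ _ u]; intro smooth_on_scaleR sd \<mu> smooth_on_pd)
  also have "\<dots> = \<mu> u *\<^sub>R pd i (pd j s) u + pd i \<mu> u *\<^sub>R pd j s u
      + pd j \<mu> u *\<^sub>R pd i s u + pd i (pd j \<mu>) u *\<^sub>R s u"
    by (simp add: pd_scaleR[OF \<mu> sd(3) u] pd_scaleR[OF smooth_on_pd[OF \<mu>] sd(2) u])
  finally show "pd i (pd j (\<lambda>w. \<mu> w *\<^sub>R s w)) u = \<mu> u *\<^sub>R pd i (pd j s) u + pd i \<mu> u *\<^sub>R pd j s u
      + pd j \<mu> u *\<^sub>R pd i s u + pd i (pd j \<mu>) u *\<^sub>R s u" .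
  have "lorentz (s u) (s u) = 0" "lorentz (pd i s u) (s u) = 0" "lorentz (s u) (pd i s u) = 0" for i
    using sd(5)[OF u] by (auto simp: regular_def lorentz_commute)
  then show "ind_metric (\<lambda>w. \<mu> w *\<^sub>R s w) u = (\<mu> u)\<^sup>2 *\<^sub>R ind_metric s u"
    by (simp add: ind_metric_def vec_eq_iff 1[OF u] lorentz_simps power2_eq_square)
qed

text \<open>Apart from the factor \<mu>, a change of gauge alters second derivatives only by terms
  orthogonal to \<open>n\<close>, so the same normal serves both gauges.\<close>

lemma normal_at_gauge:
  assumes s: "section_on W s" and \<mu>: "smooth_on W \<mu>" "\<mu> u \<noteq> 0" and u: "u \<in> W" and n: "normal_at s u n"
  shows "normal_at (\<lambda>w. \<mu> w *\<^sub>R s w) u n"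
    and "lorentz (pd i (pd j (\<lambda>w. \<mu> w *\<^sub>R s w)) u) n = \<mu> u * lorentz (pd i (pd j s) u) n"
proof -
  note p = pd_gauge[OF s \<mu>(1) u]
  have ns: "lorentz (s u) n = 0" "lorentz (pd i s u) n = 0" for i
    using n by (simp_all add: normal_at_def lorentz_commute)
  show 2: "lorentz (pd i (pd j (\<lambda>w. \<mu> w *\<^sub>R s w)) u) n = \<mu> u * lorentz (pd i (pd j s) u) n" for i j
    by (simp add: p lorentz_simps ns)
  have det: "det (ind_metric s u) \<noteq> 0"
    using section_onD(5)[OF s u] by (simp add: regular_def)
  have "trace_wrt (ind_metric (\<lambda>w. \<mu> w *\<^sub>R s w) u) (\<chi> i j. lorentz (pd i (pd j (\<lambda>w. \<mu> w *\<^sub>R s w)) u) n) = 0"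
    using n det \<mu>(2) unfolding 2 p(3) by (simp add: trace_wrt_scaleR trace_wrt_mult normal_at_def)
  then show "normal_at (\<lambda>w. \<mu> w *\<^sub>R s w) u n"
    using n by (simp add: normal_at_def p lorentz_simps)
qed

section \<open>The Gauss and Codazzi equations\<close>

locale normal_section =
  fixes W :: "(real^2) set" and s n :: "real^2 \<Rightarrow> mink"
  assumes sec: "section_on W s" and smooth_n: "smooth_on W n"
    and normal: "\<And>u. u \<in> W \<Longrightarrow> normal_at s u (n u)"
begin

abbreviation h :: "real^2 \<Rightarrow> mink" where "h u \<equiv> dual_at s u (n u)"
abbreviation g :: "real^2 \<Rightarrow> real^2^2" where "g \<equiv> ind_metric s"

text \<open>\<open>A\<close> and minus \<open>B\<close> are the coefficients of second derivatives
  along \<open>s\<close> and \<open>n\<close>; the sign of \<open>B\<close> agrees with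
  \<open>second_ff\<close>, so that \<open>II0\<close> is \<open>B\<close> times the normal.
  \<open>T\<close> is the Levi-Civita part.\<close>

definition A :: "2 \<Rightarrow> 2 \<Rightarrow> real^2 \<Rightarrow> real" where "A i j u = - lorentz (pd i (pd j s) u) (h u)"
definition B :: "2 \<Rightarrow> 2 \<Rightarrow> real^2 \<Rightarrow> real" where "B i j u = - lorentz (pd i (pd j s) u) (n u)"
definition T :: "2 \<Rightarrow> 2 \<Rightarrow> real^2 \<Rightarrow> mink" where "T i j u = (\<Sum>k\<in>UNIV. christoffel g u k i j *\<^sub>R pd k s u)"

lemmas sd = section_onD[OF sec]

lemma smooth_h: "smooth_on W h"
  by (rule smooth_on_dual_at[OF sec smooth_n])

lemma frame: "u \<in> W \<Longrightarrow> frame (s u) (pd 1 s u) (pd 2 s u) (n u) (h u)"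
  by (rule frame_normal_at[OF sd(5) normal])

lemmas fs = frame_simps[OF frame]

lemma frame_pd:
  assumes "u \<in> W"
  shows "lorentz (pd i s u) (s u) = 0" "lorentz (s u) (pd i s u) = 0" "lorentz (n u) (pd i s u) = 0"
    "lorentz (pd i s u) (n u) = 0" "lorentz (h u) (pd i s u) = 0" "lorentz (pd i s u) (h u) = 0"
  using fs[OF assms] exhaust_2[of i] by auto

lemma s_commute: "u \<in> W \<Longrightarrow> pd i (pd j s) u = pd j (pd i s) u"
  by (rule pd_commute[OF sd(2,1)])

lemma det_g: "u \<in> W \<Longrightarrow> det (g u) > 0" "u \<in> W \<Longrightarrow> det (g u) \<noteq> 0"
  using sd(5)[of u] by (auto simp: regular_def)

lemma g_sym: "g u $ i $ j = g u $ j $ i"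
  by (simp add: ind_metric_def lorentz_commute)

lemma second_s: "u \<in> W \<Longrightarrow> lorentz (pd i (pd j s) u) (s u) = - g u $ i $ j"
  using sd(5) by (simp add: regular_def)

lemma pd_g: "u \<in> W \<Longrightarrow> pd k (\<lambda>w. g w $ i $ j) u = lorentz (pd k (pd i s) u) (pd j s u) + lorentz (pd i s u) (pd k (pd j s) u)"
  using pd_lorentz[OF sd(3,3)] by (simp add: ind_metric_def)

text \<open>For a metric made of products of first derivatives of \<open>s\<close>, the Koszul
  combination collapses to twice one product, by symmetry of second derivatives.\<close>

lemma christoffel_eq:
  assumes u: "u \<in> W"
  shows "christoffel g u k i j = (\<Sum>l\<in>UNIV. matrix_inv (g u) $ k $ l * lorentz (pd i (pd j s) u) (pd l s u))"
proof -
  have "pd i (\<lambda>w. g w $ j $ l) u + pd j (\<lambda>w. g w $ i $ l) u - pd l (\<lambda>w. g w $ i $ j) u =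
      2 * lorentz (pd i (pd j s) u) (pd l s u)" for l
    unfolding pd_g[OF u] s_commute[OF u, of j i] s_commute[OF u, of l i] s_commute[OF u, of l j]
      lorentz_commute[of "pd j s u" "pd i (pd l s) u"] by simp
  then show ?thesis by (simp add: christoffel_def)
qed

lemma christoffel_sym: "u \<in> W \<Longrightarrow> christoffel g u k i j = christoffel g u k j i"
  by (simp add: christoffel_eq s_commute[of u j i])

lemma smooth_christoffel: "smooth_on W (\<lambda>u. christoffel g u k i j)"
proof -
  have "smooth_on W (\<lambda>u. matrix_inv (g u) $ k $ l)" for k l
  proof -
    have "smooth_on W (\<lambda>u. (if k = l then (if k = 1 then g u$2$2 else g u$1$1) else - g u$k$l) / det (g u))"
      by (cases "k = l"; cases "k = 1")
        (auto intro!: smooth_on_divide smooth_on_ind_metric[OF sec] smooth_on_minus sd(1) det_g(2))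
    then show ?thesis by (rule smooth_on_cong[OF _ sd(1)]) (simp add: matrix_inv_2[OF det_g(2)])
  qed
  then have "smooth_on W (\<lambda>u. \<Sum>l\<in>UNIV. matrix_inv (g u) $ k $ l * lorentz (pd i (pd j s) u) (pd l s u))"
    by (intro smooth_on_sum smooth_on_mult smooth_on_lorentz sd)
  then show ?thesis by (rule smooth_on_cong[OF _ sd(1)]) (simp add: christoffel_eq)
qed

lemma T_proj2:
  assumes u: "u \<in> W"
  shows "T i j u = proj2 (pd 1 s u) (pd 2 s u) (pd i (pd j s) u)"
  by (simp add: T_def christoffel_eq[OF u] sum_2 matrix_inv_2[OF det_g(2)[OF u]] proj2_def det_ind_metric)
    (simp add: ind_metric_def lorentz_commute[of "pd 2 s u" "pd 1 s u"] diff_divide_distrib mult.commute algebra_simps)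

lemma lorentz_T:
  assumes u: "u \<in> W"
  shows "lorentz (T i j u) (pd k s u) = lorentz (pd i (pd j s) u) (pd k s u)"
    "lorentz (T i j u) (s u) = 0" "lorentz (T i j u) (h u) = 0" "lorentz (T i j u) (n u) = 0"
  using lorentz_proj2[OF fs(24)[OF u], of "pd i (pd j s) u"] exhaust_2[of k]
  by (auto simp: T_proj2[OF u] lorentz_proj2_perp fs[OF u] simp del: split_paired_All)

lemma T_sum: "lorentz (T i j u) v = (\<Sum>k\<in>UNIV. christoffel g u k i j * lorentz (pd k s u) v)"
  by (simp add: T_def lorentz.sum_left lorentz_simps)

lemma gauss_formula:
  assumes u: "u \<in> W"
  shows "pd i (pd j s) u = T i j u + A i j u *\<^sub>R s u + g u $ i $ j *\<^sub>R h u - B i j u *\<^sub>R n u"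
  by (subst frame_expand[OF frame[OF u]])
    (simp add: frame_comb_def T_proj2[OF u] A_def B_def second_s[OF u])

lemma A_sym: "u \<in> W \<Longrightarrow> A i j u = A j i u" and B_sym: "u \<in> W \<Longrightarrow> B i j u = B j i u"
  by (simp_all add: A_def B_def s_commute[of u i j])

lemma trace_B: "u \<in> W \<Longrightarrow> trace_wrt (g u) (\<chi> i j. B i j u) = 0"
  using trace_wrt_mult[of "g u" "-1" "\<lambda>i j. lorentz (pd i (pd j s) u) (n u)"] normal[of u]
  by (simp add: B_def normal_at_def)

lemma trace_g: "u \<in> W \<Longrightarrow> trace_wrt (g u) (g u) = 2"
  using det_g(2)[of u] by (simp add: trace_wrt_2 field_simps) (simp add: det_2 g_sym[of u 2 1] algebra_simps)

text \<open>With the upper index lowered, Christoffel symbols are products of second and first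
  derivatives of \<open>s\<close>. Differentiating them produces third derivatives that cancel in
  the curvature, and the second derivatives contribute only their parts outside the tangent plane:
  there \<open>s\<close> and \<open>h\<close> give the \<open>A\<close> terms and \<open>n\<close>
  gives the determinant of \<open>B\<close>.\<close>

lemma gauss_curvature_eq:
  assumes u: "u \<in> W"
  shows "gauss_curvature g u = - trace_wrt (g u) (\<chi> i j. A i j u) + (B 1 1 u * B 2 2 u - (B 1 2 u)\<^sup>2) / det (g u)"
proof -
  let ?C = "\<lambda>k i j. christoffel g u k i j"
  let ?s = "\<lambda>i j. pd i (pd j s) u" and ?a = "\<lambda>i. pd i s u"
  have low: "g w $ k $ 1 * christoffel g w 1 i j + g w $ k $ 2 * christoffel g w 2 i j = lorentz (pd i (pd j s) w) (pd k s w)"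
    if w: "w \<in> W" for w i j k
    using lorentz_T(1)[OF w, of i j k] unfolding T_sum
    by (simp add: sum_2 ind_metric_def lorentz_commute[of "pd k s w"] mult.commute)
  \<comment> \<open>Differentiating the lowered symbols avoids derivatives of the inverse
    metric.\<close>
  have dlow: "(pd m (\<lambda>w. g w $ k $ 1) u * ?C 1 i j + g u $ k $ 1 * pd m (\<lambda>w. christoffel g w 1 i j) u) +
      (pd m (\<lambda>w. g w $ k $ 2) u * ?C 2 i j + g u $ k $ 2 * pd m (\<lambda>w. christoffel g w 2 i j) u) =
      lorentz (pd m (pd i (pd j s)) u) (?a k) + lorentz (?s i j) (?s m k)" for m k i j
  proof -
    have "pd m (\<lambda>w. g w $ k $ 1 * christoffel g w 1 i j + g w $ k $ 2 * christoffel g w 2 i j) u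
       = pd m (\<lambda>w. lorentz (pd i (pd j s) w) (pd k s w)) u"
      by (rule pd_cong[OF sd(1) u]) (rule low)
    then show ?thesis
      by (simp add: pd_add[OF smooth_on_mult smooth_on_mult u] pd_mult[OF _ _ u] pd_lorentz[OF _ _ u]
          smooth_on_ind_metric[OF sec] smooth_christoffel sd)
  qed
  have third: "pd 1 (pd 2 (pd 2 s)) u = pd 2 (pd 1 (pd 2 s)) u"
    by (rule pd_commute[OF sd(3,1) u])
  have "(\<Sum>l\<in>UNIV. g u $ 1 $ l * riemann g u l 2 1 2) =
     lorentz (?s 1 1) (?s 2 2 - T 2 2 u) - lorentz (?s 1 2) (?s 1 2 - T 1 2 u)"
  proof -
    have TT: "lorentz (?s i j) (T k l u) = ?C 1 k l * lorentz (?s i j) (?a 1) + ?C 2 k l * lorentz (?s i j) (?a 2)" for i j k l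
      using T_sum[of k l u "?s i j"] by (simp add: sum_2 lorentz_commute)
    have e1: "g u $ 1 $ 1 * pd 1 (\<lambda>w. christoffel g w 1 2 2) u + g u $ 1 $ 2 * pd 1 (\<lambda>w. christoffel g w 2 2 2) u =
       lorentz (pd 1 (pd 2 (pd 2 s)) u) (?a 1) + lorentz (?s 2 2) (?s 1 1)
       - pd 1 (\<lambda>w. g w $ 1 $ 1) u * ?C 1 2 2 - pd 1 (\<lambda>w. g w $ 1 $ 2) u * ?C 2 2 2"
      using dlow[of 1 1 2 2] by linarith
    have e2: "g u $ 1 $ 1 * pd 2 (\<lambda>w. christoffel g w 1 1 2) u + g u $ 1 $ 2 * pd 2 (\<lambda>w. christoffel g w 2 1 2) u =
       lorentz (pd 2 (pd 1 (pd 2 s)) u) (?a 1) + lorentz (?s 1 2) (?s 2 1)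
       - pd 2 (\<lambda>w. g w $ 1 $ 1) u * ?C 1 1 2 - pd 2 (\<lambda>w. g w $ 1 $ 2) u * ?C 2 1 2"
      using dlow[of 2 1 1 2] by linarith
    have "(\<Sum>l\<in>UNIV. g u $ 1 $ l * riemann g u l 2 1 2) =
       (g u $ 1 $ 1 * pd 1 (\<lambda>w. christoffel g w 1 2 2) u + g u $ 1 $ 2 * pd 1 (\<lambda>w. christoffel g w 2 2 2) u)
     - (g u $ 1 $ 1 * pd 2 (\<lambda>w. christoffel g w 1 1 2) u + g u $ 1 $ 2 * pd 2 (\<lambda>w. christoffel g w 2 1 2) u)
     + (g u $ 1 $ 1 * ?C 1 1 1 + g u $ 1 $ 2 * ?C 2 1 1) * ?C 1 2 2
     + (g u $ 1 $ 1 * ?C 1 1 2 + g u $ 1 $ 2 * ?C 2 1 2) * ?C 2 2 2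
     - (g u $ 1 $ 1 * ?C 1 2 1 + g u $ 1 $ 2 * ?C 2 2 1) * ?C 1 1 2
     - (g u $ 1 $ 1 * ?C 1 2 2 + g u $ 1 $ 2 * ?C 2 2 2) * ?C 2 1 2"
      by (simp add: riemann_def sum_2 algebra_simps)
    also have "\<dots> = lorentz (?s 1 1) (?s 2 2 - T 2 2 u) - lorentz (?s 1 2) (?s 1 2 - T 1 2 u)"
      unfolding e1 e2 low[OF u] third pd_g[OF u] lorentz_simps TT
      by (simp add: s_commute[OF u, of 2 1] lorentz_commute[of "?s 2 2" "?s 1 1"]
          lorentz_commute[of "?a 1"] lorentz_commute[of "?a 2" "?s _ _"] algebra_simps)
    finally show ?thesis .
  qed
  also have "\<dots> = - (A 2 2 u * g u $ 1 $ 1 + A 1 1 u * g u $ 2 $ 2 - 2 * A 1 2 u * g u $ 1 $ 2)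
      + (B 1 1 u * B 2 2 u - (B 1 2 u)\<^sup>2)"
  proof -
    have d: "?s i j - T i j u = A i j u *\<^sub>R s u + g u $ i $ j *\<^sub>R h u - B i j u *\<^sub>R n u" for i j
      using gauss_formula[OF u, of i j] by simp
    have "lorentz (?s i j) (h u) = - A i j u" "lorentz (?s i j) (n u) = - B i j u" for i j
      by (simp_all add: A_def B_def)
    then show ?thesis unfolding d by (simp add: lorentz_simps second_s[OF u] power2_eq_square algebra_simps)
  qed
  also have "(A 2 2 u * g u $ 1 $ 1 + A 1 1 u * g u $ 2 $ 2 - 2 * A 1 2 u * g u $ 1 $ 2) =
     det (g u) * trace_wrt (g u) (\<chi> i j. A i j u)"
    using det_g(2)[OF u] by (simp add: trace_wrt_2 A_sym[OF u, of 2 1] g_sym[of u 2 1] algebra_simps)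
  finally show ?thesis using det_g(2)[OF u]
    unfolding gauss_curvature_def by (simp add: add_divide_distrib diff_divide_distrib)
qed

lemma hessian_eq:
  assumes u: "u \<in> W"
  shows "hessian g s u $ i $ j = A i j u *\<^sub>R s u + g u $ i $ j *\<^sub>R h u - B i j u *\<^sub>R n u"
  using gauss_formula[OF u, of i j] by (simp add: hessian_def T_def)

lemma r0_eqI:
  assumes u: "u \<in> W" and e: "sym0 (g u) (hessian g s u) $ i $ j = (- a) *\<^sub>R s u + b *\<^sub>R n u"
  shows "r0 s u $ i $ j = a"
proof -
  have nn: "lorentz (n u) (n u) = 1" by (rule fs(10)[OF u])
  have s0: "s u \<noteq> 0" using fs(5)[OF u] by (auto simp: lorentz_simps)
  have "tan_proj (central_sphere s u) (sym0 (g u) (hessian g s u) $ i $ j) = - (a *\<^sub>R s u)"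
    unfolding e central_sphere_eq[OF sd(5)[OF u] normal[OF u]] tan_proj_perp[OF nn]
    by (simp add: lorentz_simps fs[OF u])
  then show ?thesis using s0 by (simp add: r0_def)
qed

text \<open>The \<open>h\<close>-coefficient of the Hessian is the metric itself and disappears with
  the trace; the \<open>B\<close> part is removed by the projection to the sphere. What remains
  along \<open>s\<close> is the tracefree part of \<open>A\<close>.\<close>

lemma r0_eq:
  assumes u: "u \<in> W"
  shows "r0 s u $ i $ j = - A i j u + trace_wrt (g u) (\<chi> i j. A i j u) / 2 * g u $ i $ j"
proof (rule r0_eqI[OF u])
  have tr: "trace_wrt (g u) (hessian g s u) = trace_wrt (g u) (\<chi> i j. A i j u) *\<^sub>R s u + 2 *\<^sub>R h u"
  proof -
    have "trace_wrt (g u) (hessian g s u) = trace_wrt (g u) (\<chi> i j. A i j u) *\<^sub>R s u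
       + trace_wrt (g u) (g u) *\<^sub>R h u - trace_wrt (g u) (\<chi> i j. B i j u) *\<^sub>R n u"
      by (simp add: trace_wrt_def hessian_eq[OF u] sum_2 scaleR_add_left scaleR_add_right scaleR_diff_right)
    then show ?thesis by (simp add: trace_B[OF u] trace_g[OF u])
  qed
  show "sym0 (g u) (hessian g s u) $ i $ j =
      (- (- A i j u + trace_wrt (g u) (\<chi> i j. A i j u) / 2 * g u $ i $ j)) *\<^sub>R s u + (- B i j u) *\<^sub>R n u"
  proof -
    have "hessian g s u $ j $ i = hessian g s u $ i $ j"
      by (simp add: hessian_eq[OF u] A_sym[OF u, of j i] B_sym[OF u, of j i] g_sym[of u j i])
    then have "sym0 (g u) (hessian g s u) $ i $ j = (1/2) *\<^sub>R (hessian g s u $ i $ j + hessian g s u $ i $ j)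
       - (g u $ i $ j / 2) *\<^sub>R (trace_wrt (g u) (\<chi> i j. A i j u) *\<^sub>R s u + 2 *\<^sub>R h u)"
      by (simp add: sym0_def tr)
    also have "(1/2) *\<^sub>R (hessian g s u $ i $ j + hessian g s u $ i $ j) = hessian g s u $ i $ j"
      by (simp only: scaleR_half_double)
    finally show ?thesis by (simp add: hessian_eq[OF u] algebra_simps)
  qed
qed

lemma pd_h:
  assumes u: "u \<in> W"
  shows "lorentz (s u) (pd i h u) = 0" "lorentz (h u) (pd i h u) = 0"
    "lorentz (pd i (pd j s) u) (h u) + lorentz (pd j s u) (pd i h u) = 0"
    "lorentz (pd i n u) (h u) + lorentz (n u) (pd i h u) = 0"
proof -
  note pl = pd_lorentz[OF _ _ u] and pc = pd_const_on[OF sd(1) u]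
  show "lorentz (s u) (pd i h u) = 0"
    using pl[OF sd(2) smooth_h, of i] pc[of "\<lambda>w. lorentz (s w) (h w)" "-1"] fs(9) frame_pd(6)[OF u] by simp
  show "lorentz (h u) (pd i h u) = 0"
    using pl[OF smooth_h smooth_h, of i] pc[of "\<lambda>w. lorentz (h w) (h w)" 0 i] fs(17)
    by (simp add: lorentz_commute)
  show "lorentz (pd i (pd j s) u) (h u) + lorentz (pd j s u) (pd i h u) = 0"
    using pl[OF sd(3) smooth_h, of i] pc[of "\<lambda>w. lorentz (pd j s w) (h w)" 0 i] frame_pd(6) by simp
  show "lorentz (pd i n u) (h u) + lorentz (n u) (pd i h u) = 0"
    using pl[OF smooth_n smooth_h, of i] pc[of "\<lambda>w. lorentz (n w) (h w)" 0 i] fs(13) by simp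
qed

lemma pd_n:
  assumes u: "u \<in> W"
  shows "lorentz (pd i n u) (n u) = 0" "lorentz (pd i n u) (s u) = 0" "lorentz (pd i n u) (pd j s u) = B i j u"
proof -
  note pl = pd_lorentz[OF _ _ u] and pc = pd_const_on[OF sd(1) u]
  show "lorentz (pd i n u) (n u) = 0"
    using pl[OF smooth_n smooth_n, of i] pc[of "\<lambda>w. lorentz (n w) (n w)" 1 i] fs(10)
    by (simp add: lorentz_commute)
  show "lorentz (pd i n u) (s u) = 0"
    using pl[OF smooth_n sd(2), of i] pc[of "\<lambda>w. lorentz (n w) (s w)" 0 i] fs(4) frame_pd(3)[OF u] by simp
  show "lorentz (pd i n u) (pd j s u) = B i j u"
    using pl[OF smooth_n sd(3), of i] pc[of "\<lambda>w. lorentz (n w) (pd j s w)" 0 i] frame_pd(3)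
    by (simp add: B_def lorentz_commute)
qed

lemma smooth_A: "smooth_on W (A i j)"
  unfolding A_def[abs_def] by (intro smooth_on_minus smooth_on_lorentz sd smooth_h)

lemma ext_cov_eq:
  assumes u: "u \<in> W"
  shows "ext_cov g r u 1 2 j = pd 1 (\<lambda>w. r w $ 2 $ j) u - pd 2 (\<lambda>w. r w $ 1 $ j) u
    - (\<Sum>m\<in>UNIV. christoffel g u m 1 j * r u $ 2 $ m) + (\<Sum>m\<in>UNIV. christoffel g u m 2 j * r u $ 1 $ m)"
  by (simp add: ext_cov_def cov2_def christoffel_sym[OF u, of _ 2 1])

text \<open>The determinant condition turns the tensor to be differentiated into
  \<open>- A - g / 2\<close>. The metric part is parallel and third derivatives of \<open>s\<close>
  are symmetric; what survives are second derivatives of \<open>s\<close> paired with derivatives of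
  \<open>h\<close>. The Christoffel terms take away their tangential parts, and \<open>s\<close> and
  \<open>h\<close> are orthogonal to \<open>pd k h\<close>, so only the parts along \<open>n\<close>
  are left.\<close>

lemma codazzi:
  assumes det: "\<And>w. w \<in> W \<Longrightarrow> B 1 1 w * B 2 2 w - (B 1 2 w)\<^sup>2 = - det (g w)" and u: "u \<in> W"
  shows "cotton s u 1 2 j = B 1 j u * lorentz (n u) (pd 2 h u) - B 2 j u * lorentz (n u) (pd 1 h u)"
proof -
  let ?s = "\<lambda>i j. pd i (pd j s) u" and ?a = "\<lambda>i. pd i s u"
  let ?r = "\<lambda>w. r0 s w + (gauss_curvature g w / 2) *\<^sub>R g w"
  have r: "?r w $ i $ j = - A i j w - g w $ i $ j / 2" if w: "w \<in> W" for w i j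
  proof -
    have K: "gauss_curvature g w = - trace_wrt (g w) (\<chi> i j. A i j w) - 1"
      using gauss_curvature_eq[OF w] det[OF w] det_g(2)[OF w] by simp
    show ?thesis by (simp add: r0_eq[OF w] K) (simp add: field_simps)
  qed
  have pdA: "pd k (A i j) u = - lorentz (pd k (pd i (pd j s)) u) (h u) - lorentz (?s i j) (pd k h u)" for k i j
    unfolding A_def[abs_def]
    by (simp add: pd_minus[OF smooth_on_lorentz u] pd_lorentz[OF _ _ u] sd smooth_h)
  have pdr: "pd k (\<lambda>w. ?r w $ i $ j) u = lorentz (pd k (pd i (pd j s)) u) (h u) + lorentz (?s i j) (pd k h u)
     - (lorentz (?s k i) (?a j) + lorentz (?a i) (?s k j)) / 2" for k i
  proof -
    have "pd k (\<lambda>w. ?r w $ i $ j) u = pd k (\<lambda>w. - A i j w - (1/2) *\<^sub>R g w $ i $ j) u"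
      by (rule pd_cong[OF sd(1) u]) (simp only: r, simp)
    also have "\<dots> = pd k (\<lambda>w. - A i j w) u - pd k (\<lambda>w. (1/2) *\<^sub>R g w $ i $ j) u"
      by (rule pd_diff[OF _ _ u]; intro smooth_on_minus smooth_on_scaleR smooth_on_const sd smooth_A smooth_on_ind_metric[OF sec])
    also have "\<dots> = - pd k (A i j) u - (1/2) *\<^sub>R pd k (\<lambda>w. g w $ i $ j) u"
      by (simp only: pd_minus[OF smooth_A u] pd_scaleR_const[OF smooth_on_ind_metric(1)[OF sec] u])
    finally show ?thesis by (simp add: pdA pd_g[OF u])
  qed
  have third: "pd 1 (pd 2 (pd j s)) u = pd 2 (pd 1 (pd j s)) u"
    by (rule pd_commute[OF sd(3,1) u])
  have contr: "(\<Sum>m\<in>UNIV. christoffel g u m i j * ?r u $ k $ m) =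
      - lorentz (T i j u) (pd k h u) - lorentz (?s i j) (?a k) / 2" for i k
  proof -
    have rk: "?r u $ k $ m = - lorentz (?a m) (pd k h u) - lorentz (?a m) (?a k) / 2" for m
      unfolding r[OF u] using pd_h(3)[OF u, of k m] by (simp add: A_def ind_metric_def lorentz_commute[of "?a k"])
    have "(\<Sum>m\<in>UNIV. christoffel g u m i j * ?r u $ k $ m) =
      - lorentz (T i j u) (pd k h u) - lorentz (T i j u) (?a k) / 2"
      unfolding T_sum rk by (simp add: sum_2 algebra_simps add_divide_distrib)
    then show ?thesis by (simp add: lorentz_T[OF u])
  qed
  have d: "lorentz (?s i j) (pd k h u) - lorentz (T i j u) (pd k h u) = - B i j u * lorentz (n u) (pd k h u)" for i k
  proof -
    have "lorentz (?s i j) (pd k h u) = lorentz (T i j u + A i j u *\<^sub>R s u + g u $ i $ j *\<^sub>R h u - B i j u *\<^sub>R n u) (pd k h u)"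
      by (simp only: gauss_formula[OF u, of i j, symmetric])
    then show ?thesis by (simp add: lorentz_simps pd_h[OF u])
  qed
  have "cotton s u 1 2 j = pd 1 (\<lambda>w. ?r w $ 2 $ j) u - pd 2 (\<lambda>w. ?r w $ 1 $ j) u
    - (\<Sum>m\<in>UNIV. christoffel g u m 1 j * ?r u $ 2 $ m) + (\<Sum>m\<in>UNIV. christoffel g u m 2 j * ?r u $ 1 $ m)"
    unfolding cotton_def by (rule ext_cov_eq[OF u])
  also have "\<dots> = (lorentz (?s 2 j) (pd 1 h u) - lorentz (T 2 j u) (pd 1 h u))
     - (lorentz (?s 1 j) (pd 2 h u) - lorentz (T 1 j u) (pd 2 h u))"
    unfolding pdr contr third s_commute[OF u, of 2 1]
    by (simp add: lorentz_commute[of "?a _" "?s _ _"] field_simps)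
  also have "\<dots> = B 1 j u * lorentz (n u) (pd 2 h u) - B 2 j u * lorentz (n u) (pd 1 h u)"
    unfolding d by simp
  finally show ?thesis .
qed

text \<open>The two Codazzi components are a homogeneous linear system for the products
  \<open>lorentz (n u) (pd i h u)\<close>, and its determinant is, up to sign, that of
  \<open>B\<close>, hence nonzero.\<close>

lemma flat_imp_parallel:
  assumes det: "\<And>w. w \<in> W \<Longrightarrow> B 1 1 w * B 2 2 w - (B 1 2 w)\<^sup>2 = - det (g w)" and u: "u \<in> W"
    and flat: "\<And>j. cotton s u 1 2 j = 0"
  shows "lorentz (pd i n u) (h u) = 0"
proof -
  let ?t = "\<lambda>i. lorentz (n u) (pd i h u)"
  have e1: "B 1 1 u * ?t 2 = B 1 2 u * ?t 1" and e2: "B 1 2 u * ?t 2 = B 2 2 u * ?t 1"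
    using codazzi[OF det u, of 1] codazzi[OF det u, of 2] flat B_sym[OF u, of 2 1] by simp_all
  have "(B 1 1 u * B 2 2 u - (B 1 2 u)\<^sup>2) * ?t 2 = B 2 2 u * (B 1 1 u * ?t 2) - B 1 2 u * (B 1 2 u * ?t 2)"
    by (simp add: power2_eq_square algebra_simps)
  also have "\<dots> = 0" unfolding e1 e2 by simp
  finally have 2: "?t 2 = 0" using det[OF u] det_g(2)[OF u] by simp
  have "(B 1 1 u * B 2 2 u - (B 1 2 u)\<^sup>2) * ?t 1 = B 1 1 u * (B 2 2 u * ?t 1) - B 1 2 u * (B 1 2 u * ?t 1)"
    by (simp add: power2_eq_square algebra_simps)
  also have "\<dots> = 0" unfolding e1[symmetric] e2[symmetric] by simp
  finally have "?t 1 = 0" using det[OF u] det_g(2)[OF u] by simp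
  then have "?t i = 0" using 2 exhaust_2[of i] by auto
  then show ?thesis using pd_h(4)[OF u, of i] by simp
qed

end

section \<open>The canonical gauge\<close>

text \<open>After elimination of \<open>z\<close> by the trace condition, \<open>a * a\<close> times
  the negative determinant becomes a square plus a positive multiple of \<open>x\<^sup>2\<close>.
  Here \<open>a\<close>, \<open>b\<close>, \<open>c\<close> are the entries of a metric and
  \<open>x\<close>, \<open>y\<close>, \<open>z\<close> those of a tracefree form, whose eigenvalues
  are opposite.\<close>

lemma tracefree_det:
  fixes a b c x y z :: real
  assumes "a > 0" "a * c - b * b > 0" and tr: "c * x - 2 * b * y + a * z = 0"
  shows "y * y - x * z \<ge> 0" and "y * y - x * z = 0 \<Longrightarrow> x = 0 \<and> y = 0 \<and> z = 0"
proof -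
  have "a * a * (y * y - x * z) = a * a * y * y - a * x * (a * z)" by (simp add: algebra_simps)
  also have "a * z = 2 * b * y - c * x" using tr by simp
  also have "a * a * y * y - a * x * (2 * b * y - c * x) = (a * y - b * x)\<^sup>2 + x\<^sup>2 * (a * c - b * b)"
    by (simp add: power2_eq_square algebra_simps)
  finally have *: "a * a * (y * y - x * z) = (a * y - b * x)\<^sup>2 + x\<^sup>2 * (a * c - b * b)" .
  then have "a * a * (y * y - x * z) \<ge> 0" using assms(2) by simp
  moreover have "a * a > 0" using assms(1) by simp
  ultimately show "y * y - x * z \<ge> 0" by (meson linorder_not_le mult_pos_neg)
  assume "y * y - x * z = 0"
  then have "(a * y - b * x)\<^sup>2 + x\<^sup>2 * (a * c - b * b) = 0" using * by simp
  then have "(a * y - b * x)\<^sup>2 = 0" "x\<^sup>2 * (a * c - b * b) = 0"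
    using assms(2) add_nonneg_eq_0_iff[of "(a * y - b * x)\<^sup>2" "x\<^sup>2 * (a * c - b * b)"] by simp_all
  then have "x = 0" "y = 0" using assms(1,2) by auto
  then show "x = 0 \<and> y = 0 \<and> z = 0" using tr assms(1) by simp
qed

context normal_section
begin

lemma trace_B_expand:
  assumes u: "u \<in> W"
  shows "g u $ 2 $ 2 * B 1 1 u - 2 * g u $ 1 $ 2 * B 1 2 u + g u $ 1 $ 1 * B 2 2 u = 0"
proof -
  have "(g u $ 2 $ 2 * B 1 1 u - 2 * g u $ 1 $ 2 * B 1 2 u + g u $ 1 $ 1 * B 2 2 u) / det (g u) = 0"
    using trace_B[OF u] unfolding trace_wrt_2[OF det_g(2)[OF u]]
    by (simp add: B_sym[OF u, of 2 1] g_sym[of u 2 1] add_divide_distrib diff_divide_distrib algebra_simps)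
  then show ?thesis using det_g(2)[OF u] by simp
qed

lemma g_pos: "u \<in> W \<Longrightarrow> g u $ 1 $ 1 > 0"
    "u \<in> W \<Longrightarrow> g u $ 1 $ 1 * g u $ 2 $ 2 - g u $ 1 $ 2 * g u $ 1 $ 2 > 0"
  using sd(5)[of u] by (auto simp: regular_def det_2 g_sym[of u 2 1])

lemma smooth_B: "smooth_on W (B i j)"
  unfolding B_def[abs_def] by (intro smooth_on_minus smooth_on_lorentz sd smooth_n)

lemma II0_B: "u \<in> W \<Longrightarrow> II0 s u = (\<chi> i j. B i j u *\<^sub>R n u)"
  by (simp add: II0_eq[OF sd(5) normal] B_def)

end

text \<open>The factor \<open>\<mu>\<close> is determined by \<open>|II\<^sup>0|\<^sup>2 = 2\<close>, which for a tracefree form is \<open>det II\<^sup>0 = - det g\<close>.\<close>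

lemma canonical_gauge:
  assumes s: "section_on W s" and u0: "u0 \<in> W" and II0: "II0 s u0 \<noteq> 0"
  obtains V \<mu> n where "open V" "u0 \<in> V" "V \<subseteq> W" "smooth_on V \<mu>" "\<And>u. u \<in> V \<Longrightarrow> \<mu> u > 0"
    "smooth_on V n" "\<And>u. u \<in> V \<Longrightarrow> normal_at (\<lambda>w. \<mu> w *\<^sub>R s w) u (n u)"
    "\<And>u. u \<in> V \<Longrightarrow> lorentz (pd 1 (pd 1 (\<lambda>w. \<mu> w *\<^sub>R s w)) u) (n u) * lorentz (pd 2 (pd 2 (\<lambda>w. \<mu> w *\<^sub>R s w)) u) (n u)
       - (lorentz (pd 1 (pd 2 (\<lambda>w. \<mu> w *\<^sub>R s w)) u) (n u))\<^sup>2 = - det (ind_metric (\<lambda>w. \<mu> w *\<^sub>R s w) u)"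
proof -
  obtain W1 n where W1: "open W1" "u0 \<in> W1" "W1 \<subseteq> W" "smooth_on W1 n" "\<And>u. u \<in> W1 \<Longrightarrow> normal_at s u (n u)"
    using exists_normal[OF s u0] by blast
  have s1: "section_on W1 s" by (rule section_on_subset[OF s W1(1,3)])
  interpret N: normal_section W1 s n by unfold_locales (use s1 W1 in auto)
  define D where "D u = N.B 1 2 u * N.B 1 2 u - N.B 1 1 u * N.B 2 2 u" for u
  note tf = tracefree_det[OF N.g_pos N.trace_B_expand, folded D_def]
  have smD: "smooth_on W1 D" unfolding D_def[abs_def]
    by (intro smooth_on_diff smooth_on_mult N.smooth_B W1(1))
  have "D u0 \<noteq> 0"
  proof
    assume "D u0 = 0"
    then have "N.B i j u0 = 0" for i j
      using tf(2)[OF W1(2,2,2)] exhaust_2[of i] exhaust_2[of j] N.B_sym[OF W1(2), of 2 1] by auto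
    then have "II0 s u0 = 0" by (simp add: N.II0_B[OF W1(2)] vec_eq_iff)
    then show False using II0 by simp
  qed
  then have D0: "D u0 > 0" using tf(1)[OF W1(2,2,2)] by simp
  define V where "V = {u \<in> W1. D u > 0}"
  have V: "open V" "V \<subseteq> W1" "u0 \<in> V"
    using open_positive[OF W1(1) smD] D0 W1(2) by (auto simp: V_def)
  have sV: "section_on V s" by (rule section_on_subset[OF s1 V(1,2)])
  \<comment> \<open>Scaling by \<mu> multiplies the determinant of \<open>B\<close> by
    \<open>\<mu>\<^sup>2\<close> and that of the metric by \<open>\<mu>\<^sup>4\<close>, so this
    root makes them opposite.\<close>
  define \<mu> where "\<mu> u = sqrt (D u / det (ind_metric s u))" for u
  have q: "D u / det (ind_metric s u) > 0" if "u \<in> V" for u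
    using that N.det_g(1)[of u] V(2) by (auto simp: V_def)
  have sm\<mu>: "smooth_on V \<mu>" unfolding \<mu>_def[abs_def]
    by (intro smooth_on_sqrt smooth_on_divide V(1) q smooth_on_ind_metric[OF sV] smooth_on_subset[OF smD V(2)])
      (use N.det_g(2) V(2) in auto)
  have pos: "\<mu> u > 0" if "u \<in> V" for u using q[OF that] by (simp add: \<mu>_def)
  show ?thesis
  proof (rule that[OF V(1,3) _ sm\<mu> pos smooth_on_subset[OF W1(4) V(2)]])
    show "V \<subseteq> W" using V(2) W1(3) by blast
    fix u assume u: "u \<in> V"
    then have u1: "u \<in> W1" using V(2) by blast
    have nz: "\<mu> u \<noteq> 0" using pos[OF u] by simp
    note ng = normal_at_gauge[OF sV sm\<mu> nz u W1(5)[OF u1]]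
    show "normal_at (\<lambda>w. \<mu> w *\<^sub>R s w) u (n u)" by (rule ng)
    have m2: "(\<mu> u)\<^sup>2 * det (ind_metric s u) = D u"
      using q[OF u] N.det_g(2)[OF u1] by (simp add: \<mu>_def)
    have "lorentz (pd 1 (pd 1 s) u) (n u) * lorentz (pd 2 (pd 2 s) u) (n u) - (lorentz (pd 1 (pd 2 s) u) (n u))\<^sup>2 = - D u"
      by (simp add: D_def N.B_def power2_eq_square)
    then have "lorentz (pd 1 (pd 1 (\<lambda>w. \<mu> w *\<^sub>R s w)) u) (n u) * lorentz (pd 2 (pd 2 (\<lambda>w. \<mu> w *\<^sub>R s w)) u) (n u)
       - (lorentz (pd 1 (pd 2 (\<lambda>w. \<mu> w *\<^sub>R s w)) u) (n u))\<^sup>2 = (\<mu> u)\<^sup>2 * (- D u)"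
      unfolding ng(2) by (simp add: power2_eq_square algebra_simps flip: m2) (metis distrib_left)
    also have "\<dots> = - det (ind_metric (\<lambda>w. \<mu> w *\<^sub>R s w) u)"
      unfolding pd_gauge(3)[OF sV sm\<mu> u] by (simp add: det_2 algebra_simps flip: m2)
    finally show "lorentz (pd 1 (pd 1 (\<lambda>w. \<mu> w *\<^sub>R s w)) u) (n u) * lorentz (pd 2 (pd 2 (\<lambda>w. \<mu> w *\<^sub>R s w)) u) (n u)
       - (lorentz (pd 1 (pd 2 (\<lambda>w. \<mu> w *\<^sub>R s w)) u) (n u))\<^sup>2 = - det (ind_metric (\<lambda>w. \<mu> w *\<^sub>R s w) u)" .
  qed
qed

text \<open>The form \<open>\<phi>\<close> is closed: when differentiating \<open>\<phi>\<^sub>i = (F\<^sub>i, e)\<close>, the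
  term \<open>(F\<^sub>i, e\<^sub>j) = \<phi>\<^sub>i (e, e\<^sub>j)\<close> vanishes.\<close>

lemma rank_one_closed:
  assumes V: "open V" and F: "smooth_on V F" and pos: "\<And>u. u \<in> V \<Longrightarrow> lorentz (pd v F u) (pd v F u) > 0"
    and rank: "\<And>u i. u \<in> V \<Longrightarrow> pd i F u = (lorentz (pd i F u) (pd v F u) / lorentz (pd v F u) (pd v F u)) *\<^sub>R pd v F u"
  obtains e \<phi> where "smooth_on V e" "\<And>i. smooth_on V (\<phi> i)" "\<And>u. u \<in> V \<Longrightarrow> lorentz (e u) (e u) = 1"
    "\<And>u i. u \<in> V \<Longrightarrow> pd i F u = \<phi> i u *\<^sub>R e u" "\<And>u. u \<in> V \<Longrightarrow> pd 1 (\<phi> 2) u = pd 2 (\<phi> 1) u"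
    "\<And>u. u \<in> V \<Longrightarrow> \<exists>c. e u = c *\<^sub>R pd v F u"
proof -
  define q where "q u = sqrt (lorentz (pd v F u) (pd v F u))" for u
  define e where "e u = (1 / q u) *\<^sub>R pd v F u" for u
  define \<phi> where "\<phi> i u = lorentz (pd i F u) (e u)" for i u
  have q0: "q u > 0" if "u \<in> V" for u using pos[OF that] by (simp add: q_def)
  have smq: "smooth_on V q" unfolding q_def[abs_def]
    by (intro smooth_on_sqrt smooth_on_lorentz smooth_on_pd F V pos)
  have sme: "smooth_on V e" unfolding e_def[abs_def]
    by (intro smooth_on_scaleR smooth_on_divide smooth_on_const smooth_on_pd F V smq) (use q0 in force)
  have sm\<phi>: "smooth_on V (\<phi> i)" for i unfolding \<phi>_def[abs_def]
    by (intro smooth_on_lorentz smooth_on_pd F V sme)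
  have qq: "q u * q u = lorentz (pd v F u) (pd v F u)" if "u \<in> V" for u using pos[OF that] by (simp add: q_def)
  have ee: "lorentz (e u) (e u) = 1" if "u \<in> V" for u
    using q0[OF that] by (simp add: e_def lorentz_simps flip: qq[OF that])
  have Fe: "pd i F u = \<phi> i u *\<^sub>R e u" if "u \<in> V" for u i
    using rank[OF that, of i] qq[OF that] by (simp add: \<phi>_def e_def lorentz_simps)
  have e_pd: "lorentz (e u) (pd j e u) = 0" if u: "u \<in> V" for u j
    using pd_lorentz[OF sme sme u, of j] pd_const_on[OF V u, of "\<lambda>w. lorentz (e w) (e w)" 1 j] ee
    by (simp add: lorentz_commute)
  have "pd j (\<phi> i) u = lorentz (pd j (pd i F) u) (e u)" if u: "u \<in> V" for u i j
  proof -
    have "pd j (\<phi> i) u = lorentz (pd j (pd i F) u) (e u) + lorentz (pd i F u) (pd j e u)"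
      unfolding \<phi>_def[abs_def] by (rule pd_lorentz[OF smooth_on_pd[OF F] sme u])
    then show ?thesis unfolding Fe[OF u] by (simp add: lorentz_simps e_pd[OF u])
  qed
  then have "pd 1 (\<phi> 2) u = pd 2 (\<phi> 1) u" if "u \<in> V" for u
    using that pd_commute[OF F V that, of 1 2] by simp
  moreover have "\<exists>c. e u = c *\<^sub>R pd v F u" for u unfolding e_def by blast
  ultimately show ?thesis using that sme sm\<phi> ee Fe by blast
qed

locale parallel_section = normal_section +
  assumes det_B: "\<And>u. u \<in> W \<Longrightarrow> B 1 1 u * B 2 2 u - (B 1 2 u)\<^sup>2 = - det (g u)"
    and parallel: "\<And>u i. u \<in> W \<Longrightarrow> lorentz (pd i n u) (h u) = 0"
begin

text \<open>As the derivatives of \<open>n\<close> are orthogonal to \<open>h\<close>, they are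
  tangential, and their products are the entries of \<open>B\<close>, inverse metric,
  \<open>B\<close> multiplied together. By Cayley-Hamilton this is \<open>g\<close>, the shape
  operator having trace 0 and determinant -1. The proof multiplies by \<open>det (g u)\<close> and
  finds the difference to be an entry of \<open>B\<close> times the trace term.\<close>

lemma third_ff:
  assumes u: "u \<in> W"
  shows "lorentz (pd i n u) (pd j n u) = g u $ i $ j"
proof -
  let ?D = "det (g u)"
  note D0 = det_g(2)[OF u]
  have e: "pd i n u = proj2 (pd 1 s u) (pd 2 s u) (pd i n u)" for i
    using frame_expand[OF frame[OF u], of "pd i n u"]
    by (simp add: frame_comb_def pd_n[OF u] parallel[OF u])
  have f: "lorentz (pd i n u) (pd j n u) * ?D = (B i 1 u * g u $ 2 $ 2 - B i 2 u * g u $ 1 $ 2) * B j 1 u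
      + (B i 2 u * g u $ 1 $ 1 - B i 1 u * g u $ 1 $ 2) * B j 2 u" for i j
  proof -
    have "lorentz (pd i n u) (pd j n u) = lorentz (proj2 (pd 1 s u) (pd 2 s u) (pd i n u)) (pd j n u)"
      by (simp only: e[symmetric])
    also have "\<dots> = ((B i 1 u * g u $ 2 $ 2 - B i 2 u * g u $ 1 $ 2) * B j 1 u
        + (B i 2 u * g u $ 1 $ 1 - B i 1 u * g u $ 1 $ 2) * B j 2 u) / ?D"
      by (simp add: proj2_def lorentz_simps pd_n[OF u] lorentz_commute[of "pd _ s u" "pd _ n u"] det_ind_metric
          add_divide_distrib) (simp add: ind_metric_def)
    finally show ?thesis using D0 by simp
  qed
  note tr = trace_B_expand[OF u]
  have d: "?D = B 1 2 u * B 1 2 u - B 1 1 u * B 2 2 u" using det_B[OF u] by (simp add: power2_eq_square)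
  note b = B_sym[OF u, of 2 1]
  have "lorentz (pd 1 n u) (pd 1 n u) * ?D = g u $ 1 $ 1 * ?D"
  proof -
    have "lorentz (pd 1 n u) (pd 1 n u) * ?D - g u $ 1 $ 1 * ?D =
       B 1 1 u * (g u $ 2 $ 2 * B 1 1 u - 2 * g u $ 1 $ 2 * B 1 2 u + g u $ 1 $ 1 * B 2 2 u)"
      unfolding f unfolding d by (simp add: algebra_simps)
    then show ?thesis unfolding tr by simp
  qed
  moreover have "lorentz (pd 2 n u) (pd 2 n u) * ?D = g u $ 2 $ 2 * ?D"
  proof -
    have "lorentz (pd 2 n u) (pd 2 n u) * ?D - g u $ 2 $ 2 * ?D =
       B 2 2 u * (g u $ 2 $ 2 * B 1 1 u - 2 * g u $ 1 $ 2 * B 1 2 u + g u $ 1 $ 1 * B 2 2 u)"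
      unfolding f unfolding d b by (simp add: algebra_simps)
    then show ?thesis unfolding tr by simp
  qed
  moreover have "lorentz (pd 1 n u) (pd 2 n u) * ?D = g u $ 1 $ 2 * ?D"
  proof -
    have "lorentz (pd 1 n u) (pd 2 n u) * ?D - g u $ 1 $ 2 * ?D =
       B 1 2 u * (g u $ 2 $ 2 * B 1 1 u - 2 * g u $ 1 $ 2 * B 1 2 u + g u $ 1 $ 1 * B 2 2 u)"
      unfolding f unfolding d b by (simp add: algebra_simps)
    then show ?thesis unfolding tr by simp
  qed
  ultimately show ?thesis
    using D0 exhaust_2[of i] exhaust_2[of j] g_sym[of u 2 1] lorentz_commute[of "pd 2 n u" "pd 1 n u"] by auto
qed

text \<open>The normalized shape operator has eigenvalues \<open>\<plusminus>1\<close>, so the derivatives of \<open>(s + n)/2\<close> and of \<open>(s - n)/2\<close>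
  each annihilate one principal direction.\<close>

definition half :: "real \<Rightarrow> real^2 \<Rightarrow> mink" where
  "half \<epsilon> u = (1/2) *\<^sub>R (s u + \<epsilon> *\<^sub>R n u)"

lemma smooth_half: "smooth_on W (half \<epsilon>)"
  unfolding half_def[abs_def] by (intro smooth_on_scaleR smooth_on_add smooth_on_const sd smooth_n)

lemma pd_half:
  assumes "u \<in> W" shows "pd i (half \<epsilon>) u = (1/2) *\<^sub>R (pd i s u + \<epsilon> *\<^sub>R pd i n u)"
proof -
  have e: "smooth_on W (\<lambda>u. \<epsilon> *\<^sub>R n u)" by (intro smooth_on_scaleR smooth_on_const sd smooth_n)
  show ?thesis unfolding half_def[abs_def]
    by (simp add: pd_scaleR_const[OF smooth_on_add[OF sd(1,2) e] assms] pd_add[OF sd(2) e assms]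
        pd_scaleR_const[OF smooth_n assms])
qed

lemma half_gram:
  assumes u: "u \<in> W"
  shows "lorentz (pd i (half \<epsilon>) u) (pd j (half \<delta>) u) = ((1 + \<epsilon> * \<delta>) * g u $ i $ j + (\<epsilon> + \<delta>) * B i j u) / 4"
proof -
  have "lorentz (pd i s u) (pd j n u) = B i j u"
    using pd_n(3)[OF u, of j i] B_sym[OF u, of i j] by (simp add: lorentz_commute)
  then show ?thesis
    by (simp add: pd_half[OF u] lorentz_simps pd_n[OF u] third_ff[OF u]) (simp add: ind_metric_def algebra_simps add_divide_distrib)
qed

lemma half_perp:
  assumes u: "u \<in> W"
  shows "lorentz (pd i (half \<epsilon>) u) (s u) = 0" "lorentz (pd i (half \<epsilon>) u) (n u) = 0" "lorentz (pd i (half \<epsilon>) u) (h u) = 0"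
  by (simp_all add: pd_half[OF u] lorentz_simps pd_n[OF u] frame_pd[OF u] parallel[OF u])

text \<open>A null vector orthogonal to \<open>s u\<close> lies on the line of \<open>s u\<close>,
  and the product with \<open>h u\<close> detects its coefficient.\<close>

lemma half_null_zero:
  assumes u: "u \<in> W" and z: "lorentz z (s u) = 0" "lorentz z (h u) = 0" "lorentz z z = 0"
  shows "z = 0"
proof -
  have s: "lorentz (s u) (s u) = 0" "snd (s u) \<noteq> 0" using sd(5)[OF u] by (auto simp: regular_def)
  have e: "z = (snd z / snd (s u)) *\<^sub>R s u" by (rule null_perp(2)[OF s z(1,3)])
  have "lorentz z (h u) = - (snd z / snd (s u))" by (subst e) (simp add: lorentz_simps fs[OF u])
  then have "snd z / snd (s u) = 0" using z(2) by simp
  then show ?thesis using e by (metis scaleR_zero_left)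
qed

lemma half_nonneg: "u \<in> W \<Longrightarrow> lorentz (pd i (half \<epsilon>) u) (pd i (half \<epsilon>) u) \<ge> 0"
  using null_perp(1)[OF _ _ half_perp(1)] sd(5)[of u] by (auto simp: regular_def)

text \<open>The Gram matrix is \<open>(g + \<epsilon> B) / 2\<close>. The determinant of
  \<open>g + \<epsilon> B\<close> is the sum of \<open>det g\<close>, the vanishing trace term and
  \<open>det B\<close>, and the last cancels the first.\<close>

lemma half_det:
  assumes u: "u \<in> W" and \<epsilon>: "\<epsilon> * \<epsilon> = 1"
  shows "lorentz (pd 1 (half \<epsilon>) u) (pd 1 (half \<epsilon>) u) * lorentz (pd 2 (half \<epsilon>) u) (pd 2 (half \<epsilon>) u)
    = (lorentz (pd 1 (half \<epsilon>) u) (pd 2 (half \<epsilon>) u))\<^sup>2"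
proof -
  have *: "lorentz (pd i (half \<epsilon>) u) (pd j (half \<epsilon>) u) = (g u $ i $ j + \<epsilon> * B i j u) / 2" for i j
    by (simp add: half_gram[OF u] \<epsilon> field_simps)
  have "4 * (lorentz (pd 1 (half \<epsilon>) u) (pd 1 (half \<epsilon>) u) * lorentz (pd 2 (half \<epsilon>) u) (pd 2 (half \<epsilon>) u)
    - (lorentz (pd 1 (half \<epsilon>) u) (pd 2 (half \<epsilon>) u))\<^sup>2) =
      det (g u) + \<epsilon> * (g u $ 2 $ 2 * B 1 1 u - 2 * g u $ 1 $ 2 * B 1 2 u + g u $ 1 $ 1 * B 2 2 u)
      + (\<epsilon> * \<epsilon>) * (B 1 1 u * B 2 2 u - (B 1 2 u)\<^sup>2)"
    unfolding * by (simp add: det_2 g_sym[of u 2 1] power2_eq_square field_simps)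
  also have "\<dots> = 0" unfolding trace_B_expand[OF u] \<epsilon> det_B[OF u] by simp
  finally show ?thesis by simp
qed

text \<open>If both partial derivatives were null, \<open>g\<close> would be minus \<epsilon> times
  \<open>B\<close>, and the trace term of \<open>B\<close> would be a nonzero multiple of its
  determinant.\<close>

lemma half_immersed:
  assumes u: "u \<in> W" and \<epsilon>: "\<epsilon> * \<epsilon> = 1"
  shows "\<exists>v. lorentz (pd v (half \<epsilon>) u) (pd v (half \<epsilon>) u) > 0"
proof (rule ccontr)
  assume "\<not> ?thesis"
  then have z: "lorentz (pd v (half \<epsilon>) u) (pd v (half \<epsilon>) u) = 0" for v
    using half_nonneg[OF u, of v \<epsilon>] by (metis linorder_not_less order_antisym)
  then have z': "lorentz (pd 1 (half \<epsilon>) u) (pd 2 (half \<epsilon>) u) = 0"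
    using half_det[OF u \<epsilon>] by simp
  have *: "lorentz (pd i (half \<epsilon>) u) (pd j (half \<epsilon>) u) = (g u $ i $ j + \<epsilon> * B i j u) / 2" for i j
    by (simp add: half_gram[OF u] \<epsilon> field_simps)
  have "g u $ 1 $ 1 = - \<epsilon> * B 1 1 u" "g u $ 2 $ 2 = - \<epsilon> * B 2 2 u" "g u $ 1 $ 2 = - \<epsilon> * B 1 2 u"
    using z[of 1] z[of 2] z' unfolding * by simp_all
  then have "\<epsilon> * (g u $ 2 $ 2 * B 1 1 u - 2 * g u $ 1 $ 2 * B 1 2 u + g u $ 1 $ 1 * B 2 2 u) =
      - 2 * (\<epsilon> * \<epsilon>) * (B 1 1 u * B 2 2 u - (B 1 2 u)\<^sup>2)"
    by (simp add: power2_eq_square algebra_simps)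
  then show False unfolding trace_B_expand[OF u] \<epsilon> det_B[OF u] using det_g(2)[OF u] by simp
qed

text \<open>Equality in the Cauchy-Schwarz inequality: the component of one partial derivative
  orthogonal to the other has square zero, and \<open>half_null_zero\<close> makes it
  vanish.\<close>

lemma half_rank_one:
  assumes u: "u \<in> W" and \<epsilon>: "\<epsilon> * \<epsilon> = 1" and v: "lorentz (pd v (half \<epsilon>) u) (pd v (half \<epsilon>) u) > 0"
  shows "pd i (half \<epsilon>) u = (lorentz (pd i (half \<epsilon>) u) (pd v (half \<epsilon>) u) /
    lorentz (pd v (half \<epsilon>) u) (pd v (half \<epsilon>) u)) *\<^sub>R pd v (half \<epsilon>) u"
proof -
  let ?F = "\<lambda>i. pd i (half \<epsilon>) u"
  let ?c = "lorentz (?F i) (?F v) / lorentz (?F v) (?F v)"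
  have c: "?c * lorentz (?F v) (?F v) = lorentz (?F i) (?F v)" using v by simp
  have det: "lorentz (?F i) (?F i) * lorentz (?F v) (?F v) = (lorentz (?F i) (?F v))\<^sup>2"
    using half_det[OF u \<epsilon>] exhaust_2[of i] exhaust_2[of v] by (auto simp: power2_eq_square mult.commute lorentz_commute)
  have "lorentz (?F i - ?c *\<^sub>R ?F v) (?F i - ?c *\<^sub>R ?F v) * lorentz (?F v) (?F v) =
      lorentz (?F i) (?F i) * lorentz (?F v) (?F v) - 2 * (?c * lorentz (?F v) (?F v)) * lorentz (?F i) (?F v)
      + (?c * lorentz (?F v) (?F v)) * (?c * lorentz (?F v) (?F v))"
    unfolding lorentz_simps lorentz_commute[of "?F v" "?F i"] by (simp only: real_scaleR_def) algebra
  also have "\<dots> = 0" unfolding c det by (simp add: power2_eq_square)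
  finally have "lorentz (?F i - ?c *\<^sub>R ?F v) (?F i - ?c *\<^sub>R ?F v) = 0" using v by simp
  then have "?F i - ?c *\<^sub>R ?F v = 0"
    by (intro half_null_zero[OF u]) (simp_all add: lorentz_simps half_perp[OF u])
  then show ?thesis by simp
qed

end

section \<open>Flat coordinates\<close>

text \<open>The normal form in the new coordinates. The last condition says that the coordinate
  directions are principal, with opposite unit principal curvatures; the trace condition on
  \<open>xi\<close> follows and is supplied when \<open>normal_section\<close> is derived.\<close>

locale flat_form =
  fixes D :: "(real^2) set" and lam xi :: "real^2 \<Rightarrow> mink"
  assumes open_D: "open D" and smooth_lam: "smooth_on D lam" and smooth_xi: "smooth_on D xi"
    and null: "\<And>y. y \<in> D \<Longrightarrow> lorentz (lam y) (lam y) = 0" and snd_pos: "\<And>y. y \<in> D \<Longrightarrow> snd (lam y) > 0"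
    and unit: "\<And>y. y \<in> D \<Longrightarrow> lorentz (xi y) (xi y) = 1" and xi_lam: "\<And>y. y \<in> D \<Longrightarrow> lorentz (xi y) (lam y) = 0"
    and xi_dlam: "\<And>y i. y \<in> D \<Longrightarrow> lorentz (xi y) (pd i lam y) = 0"
    and metric: "\<And>y. y \<in> D \<Longrightarrow> ind_metric lam y = mat 1"
    and dxi: "\<And>y. y \<in> D \<Longrightarrow> pd 1 xi y = pd 1 lam y" "\<And>y. y \<in> D \<Longrightarrow> pd 2 xi y = - pd 2 lam y"

lemma has_derivative_plane:
  fixes f1 f2 :: "'a::real_normed_vector \<Rightarrow> real"
  assumes "(f1 has_derivative f1') (at u)" "(f2 has_derivative f2') (at u)"
  shows "((\<lambda>w. f1 w *\<^sub>R axis 1 1 + f2 w *\<^sub>R axis 2 1 :: real^2) has_derivative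
     (\<lambda>h. f1' h *\<^sub>R axis 1 1 + f2' h *\<^sub>R axis 2 1)) (at u)"
  by (intro has_derivative_add bounded_linear.has_derivative[OF bounded_linear_scaleR_left] assms)

text \<open>The solution of the linear system with rows \<open>(a, b)\<close> and
  \<open>(c, d)\<close>, that is, the inverse of a Jacobian whose rows are two one-forms.\<close>

definition cramer :: "real \<Rightarrow> real \<Rightarrow> real \<Rightarrow> real \<Rightarrow> real^2 \<Rightarrow> real^2" where
  "cramer a b c d k = ((d * k $ 1 - b * k $ 2) / (a * d - b * c)) *\<^sub>R axis 1 1 +
     ((a * k $ 2 - c * k $ 1) / (a * d - b * c)) *\<^sub>R axis 2 1"

lemma cramer_nth:
  "cramer a b c d k $ 1 = (d * k $ 1 - b * k $ 2) / (a * d - b * c)"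
  "cramer a b c d k $ 2 = (a * k $ 2 - c * k $ 1) / (a * d - b * c)"
  by (simp_all add: cramer_def axis_def)

lemma closed_form_primitive:
  fixes \<phi> :: "2 \<Rightarrow> real^2 \<Rightarrow> real"
  assumes B: "open B" "convex B" "u0 \<in> B" and sm: "\<And>i. smooth_on B (\<phi> i)"
    and closed: "\<And>u. u \<in> B \<Longrightarrow> pd 1 (\<phi> 2) u = pd 2 (\<phi> 1) u"
  obtains x where "\<And>u. u \<in> B \<Longrightarrow> (x has_derivative (\<lambda>v. \<phi> 1 u * v $ 1 + \<phi> 2 u * v $ 2)) (at u)"
proof -
  define P :: "real^2 \<Rightarrow> real^2" where "P u = (\<chi> i. \<phi> i u)" for u
  have smP: "smooth_on B P" unfolding P_def[abs_def] by (intro smooth_on_vec B(1) sm)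
  have pdP: "pd k P u $ j = pd k (\<phi> j) u" if "u \<in> B" for k j u
    using pd_linear[OF bounded_linear_vec_nth smP that, of k j] by (simp add: P_def)
  have "frechet_derivative P (at u) v \<bullet> w = frechet_derivative P (at u) w \<bullet> v" if u: "u \<in> B" for u v w
    using closed[OF u] by (simp add: frechet_derivative_pd[OF smP u] inner_vec_def sum_2 pdP[OF u] algebra_simps)
  from poincare_lemma[OF B smP this] obtain x where "\<forall>u\<in>B. (x has_derivative (\<lambda>h. P u \<bullet> h)) (at u)" by blast
  then show ?thesis by (intro that[of x]) (simp add: inner_vec_def sum_2 P_def)
qed

text \<open>Writing the derivative of the inverse map as \<open>H\<close> evaluated at that map lets
  smoothness follow by bootstrapping. The image is cut down to a ball because the constancy of
  \<kappa> is later deduced on a convex set.\<close>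

lemma plane_inverse_function:
  fixes \<phi> \<psi> :: "2 \<Rightarrow> real^2 \<Rightarrow> real" and X :: "real^2 \<Rightarrow> real^2"
  assumes B: "open B" "u0 \<in> B" and sm: "\<And>i. smooth_on B (\<phi> i)" "\<And>i. smooth_on B (\<psi> i)"
    and X: "\<And>u. u \<in> B \<Longrightarrow> (X has_derivative (\<lambda>v. (\<phi> 1 u * v $ 1 + \<phi> 2 u * v $ 2) *\<^sub>R axis 1 1
       + (\<psi> 1 u * v $ 1 + \<psi> 2 u * v $ 2) *\<^sub>R axis 2 1)) (at u)"
    and J: "\<And>u. u \<in> B \<Longrightarrow> \<phi> 1 u * \<psi> 2 u - \<phi> 2 u * \<psi> 1 u \<noteq> 0"
  obtains V r Y where "open V" "u0 \<in> V" "V \<subseteq> B" "r > 0" "homeomorphism V (ball (X u0) r) X Y"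
    "smooth_on B X" "smooth_on (ball (X u0) r) Y"
    "\<forall>y\<in>ball (X u0) r. (Y has_derivative cramer (\<phi> 1 (Y y)) (\<phi> 2 (Y y)) (\<psi> 1 (Y y)) (\<psi> 2 (Y y))) (at y)"
proof -
  define DX where "DX u v = ((\<phi> 1 u * v $ 1 + \<phi> 2 u * v $ 2) *\<^sub>R axis 1 1
       + (\<psi> 1 u * v $ 1 + \<psi> 2 u * v $ 2) *\<^sub>R axis 2 1 :: real^2)" for u and v :: "real^2"
  define J' where "J' u = \<phi> 1 u * \<psi> 2 u - \<phi> 2 u * \<psi> 1 u" for u
  define H where "H k u = cramer (\<phi> 1 u) (\<phi> 2 u) (\<psi> 1 u) (\<psi> 2 u) k" for k u
  have H: "H k u = ((\<psi> 2 u * k $ 1 - \<phi> 2 u * k $ 2) / J' u) *\<^sub>R axis 1 1 +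
       ((\<phi> 1 u * k $ 2 - \<psi> 1 u * k $ 1) / J' u) *\<^sub>R axis 2 1" for k u
    by (simp add: H_def cramer_def J'_def)
  have X': "(X has_derivative DX u) (at u)" if "u \<in> B" for u
    using X[OF that] unfolding DX_def .
  have DXH: "DX u (H k u) = k" and HDX: "H (DX u v) u = v" if "u \<in> B" for u k v
  proof -
    have j: "J' u \<noteq> 0" using J[OF that] by (simp add: J'_def)
    show "DX u (H k u) = k"
      using j by (simp add: DX_def H vec_eq_iff forall_2 axis_def add_divide_distrib[symmetric] nonzero_divide_eq_eq)
        (simp add: J'_def algebra_simps)
    show "H (DX u v) u = v"
      using j by (simp add: DX_def H vec_eq_iff forall_2 axis_def nonzero_divide_eq_eq)
        (simp add: J'_def algebra_simps)
  qed
  have smDX: "smooth_on B (\<lambda>u. DX u v)" for v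
    unfolding DX_def by (intro smooth_on_add smooth_on_scaleR smooth_on_mult smooth_on_const sm B(1))
  have smX: "smooth_on B X" by (rule smooth_on_derivI[OF B(1) X' smDX])
  have smH: "smooth_on B (H k)" for k
    unfolding H[abs_def] J'_def
    by (intro smooth_on_add smooth_on_diff smooth_on_scaleR smooth_on_divide smooth_on_mult smooth_on_const sm B(1) J)
  define f' where "f' u = Blinfun (DX u)" for u
  have f': "blinfun_apply (f' u) = DX u" if "u \<in> B" for u
    unfolding f'_def using bounded_linear_Blinfun_apply[OF has_derivative_bounded_linear[OF X'[OF that]]] .
  have cont: "continuous_on B f'"
  proof (rule continuous_on_blinfun_componentwise)
    fix i :: "real^2"
    show "continuous_on B (\<lambda>u. blinfun_apply (f' u) i)"
      using smooth_on_imp_continuous_on[OF smDX[of i]] by (simp add: f' cong: continuous_on_cong)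
  qed
  define invf where "invf = Blinfun (\<lambda>k. H k u0)"
  have "linear (\<lambda>k. H k u0)"
    unfolding H by (rule linearI) (simp_all add: vec_eq_iff forall_2 axis_def algebra_simps add_divide_distrib diff_divide_distrib)
  then have invf: "blinfun_apply invf = (\<lambda>k. H k u0)"
    unfolding invf_def by (intro bounded_linear_Blinfun_apply linear_conv_bounded_linear[THEN iffD1])
  have "invf o\<^sub>L f' u0 = id_blinfun"
    by (rule blinfun_eqI) (simp add: invf f'[OF B(2)] HDX[OF B(2)])
  note inv = this
  have dX: "(X has_derivative blinfun_apply (f' u)) (at u)" if "u \<in> B" for u
    using X'[OF that] by (simp only: f'[OF that])
  have "\<exists>U V' Y Y'. open U \<and> U \<subseteq> B \<and> u0 \<in> U \<and> open V' \<and> X u0 \<in> V' \<and> homeomorphism U V' X Y \<and>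
      (\<forall>y\<in>V'. (Y has_derivative (Y' y)) (at y) \<and> Y' y = inv (blinfun_apply (f' (Y y))) \<and> bij (blinfun_apply (f' (Y y))))"
    (is ?ex)
  proof (rule inverse_function_theorem[OF B(1) dX cont B(2) inv])
    fix U V' Y Y'
    assume a: "open U" "U \<subseteq> B" "u0 \<in> U" "open V'" "X u0 \<in> V'" "homeomorphism U V' X Y"
      "\<And>y. y \<in> V' \<Longrightarrow> (Y has_derivative (Y' y)) (at y)"
      "\<And>y. y \<in> V' \<Longrightarrow> Y' y = inv (blinfun_apply (f' (Y y)))"
      "\<And>y. y \<in> V' \<Longrightarrow> bij (blinfun_apply (f' (Y y)))"
    show ?ex
      by (rule exI[of _ U], rule exI[of _ V'], rule exI[of _ Y], rule exI[of _ Y']) (intro conjI ballI a)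
  qed
  then obtain U V' Y Y' where U: "open U" "U \<subseteq> B" "u0 \<in> U" "open V'" "X u0 \<in> V'" "homeomorphism U V' X Y"
    and Y: "\<And>y. y \<in> V' \<Longrightarrow> (Y has_derivative (Y' y)) (at y)"
      "\<And>y. y \<in> V' \<Longrightarrow> Y' y = inv (blinfun_apply (f' (Y y)))" "\<And>y. y \<in> V' \<Longrightarrow> bij (blinfun_apply (f' (Y y)))"
    by blast
  obtain r where r: "r > 0" "ball (X u0) r \<subseteq> V'" using U(4,5) open_contains_ball by metis
  let ?D = "ball (X u0) r"
  have YU: "Y y \<in> U" if "y \<in> V'" for y using U(6) that by (auto simp: homeomorphism_def)
  have dY: "(Y has_derivative (\<lambda>k. H k (Y y))) (at y)" if "y \<in> ?D" for y
  proof -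
    have yV: "y \<in> V'" using that r by blast
    then have YB: "Y y \<in> B" using YU U(2) by blast
    have "Y' y = (\<lambda>k. H k (Y y))"
      unfolding Y(2)[OF yV]
    proof
      fix k show "inv (blinfun_apply (f' (Y y))) k = H k (Y y)"
        using Y(3)[OF yV] by (intro inv_f_eq) (auto simp: bij_def f'[OF YB] DXH[OF YB])
    qed
    then show ?thesis using Y(1)[OF yV] by simp
  qed
  have smY: "smooth_on ?D Y"
    by (rule smooth_on_inverse_map[where h = H and S = B, OF _ dY _ smH]) (use YU r U in auto)
  define V where "V = X -` ?D \<inter> U"
  have V1: "open V" unfolding V_def
    using continuous_on_open_vimage[OF U(1), of X] smooth_on_imp_continuous_on[OF smooth_on_subset[OF smX U(2)]] open_ball
    by metis
  have V2: "u0 \<in> V" "V \<subseteq> B" using U r by (auto simp: V_def)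
  have hom: "homeomorphism V ?D X Y"
  proof (rule homeomorphism_of_subsets[OF U(6)])
    show "X ` V = ?D"
    proof
      show "?D \<subseteq> X ` V"
      proof
        fix y assume y: "y \<in> ?D"
        then have "X (Y y) = y" "Y y \<in> U" using U(6) r(2) YU by (auto simp: homeomorphism_def)
        then show "y \<in> X ` V" using y by (force simp: V_def intro: image_eqI[where x = "Y y"])
      qed
    qed (auto simp: V_def)
  qed (use r in \<open>auto simp: V_def\<close>)
  have dY': "\<forall>y\<in>?D. (Y has_derivative cramer (\<phi> 1 (Y y)) (\<phi> 2 (Y y)) (\<psi> 1 (Y y)) (\<psi> 2 (Y y))) (at y)"
    using dY unfolding H_def by blast
  show ?thesis by (rule that[OF V1 V2 r(1) hom smX smY dY'])
qed

context parallel_section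
begin

text \<open>The coordinates are primitives of the forms \<phi> and \<psi> that multiply unit vectors
  \<open>e\<close> and \<open>f\<close> in the derivatives of the two halves. In these coordinates
  the partial derivatives of \<open>s\<close> are \<open>e\<close>, \<open>f\<close> and those of
  \<open>n\<close> are \<open>e\<close>, \<open>- f\<close>.\<close>

theorem flat_coordinates:
  assumes u0: "u0 \<in> W"
  obtains V c r X Y where "open V" "u0 \<in> V" "V \<subseteq> W" "r > 0" "homeomorphism V (ball c r) X Y"
    "smooth_on V X" "smooth_on (ball c r) Y" "flat_form (ball c r) (\<lambda>y. s (Y y)) (\<lambda>y. n (Y y))"
proof -
  let ?F = "half 1" and ?G = "half (-1)"
  have eps: "1 * 1 = (1::real)" "(-1) * (-1) = (1::real)" by simp_all
  obtain v w where v: "lorentz (pd v ?F u0) (pd v ?F u0) > 0" and w: "lorentz (pd w ?G u0) (pd w ?G u0) > 0"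
    using half_immersed[OF u0 eps(1)] half_immersed[OF u0 eps(2)] by blast
  \<comment> \<open>Each half has some nonvanishing partial derivative at \<open>u0\<close>, not
    necessarily with the same index; the set where both stay nonzero is open.\<close>
  define W1 where "W1 = {u \<in> W. lorentz (pd v ?F u) (pd v ?F u) > 0} \<inter> {u \<in> W. lorentz (pd w ?G u) (pd w ?G u) > 0}"
  have W1: "open W1" "W1 \<subseteq> W" "u0 \<in> W1"
    unfolding W1_def using u0 v w
    by (auto intro!: open_Int open_positive sd smooth_on_lorentz smooth_on_pd smooth_half)
  note smhalf = smooth_on_subset[OF smooth_half W1(2)]
  have Fpos: "lorentz (pd v ?F u) (pd v ?F u) > 0" "lorentz (pd w ?G u) (pd w ?G u) > 0" if "u \<in> W1" for u
    using that by (auto simp: W1_def)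
  have rk: "pd i ?F u = (lorentz (pd i ?F u) (pd v ?F u) / lorentz (pd v ?F u) (pd v ?F u)) *\<^sub>R pd v ?F u"
    "pd i ?G u = (lorentz (pd i ?G u) (pd w ?G u) / lorentz (pd w ?G u) (pd w ?G u)) *\<^sub>R pd w ?G u" if "u \<in> W1" for u i
    using that W1(2) by (auto intro!: half_rank_one Fpos)
  obtain e \<phi> where e: "smooth_on W1 e" "\<And>i. smooth_on W1 (\<phi> i)" "\<And>u. u \<in> W1 \<Longrightarrow> lorentz (e u) (e u) = 1"
    "\<And>u i. u \<in> W1 \<Longrightarrow> pd i ?F u = \<phi> i u *\<^sub>R e u" "\<And>u. u \<in> W1 \<Longrightarrow> pd 1 (\<phi> 2) u = pd 2 (\<phi> 1) u"
    "\<And>u. u \<in> W1 \<Longrightarrow> \<exists>c. e u = c *\<^sub>R pd v ?F u"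
    using rank_one_closed[OF W1(1) smhalf Fpos(1) rk(1)] by blast
  obtain f \<psi> where f: "smooth_on W1 f" "\<And>i. smooth_on W1 (\<psi> i)" "\<And>u. u \<in> W1 \<Longrightarrow> lorentz (f u) (f u) = 1"
    "\<And>u i. u \<in> W1 \<Longrightarrow> pd i ?G u = \<psi> i u *\<^sub>R f u" "\<And>u. u \<in> W1 \<Longrightarrow> pd 1 (\<psi> 2) u = pd 2 (\<psi> 1) u"
    "\<And>u. u \<in> W1 \<Longrightarrow> \<exists>c. f u = c *\<^sub>R pd w ?G u"
    using rank_one_closed[OF W1(1) smhalf Fpos(2) rk(2)] by blast
  have ds: "pd i s u = \<phi> i u *\<^sub>R e u + \<psi> i u *\<^sub>R f u" and dn: "pd i n u = \<phi> i u *\<^sub>R e u - \<psi> i u *\<^sub>R f u" if "u \<in> W1" for u i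
  proof -
    have uW: "u \<in> W" using that W1 by blast
    have "pd i s u = pd i ?F u + pd i ?G u" "pd i n u = pd i ?F u - pd i ?G u"
      unfolding pd_half[OF uW] by (simp_all add: scaleR_add_right[symmetric] scaleR_diff_right[symmetric])
    then show "pd i s u = \<phi> i u *\<^sub>R e u + \<psi> i u *\<^sub>R f u" "pd i n u = \<phi> i u *\<^sub>R e u - \<psi> i u *\<^sub>R f u"
      by (simp_all add: e(4)[OF that] f(4)[OF that])
  qed
  \<comment> \<open>\<open>e\<close> and \<open>f\<close> are multiples of derivatives of opposite
    halves, and for opposite signs both \<open>1 + \<epsilon> * \<delta>\<close> and
    \<open>\<epsilon> + \<delta>\<close> in \<open>half_gram\<close> vanish.\<close>
  have ef: "lorentz (e u) (f u) = 0" "lorentz (f u) (e u) = 0" "lorentz (n u) (e u) = 0" "lorentz (n u) (f u) = 0"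
    if u: "u \<in> W1" for u
  proof -
    have uW: "u \<in> W" using that W1 by blast
    obtain c d where "e u = c *\<^sub>R pd v ?F u" "f u = d *\<^sub>R pd w ?G u" using e(6)[OF u] f(6)[OF u] by blast
    then show "lorentz (e u) (f u) = 0" "lorentz (f u) (e u) = 0" "lorentz (n u) (e u) = 0" "lorentz (n u) (f u) = 0"
      using half_perp(2)[OF uW] by (simp_all add: lorentz_simps half_gram[OF uW] lorentz_commute)
  qed
  \<comment> \<open>The square of this Jacobian is \<open>det (g u)\<close>, since \<open>e\<close>
    and \<open>f\<close> are orthonormal.\<close>
  have J: "\<phi> 1 u * \<psi> 2 u - \<phi> 2 u * \<psi> 1 u \<noteq> 0" if u: "u \<in> W1" for u
  proof -
    have "det (g u) = (\<phi> 1 u * \<psi> 2 u - \<phi> 2 u * \<psi> 1 u)\<^sup>2"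
      by (simp add: det_2 ind_metric_def ds[OF u] lorentz_simps ef[OF u] e(3)[OF u] f(3)[OF u] power2_eq_square algebra_simps)
    then show ?thesis using det_g(2)[of u] u W1 by auto
  qed
  obtain \<rho> where \<rho>: "\<rho> > 0" "ball u0 \<rho> \<subseteq> W1" using W1 open_contains_ball by metis
  let ?B = "ball u0 \<rho>"
  have B: "open ?B" "convex ?B" "u0 \<in> ?B" using \<rho> by simp_all
  have sm: "smooth_on ?B (\<phi> i)" "smooth_on ?B (\<psi> i)" for i
    using e(2) f(2) \<rho>(2) smooth_on_subset by blast+
  obtain x1 where x1: "\<And>u. u \<in> ?B \<Longrightarrow> (x1 has_derivative (\<lambda>v. \<phi> 1 u * v $ 1 + \<phi> 2 u * v $ 2)) (at u)"
    using closed_form_primitive[OF B, of \<phi>] sm(1) e(5) \<rho>(2) by blast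
  obtain x2 where x2: "\<And>u. u \<in> ?B \<Longrightarrow> (x2 has_derivative (\<lambda>v. \<psi> 1 u * v $ 1 + \<psi> 2 u * v $ 2)) (at u)"
    using closed_form_primitive[OF B, of \<psi>] sm(2) f(5) \<rho>(2) by blast
  define X :: "real^2 \<Rightarrow> real^2" where "X u = x1 u *\<^sub>R axis 1 1 + x2 u *\<^sub>R axis 2 1" for u
  have dX: "(X has_derivative (\<lambda>v. (\<phi> 1 u * v $ 1 + \<phi> 2 u * v $ 2) *\<^sub>R axis 1 1
       + (\<psi> 1 u * v $ 1 + \<psi> 2 u * v $ 2) *\<^sub>R axis 2 1)) (at u)" if "u \<in> ?B" for u
    unfolding X_def[abs_def] by (rule has_derivative_plane[OF x1[OF that] x2[OF that]])
  have J': "\<phi> 1 u * \<psi> 2 u - \<phi> 2 u * \<psi> 1 u \<noteq> 0" if "u \<in> ?B" for u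
    using J \<rho>(2) that by blast
  obtain V r Y where V: "open V" "u0 \<in> V" "V \<subseteq> ?B" and r: "r > 0" and hom: "homeomorphism V (ball (X u0) r) X Y"
    and smX: "smooth_on ?B X" and smY: "smooth_on (ball (X u0) r) Y"
    and dY: "\<forall>y\<in>ball (X u0) r. (Y has_derivative cramer (\<phi> 1 (Y y)) (\<phi> 2 (Y y)) (\<psi> 1 (Y y)) (\<psi> 2 (Y y))) (at y)"
    by (rule plane_inverse_function[OF B(1,3) sm dX J'])
  let ?D = "ball (X u0) r"
  have YW: "Y y \<in> W1" "Y y \<in> W" if "y \<in> ?D" for y
  proof -
    have "Y y \<in> V" using hom that unfolding homeomorphism_def by blast
    then show "Y y \<in> W1" "Y y \<in> W" using V(3) \<rho>(2) W1(2) by blast+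
  qed
  have chain: "pd i (\<lambda>y. F (Y y)) y =
       ((\<psi> 2 (Y y) * axis i 1 $ 1 - \<phi> 2 (Y y) * axis i 1 $ 2) / (\<phi> 1 (Y y) * \<psi> 2 (Y y) - \<phi> 2 (Y y) * \<psi> 1 (Y y))) *\<^sub>R pd 1 F (Y y) +
       ((\<phi> 1 (Y y) * axis i 1 $ 2 - \<psi> 1 (Y y) * axis i 1 $ 1) / (\<phi> 1 (Y y) * \<psi> 2 (Y y) - \<phi> 2 (Y y) * \<psi> 1 (Y y))) *\<^sub>R pd 2 F (Y y)"
    if F: "smooth_on W F" and y: "y \<in> ?D" for F :: "real^2 \<Rightarrow> mink" and y i
    using pd_eqI[OF has_derivative_compose[OF dY[rule_format, OF y] has_derivative_pd[OF F YW(2)[OF y]]], of i] by (simp add: cramer_nth)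
  have comb: "(a / j) *\<^sub>R (p *\<^sub>R x + q *\<^sub>R y) + (b / j) *\<^sub>R (p' *\<^sub>R x + q' *\<^sub>R y) =
      ((a * p + b * p') / j) *\<^sub>R x + ((a * q + b * q') / j) *\<^sub>R y" for a b j p q p' q' :: real and x y :: mink
    by (simp add: algebra_simps add_divide_distrib)
  have pd_new: "pd 1 (\<lambda>y. s (Y y)) y = e (Y y)" "pd 2 (\<lambda>y. s (Y y)) y = f (Y y)"
    "pd 1 (\<lambda>y. n (Y y)) y = e (Y y)" "pd 2 (\<lambda>y. n (Y y)) y = - f (Y y)" if y: "y \<in> ?D" for y
  proof -
    let ?u = "Y y"
    define j where "j = \<phi> 1 ?u * \<psi> 2 ?u - \<phi> 2 ?u * \<psi> 1 ?u"
    have j: "j \<noteq> 0" using J[OF YW(1)[OF y]] by (simp add: j_def)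
    have dn': "pd i n ?u = \<phi> i ?u *\<^sub>R e ?u + (- \<psi> i ?u) *\<^sub>R f ?u" for i by (simp add: dn[OF YW(1)[OF y]])
    show "pd 1 (\<lambda>y. s (Y y)) y = e (Y y)" "pd 2 (\<lambda>y. s (Y y)) y = f (Y y)"
      unfolding chain[OF sd(2) y] j_def[symmetric] ds[OF YW(1)[OF y]] comb using j
      by (simp_all add: axis_def) (simp_all add: j_def algebra_simps)
    show "pd 1 (\<lambda>y. n (Y y)) y = e (Y y)" "pd 2 (\<lambda>y. n (Y y)) y = - f (Y y)"
      unfolding chain[OF smooth_n y] j_def[symmetric] dn' comb using j
      by (simp_all add: axis_def) (simp_all add: j_def algebra_simps,
        metis (no_types) divide_minus_left div_self minus_diff_eq right_minus_eq scaleR_minus1_left)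
  qed
  have YW': "Y ` ?D \<subseteq> W" using YW by blast
  have "flat_form ?D (\<lambda>y. s (Y y)) (\<lambda>y. n (Y y))"
  proof
    show "smooth_on ?D (\<lambda>y. s (Y y))" "smooth_on ?D (\<lambda>y. n (Y y))"
      by (intro smooth_on_compose[OF _ smY _ YW'] sd smooth_n open_ball)+
    fix y assume y: "y \<in> ?D"
    note y1 = YW(1)[OF y] and yW = YW(2)[OF y]
    show "lorentz (s (Y y)) (s (Y y)) = 0" "snd (s (Y y)) > 0" "lorentz (n (Y y)) (n (Y y)) = 1" "lorentz (n (Y y)) (s (Y y)) = 0"
      using sd(5)[OF yW] fs[OF yW] by (auto simp: regular_def)
    show "lorentz (n (Y y)) (pd i (\<lambda>y. s (Y y)) y) = 0" for i
      using exhaust_2[of i] by (auto simp: pd_new[OF y] ef[OF y1])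
    show "ind_metric (\<lambda>y. s (Y y)) y = mat 1"
      by (simp add: ind_metric_def mat_def vec_eq_iff forall_2 pd_new[OF y] ef[OF y1] e(3)[OF y1] f(3)[OF y1])
    show "pd 1 (\<lambda>y. n (Y y)) y = pd 1 (\<lambda>y. s (Y y)) y" "pd 2 (\<lambda>y. n (Y y)) y = - pd 2 (\<lambda>y. s (Y y)) y"
      by (simp_all add: pd_new[OF y])
  qed (rule open_ball)
  moreover have "V \<subseteq> W" using V(3) \<rho>(2) W1(2) by blast
  ultimately show ?thesis using that V(1,2) r hom smooth_on_subset[OF smX V(3)] smY by blast
qed

end

section \<open>Surfaces in flat form\<close>

lemma q0_nth: "q0 $ 1 $ 1 = 1" "q0 $ 2 $ 2 = -1" "q0 $ 1 $ 2 = 0" "q0 $ 2 $ 1 = 0"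
  by (simp_all add: q0_def)

lemma mat_nth: "(mat 1 :: real^2^2) $ 1 $ 1 = 1" "(mat 1 :: real^2^2) $ 2 $ 2 = 1"
    "(mat 1 :: real^2^2) $ 1 $ 2 = 0" "(mat 1 :: real^2^2) $ 2 $ 1 = 0"
  by (simp_all add: mat_def)

lemma trace_wrt_conformal:
  fixes T :: "'b::real_vector^2^2"
  assumes "c \<noteq> 0"
  shows "trace_wrt (c *\<^sub>R mat 1) T = (1 / c) *\<^sub>R (T $ 1 $ 1 + T $ 2 $ 2)"
  using trace_wrt_scaleR[of "mat 1" c T] assms
  by (simp add: trace_wrt_2[of "mat 1"] det_2 mat_nth)

lemma matrix_inv_conformal:
  assumes "c \<noteq> 0"
  shows "matrix_inv (c *\<^sub>R mat 1 :: real^2^2) = (1 / c) *\<^sub>R mat 1"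
proof -
  have "det (c *\<^sub>R mat 1 :: real^2^2) = c * c" by (simp add: det_2 mat_nth)
  then show ?thesis using assms by (simp add: matrix_inv_2 vec_eq_iff forall_2 mat_nth)
qed

context flat_form
begin

lemma section_lam: "section_on D lam"
  unfolding section_on_def
  using open_D smooth_lam null snd_pos null_deriv[OF open_D smooth_lam null]
  by (auto simp: regular_def metric mat_nth)

lemma dlam: "y \<in> D \<Longrightarrow> lorentz (pd i lam y) (pd j lam y) = mat 1 $ i $ j"
  using metric[of y] by (simp add: ind_metric_def vec_eq_iff)

lemma dxi_q0: "y \<in> D \<Longrightarrow> pd i xi y = q0 $ i $ i *\<^sub>R pd i lam y"
  using dxi exhaust_2[of i] by (auto simp: q0_nth)

lemma second_lam_xi:
  assumes y: "y \<in> D" shows "lorentz (pd i (pd j lam) y) (xi y) = - q0 $ i $ j"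
proof -
  have "lorentz (pd i (pd j lam) y) (xi y) + lorentz (pd j lam y) (pd i xi y) = 0"
    using pd_lorentz[OF smooth_on_pd[OF smooth_lam] smooth_xi y, of i j]
      pd_const_on[OF open_D y, of "\<lambda>w. lorentz (pd j lam w) (xi w)" 0 i] xi_dlam by (simp add: lorentz_commute)
  then show ?thesis
    using exhaust_2[of i] exhaust_2[of j] by (auto simp: dxi_q0[OF y] lorentz_simps dlam[OF y] q0_nth mat_nth)
qed

end

sublocale flat_form \<subseteq> normal_section D lam xi
proof
  fix y assume y: "y \<in> D"
  have "trace_wrt (1 *\<^sub>R mat 1) (\<chi> i j. lorentz (pd i (pd j lam) y) (xi y)) = 0"
    by (subst trace_wrt_conformal) (simp_all add: second_lam_xi[OF y] q0_nth)
  then show "normal_at lam y (xi y)"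
    using y by (simp add: normal_at_def unit xi_lam xi_dlam metric)
qed (rule section_lam smooth_xi)+

context flat_form
begin

lemma B_q0: "y \<in> D \<Longrightarrow> B i j y = q0 $ i $ j"
  by (simp add: B_def second_lam_xi)

lemma christoffel_lam:
  assumes y: "y \<in> D" shows "christoffel (ind_metric lam) y k i j = 0"
proof -
  have "pd i (\<lambda>w. ind_metric lam w $ j $ l) y = 0" for i j l
    by (rule pd_const_on[OF open_D y, of _ "mat 1 $ j $ l"]) (simp add: metric)
  then show ?thesis by (simp add: christoffel_def)
qed

lemma second_lam:
  assumes "y \<in> D"
  shows "pd i (pd j lam) y = A i j y *\<^sub>R lam y + mat 1 $ i $ j *\<^sub>R h y - q0 $ i $ j *\<^sub>R xi y"
  using gauss_formula[OF assms, of i j] by (simp add: T_def christoffel_lam[OF assms] B_q0[OF assms] metric[OF assms])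

text \<open>Computed through \<open>xi\<close>, the mixed derivative of \<open>lam\<close> appears
  with opposite signs for the two orders of differentiation.\<close>

lemma mixed_lam:
  assumes y: "y \<in> D" shows "pd 1 (pd 2 lam) y = 0" "pd 2 (pd 1 lam) y = 0"
proof -
  have "pd 2 (pd 1 xi) y = pd 2 (pd 1 lam) y"
    by (rule pd_cong[OF open_D y]) (rule dxi)
  moreover have "pd 1 (pd 2 xi) y = pd 1 (\<lambda>w. - pd 2 lam w) y"
    by (rule pd_cong[OF open_D y]) (rule dxi)
  moreover have "pd 1 (\<lambda>w. - pd 2 lam w) y = - pd 1 (pd 2 lam) y"
    by (rule pd_minus[OF smooth_on_pd[OF smooth_lam] y])
  ultimately have "pd 1 (pd 2 lam) y = - pd 1 (pd 2 lam) y"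
    using pd_commute[OF smooth_xi open_D y, of 1 2] pd_commute[OF smooth_lam open_D y, of 1 2] by simp
  then show "pd 1 (pd 2 lam) y = 0" by (simp add: eq_neg_iff_add_eq_0 scaleR_2[symmetric])
  then show "pd 2 (pd 1 lam) y = 0" using pd_commute[OF smooth_lam open_D y, of 1 2] by simp
qed

text \<open>Constancy of \<open>\<kappa>\<close> follows from \<open>\<lambda>\<^sub>1\<^sub>1 - \<lambda>\<^sub>2\<^sub>2 = \<kappa> \<lambda> - 2 \<xi>\<close> and \<open>\<lambda>\<^sub>1\<^sub>2 = 0\<close> by
  differentiating once in each direction.\<close>

definition \<kappa> :: "real^2 \<Rightarrow> real" where "\<kappa> y = A 1 1 y - A 2 2 y"

lemma smooth_\<kappa>: "smooth_on D \<kappa>"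
  unfolding \<kappa>_def[abs_def] by (intro smooth_on_diff smooth_A open_D)

lemma lam_diff: "y \<in> D \<Longrightarrow> pd 1 (pd 1 lam) y - pd 2 (pd 2 lam) y = \<kappa> y *\<^sub>R lam y - 2 *\<^sub>R xi y"
  by (simp add: second_lam \<kappa>_def mat_nth q0_nth algebra_simps scaleR_2)

lemma pd_\<kappa>:
  assumes y: "y \<in> D" shows "pd i \<kappa> y = 0"
proof -
  note sp = smooth_on_pd
  have m: "pd 1 (pd 2 (pd 2 lam)) w = 0" "pd 2 (pd 1 (pd 1 lam)) w = 0" if w: "w \<in> D" for w
    using pd_commute[OF sp[OF smooth_lam] open_D w, of 1 2 2] pd_commute[OF sp[OF smooth_lam] open_D w, of 2 1 1]
      pd_const_on[OF open_D w, of "pd 1 (pd 2 lam)" 0 2] pd_const_on[OF open_D w, of "pd 2 (pd 1 lam)" 0 1] mixed_lam by simp_all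
  have sm1: "smooth_on D (\<lambda>w. \<kappa> w *\<^sub>R lam w)" "smooth_on D (\<lambda>w. 2 *\<^sub>R xi w)"
    by (intro smooth_on_scaleR smooth_on_const smooth_\<kappa> smooth_lam smooth_xi open_D)+
  have third: "pd 1 (pd 1 (pd 1 lam)) w = pd 1 \<kappa> w *\<^sub>R lam w + \<kappa> w *\<^sub>R pd 1 lam w - 2 *\<^sub>R pd 1 lam w" if w: "w \<in> D" for w
  proof -
    have "pd 1 (pd 1 (pd 1 lam)) w = pd 1 (\<lambda>w. pd 1 (pd 1 lam) w - pd 2 (pd 2 lam) w) w"
      using pd_diff[OF sp[OF sp[OF smooth_lam]] sp[OF sp[OF smooth_lam]] w, of 1 1 1 2 2] m(1)[OF w] by simp
    also have "\<dots> = pd 1 (\<lambda>w. \<kappa> w *\<^sub>R lam w - 2 *\<^sub>R xi w) w"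
      by (rule pd_cong[OF open_D w]) (rule lam_diff)
    also have "\<dots> = pd 1 \<kappa> w *\<^sub>R lam w + \<kappa> w *\<^sub>R pd 1 lam w - 2 *\<^sub>R pd 1 lam w"
      by (simp add: pd_diff[OF sm1 w] pd_scaleR[OF smooth_\<kappa> smooth_lam w] pd_scaleR_const[OF smooth_xi w] dxi[OF w])
    finally show ?thesis .
  qed
  \<comment> \<open>\<open>pd 2 (pd 1 (pd 1 lam))\<close> vanishes, hence so does its further
    derivative. Comparison with the formula \<open>third\<close> leaves a relation whose
    coefficients along \<open>pd 2 lam\<close> and \<open>pd 1 lam\<close> are the two derivatives
    of \<kappa>.\<close>
  have "pd 2 (pd 1 (pd 1 (pd 1 lam))) y = 0"
    using pd_commute[OF sp[OF sp[OF smooth_lam]] open_D y, of 2 1 1 1]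
      pd_const_on[OF open_D y, of "pd 2 (pd 1 (pd 1 lam))" 0 1] m(2) by simp
  also have "pd 2 (pd 1 (pd 1 (pd 1 lam))) y =
      pd 2 (\<lambda>w. (pd 1 \<kappa> w *\<^sub>R lam w + \<kappa> w *\<^sub>R pd 1 lam w) - 2 *\<^sub>R pd 1 lam w) y"
    by (rule pd_cong[OF open_D y]) (rule third)
  also have "\<dots> = pd 2 (\<lambda>w. pd 1 \<kappa> w *\<^sub>R lam w + \<kappa> w *\<^sub>R pd 1 lam w) y - pd 2 (\<lambda>w. 2 *\<^sub>R pd 1 lam w) y"
    by (rule pd_diff[OF _ _ y]; intro smooth_on_add smooth_on_scaleR smooth_on_const smooth_\<kappa> sp smooth_lam open_D)
  also have "pd 2 (\<lambda>w. pd 1 \<kappa> w *\<^sub>R lam w + \<kappa> w *\<^sub>R pd 1 lam w) y =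
      pd 2 (\<lambda>w. pd 1 \<kappa> w *\<^sub>R lam w) y + pd 2 (\<lambda>w. \<kappa> w *\<^sub>R pd 1 lam w) y"
    by (rule pd_add[OF _ _ y]; intro smooth_on_scaleR smooth_\<kappa> sp smooth_lam open_D)
  finally have z: "pd 2 (pd 1 \<kappa>) y *\<^sub>R lam y + pd 1 \<kappa> y *\<^sub>R pd 2 lam y + pd 2 \<kappa> y *\<^sub>R pd 1 lam y = 0"
    by (simp add: pd_scaleR[OF sp[OF smooth_\<kappa>] smooth_lam y] pd_scaleR[OF smooth_\<kappa> sp[OF smooth_lam] y]
        pd_scaleR_const[OF sp[OF smooth_lam] y] mixed_lam[OF y])
  have lz: "lorentz (pd 2 (pd 1 \<kappa>) y *\<^sub>R lam y + pd 1 \<kappa> y *\<^sub>R pd 2 lam y + pd 2 \<kappa> y *\<^sub>R pd 1 lam y) (pd k lam y) = 0" for k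
    unfolding z by (simp add: lorentz_simps)
  have "pd 2 \<kappa> y = 0" "pd 1 \<kappa> y = 0"
    using lz[of 1] lz[of 2] by (simp_all add: lorentz_simps dlam[OF y] mat_nth frame_pd[OF y])
  then show ?thesis using exhaust_2[of i] by auto
qed

lemma \<kappa>_constant:
  assumes "convex D" obtains c where "\<And>y. y \<in> D \<Longrightarrow> \<kappa> y = c"
proof -
  have "(\<kappa> has_derivative (\<lambda>h. 0)) (at y within D)" if "y \<in> D" for y
    using has_derivative_pd[OF smooth_\<kappa> that] by (simp add: pd_\<kappa>[OF that] has_derivative_at_withinI)
  from has_derivative_zero_constant[OF assms this] show ?thesis using that by blast
qed

lemma II0_lam: "y \<in> D \<Longrightarrow> II0 lam y = (\<chi> i j. q0 $ i $ j *\<^sub>R xi y)"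
  by (simp add: II0_B B_q0)

text \<open>The mixed derivative of \<open>lam\<close> vanishes, so \<open>A\<close> is diagonal and
  its tracefree part is a multiple of \<open>q0\<close>. Comparison with the factor
  \<open>t / 2\<close> gives \<open>t = - \<kappa>\<close>.\<close>

lemma r0_lam:
  assumes y: "y \<in> D" shows "r0 lam y = (- \<kappa> y / 2) *\<^sub>R q0"
proof -
  have A12: "A 1 2 y = 0" "A 2 1 y = 0" by (simp_all add: A_def mixed_lam[OF y] lorentz_simps)
  have tr: "trace_wrt (mat 1) (\<chi> i j. A i j y) = A 1 1 y + A 2 2 y"
    using trace_wrt_conformal[of 1 "\<chi> i j. A i j y"] by simp
  show ?thesis unfolding vec_eq_iff forall_2
    by (simp add: r0_eq[OF y] tr A12 q0_nth mat_nth \<kappa>_def metric[OF y] field_simps)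
qed

lemma unit_normal_xi: "unit_normal D lam xi"
  unfolding unit_normal_def
  using smooth_xi unit central_sphere_eq[OF sd(5) normal]
  by (auto simp: lorentz_perp_def lorentz_commute)

end

locale flat_gauge = flat_form +
  fixes \<mu> :: "real^2 \<Rightarrow> real" and s :: "real^2 \<Rightarrow> mink"
  assumes smooth_\<mu>: "smooth_on D \<mu>" and \<mu>_pos: "\<And>y. y \<in> D \<Longrightarrow> \<mu> y > 0"
    and s_eq: "\<And>y. y \<in> D \<Longrightarrow> s y = \<mu> y *\<^sub>R lam y"
begin

lemma smooth_s: "smooth_on D s"
  by (rule smooth_on_cong[OF smooth_on_scaleR[OF open_D smooth_\<mu> smooth_lam] open_D]) (simp add: s_eq)

lemma pd_s:
  assumes y: "y \<in> D" shows "pd i s y = \<mu> y *\<^sub>R pd i lam y + pd i \<mu> y *\<^sub>R lam y"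
proof -
  have "pd i s y = pd i (\<lambda>w. \<mu> w *\<^sub>R lam w) y"
    by (rule pd_cong[OF open_D y]) (rule s_eq)
  then show ?thesis by (simp add: pd_gauge[OF section_lam smooth_\<mu> y])
qed

lemma pd_pd_s:
  assumes y: "y \<in> D" shows "pd i (pd j s) y = \<mu> y *\<^sub>R pd i (pd j lam) y + pd i \<mu> y *\<^sub>R pd j lam y
      + pd j \<mu> y *\<^sub>R pd i lam y + pd i (pd j \<mu>) y *\<^sub>R lam y"
proof -
  have "pd i (pd j s) y = pd i (pd j (\<lambda>w. \<mu> w *\<^sub>R lam w)) y"
    by (rule pd_cong[OF open_D y]) (simp add: pd_s pd_gauge[OF section_lam smooth_\<mu>])
  then show ?thesis by (simp add: pd_gauge[OF section_lam smooth_\<mu> y])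
qed

lemma metric_s: "y \<in> D \<Longrightarrow> ind_metric s y = (\<mu> y)\<^sup>2 *\<^sub>R mat 1"
  by (simp add: ind_metric_def vec_eq_iff pd_s lorentz_simps dlam frame_pd null power2_eq_square)

lemma section_s: "section_on D s"
  unfolding section_on_def
proof (intro conjI ballI open_D smooth_s)
  fix y assume y: "y \<in> D"
  have n: "lorentz (s w) (s w) = 0" if "w \<in> D" for w using that by (simp add: s_eq lorentz_simps null)
  show "regular s y"
    using null_deriv[OF open_D smooth_s n y] \<mu>_pos[OF y] snd_pos[OF y] n[OF y]
    by (auto simp: regular_def metric_s[OF y] mat_nth det_2 s_eq[OF y])
qed

lemma normal_s:
  assumes y: "y \<in> D" shows "normal_at s y (xi y)"
proof -
  have "lorentz (pd i (pd j s) y) (xi y) = - \<mu> y * q0 $ i $ j" for i j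
    by (simp add: pd_pd_s[OF y] lorentz_simps second_lam_xi[OF y] frame_pd[OF y] fs[OF y])
  then have "trace_wrt ((\<mu> y)\<^sup>2 *\<^sub>R mat 1) (\<chi> i j. lorentz (pd i (pd j s) y) (xi y)) = 0"
    using \<mu>_pos[OF y] by (subst trace_wrt_conformal) (auto simp: q0_nth)
  then show ?thesis
    using y by (simp add: normal_at_def unit s_eq pd_s lorentz_simps xi_lam xi_dlam metric_s)
qed

sublocale S: normal_section D s xi
  by unfold_locales (simp_all add: section_s smooth_xi normal_s)

lemma central_s: "y \<in> D \<Longrightarrow> central_sphere s y = lorentz_perp {xi y}"
  by (rule central_sphere_eq[OF S.sd(5) normal_s])

lemma II0_s: 
  assumes "y \<in> D" shows "II0 s y $ i $ j = (\<mu> y * q0 $ i $ j) *\<^sub>R xi y"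
proof -
  have "S.B i j y = \<mu> y * q0 $ i $ j"
    by (simp add: S.B_def pd_pd_s[OF assms] lorentz_simps second_lam_xi[OF assms] frame_pd[OF assms] fs[OF assms])
  then show ?thesis by (simp add: S.II0_B[OF assms])
qed

lemma christoffel_s:
  assumes y: "y \<in> D"
  shows "christoffel (ind_metric s) y k i j =
    (pd i \<mu> y * mat 1 $ j $ k + pd j \<mu> y * mat 1 $ i $ k - pd k \<mu> y * mat 1 $ i $ j) / \<mu> y"
proof -
  have m: "\<mu> y \<noteq> 0" using \<mu>_pos[OF y] by simp
  have dg: "pd k (\<lambda>w. ind_metric s w $ i $ j) y = 2 * \<mu> y * pd k \<mu> y * mat 1 $ i $ j" for k i j
  proof -
    have "pd k (\<lambda>w. ind_metric s w $ i $ j) y = pd k (\<lambda>w. (mat 1 $ i $ j) *\<^sub>R (\<mu> w * \<mu> w)) y"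
      by (rule pd_cong[OF open_D y]) (simp add: metric_s power2_eq_square)
    also have "\<dots> = (mat 1 $ i $ j) *\<^sub>R pd k (\<lambda>w. \<mu> w * \<mu> w) y"
      by (rule pd_scaleR_const[OF smooth_on_mult[OF open_D smooth_\<mu> smooth_\<mu>] y])
    finally show ?thesis by (simp add: pd_mult[OF smooth_\<mu> smooth_\<mu> y])
  qed
  have inv: "matrix_inv (ind_metric s y) $ a $ b = mat 1 $ a $ b / (\<mu> y)\<^sup>2" for a b
    using m by (simp add: metric_s[OF y] matrix_inv_conformal)
  show ?thesis
    unfolding christoffel_def dg inv sum_2 using m exhaust_2[of k]
    by (auto simp: mat_nth field_simps power2_eq_square)
qed

text \<open>The diagonal entries of the tracefree Hessian are plus and minus half the difference of
  the diagonal Hessian entries, and in this difference the terms along \<open>pd i lam\<close>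
  cancel against the Christoffel terms. The diagonal suffices because \<open>II0\<close> is diagonal
  in these coordinates.\<close>

lemma r0_s:
  assumes y: "y \<in> D"
  defines "a \<equiv> - (\<kappa> y + (pd 1 (pd 1 \<mu>) y - pd 2 (pd 2 \<mu>) y) / \<mu> y - 2 * ((pd 1 \<mu> y)\<^sup>2 - (pd 2 \<mu> y)\<^sup>2) / (\<mu> y)\<^sup>2) / 2"
  shows "r0 s y $ 1 $ 1 = a" "r0 s y $ 2 $ 2 = - a"
proof -
  have m: "\<mu> y \<noteq> 0" using \<mu>_pos[OF y] by simp
  let ?H = "hessian (ind_metric s) s y"
  let ?m1 = "pd 1 \<mu> y" and ?m2 = "pd 2 \<mu> y"
  have dbl: "(2 * p / q) *\<^sub>R v = (p / q) *\<^sub>R v + (p / q) *\<^sub>R v" for p q :: real and v :: mink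
    by (simp add: scaleR_add_left[symmetric])
  have dbl2: "(2 * p) *\<^sub>R v = p *\<^sub>R v + p *\<^sub>R v" for p :: real and v :: mink
    by (simp add: scaleR_add_left[symmetric])
  have "?H $ 1 $ 1 - ?H $ 2 $ 2 = (pd 1 (pd 1 s) y - pd 2 (pd 2 s) y)
      - (2 * ?m1 / \<mu> y) *\<^sub>R pd 1 s y + (2 * ?m2 / \<mu> y) *\<^sub>R pd 2 s y"
    by (simp add: hessian_def sum_2 christoffel_s[OF y] mat_nth) (simp add: dbl algebra_simps)
  also have "pd 1 (pd 1 s) y - pd 2 (pd 2 s) y = \<mu> y *\<^sub>R (\<kappa> y *\<^sub>R lam y - 2 *\<^sub>R xi y) + (2 * ?m1) *\<^sub>R pd 1 lam y
      - (2 * ?m2) *\<^sub>R pd 2 lam y + (pd 1 (pd 1 \<mu>) y - pd 2 (pd 2 \<mu>) y) *\<^sub>R lam y"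
    unfolding lam_diff[OF y, symmetric] pd_pd_s[OF y] by (simp only: dbl2) (simp add: algebra_simps)
  also have "\<dots> - (2 * ?m1 / \<mu> y) *\<^sub>R pd 1 s y + (2 * ?m2 / \<mu> y) *\<^sub>R pd 2 s y =
      (\<mu> y * \<kappa> y + (pd 1 (pd 1 \<mu>) y - pd 2 (pd 2 \<mu>) y) - 2 * (?m1\<^sup>2 - ?m2\<^sup>2) / \<mu> y) *\<^sub>R lam y - (2 * \<mu> y) *\<^sub>R xi y"
    using m by (simp add: pd_s[OF y] algebra_simps power2_eq_square diff_divide_distrib)
  also have "\<mu> y * \<kappa> y + (pd 1 (pd 1 \<mu>) y - pd 2 (pd 2 \<mu>) y) - 2 * (?m1\<^sup>2 - ?m2\<^sup>2) / \<mu> y = (- 2 * a) * \<mu> y"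
    using m by (simp add: a_def field_simps power2_eq_square)
  also have "((- 2 * a) * \<mu> y) *\<^sub>R lam y = (- 2 * a) *\<^sub>R s y"
    by (simp add: s_eq[OF y])
  finally have H: "?H $ 1 $ 1 - ?H $ 2 $ 2 = (- 2 * a) *\<^sub>R s y - (2 * \<mu> y) *\<^sub>R xi y" .
  have tr: "trace_wrt ((\<mu> y)\<^sup>2 *\<^sub>R mat 1) ?H = (1 / (\<mu> y)\<^sup>2) *\<^sub>R (?H $ 1 $ 1 + ?H $ 2 $ 2)"
    using m by (intro trace_wrt_conformal) simp
  have half: "(1/2) *\<^sub>R (x + x) = x" for x :: mink by (simp add: scaleR_half_double)
  have e: "sym0 (ind_metric s y) ?H $ 1 $ 1 = ?H $ 1 $ 1 - (1/2) *\<^sub>R (?H $ 1 $ 1 + ?H $ 2 $ 2)"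
    "sym0 (ind_metric s y) ?H $ 2 $ 2 = ?H $ 2 $ 2 - (1/2) *\<^sub>R (?H $ 1 $ 1 + ?H $ 2 $ 2)"
    using m unfolding sym0_def metric_s[OF y] tr by (simp_all add: half mat_nth)
  have "x - (1/2) *\<^sub>R (x + z) = (1/2) *\<^sub>R (x - z)" "z - (1/2) *\<^sub>R (x + z) = (-1/2) *\<^sub>R (x - z)" for x z :: mink
  proof -
    have "x - (1/2) *\<^sub>R (x + z) = (1/2) *\<^sub>R ((x + x) - (x + z))" "z - (1/2) *\<^sub>R (x + z) = (1/2) *\<^sub>R ((z + z) - (x + z))"
      by (simp_all only: scaleR_diff_right half)
    then show "x - (1/2) *\<^sub>R (x + z) = (1/2) *\<^sub>R (x - z)" "z - (1/2) *\<^sub>R (x + z) = (-1/2) *\<^sub>R (x - z)"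
      by (simp_all add: algebra_simps)
  qed
  then have "sym0 (ind_metric s y) ?H $ 1 $ 1 = (1/2) *\<^sub>R (?H $ 1 $ 1 - ?H $ 2 $ 2)"
      "sym0 (ind_metric s y) ?H $ 2 $ 2 = (-1/2) *\<^sub>R (?H $ 1 $ 1 - ?H $ 2 $ 2)"
    unfolding e by blast+
  then have f: "sym0 (ind_metric s y) ?H $ 1 $ 1 = (- a) *\<^sub>R s y + (- \<mu> y) *\<^sub>R xi y"
    "sym0 (ind_metric s y) ?H $ 2 $ 2 = (- (- a)) *\<^sub>R s y + \<mu> y *\<^sub>R xi y"
    unfolding H by (simp_all add: algebra_simps)
  show "r0 s y $ 1 $ 1 = a" "r0 s y $ 2 $ 2 = - a" by (rule S.r0_eqI[OF y f(1)], rule S.r0_eqI[OF y f(2)])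
qed

text \<open>\<open>xi\<close> is a unit section of a line bundle, so its derivative has no normal
  component and the connection differentiates only the coefficient.\<close>

lemma normal_conn_s:
  assumes y: "y \<in> D" and b: "smooth_on D b" and f: "\<And>w. w \<in> D \<Longrightarrow> f w = b w *\<^sub>R xi w"
  shows "normal_conn s k f y = pd k b y *\<^sub>R xi y"
proof -
  have "pd k f y = pd k (\<lambda>w. b w *\<^sub>R xi w) y"
    by (rule pd_cong[OF open_D y]) (rule f)
  also have "\<dots> = pd k b y *\<^sub>R xi y + b y *\<^sub>R pd k xi y"
    by (rule pd_scaleR[OF b smooth_xi y])
  finally show ?thesis
    by (simp add: normal_conn_def central_s[OF y] nor_proj_perp[OF unit[OF y]] lorentz_simps unit[OF y] pd_n[OF y])
qed

text \<open>On tracefree symmetric tensors in dimension two the Christoffel terms of a conformally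
  flat metric cancel in the divergence, leaving \<open>1 / \<mu>\<^sup>2\<close> times the flat
  divergence of \<open>\<mu> q0\<close>.\<close>

lemma div2_s:
  assumes y: "y \<in> D"
  shows "div2 (normal_conn s) (ind_metric s) (II0 s) y $ 1 = (pd 1 \<mu> y / (\<mu> y)\<^sup>2) *\<^sub>R xi y"
    "div2 (normal_conn s) (ind_metric s) (II0 s) y $ 2 = (- pd 2 \<mu> y / (\<mu> y)\<^sup>2) *\<^sub>R xi y"
proof -
  have m: "\<mu> y \<noteq> 0" using \<mu>_pos[OF y] by simp
  have nc: "normal_conn s k (\<lambda>w. II0 s w $ i $ j) y = (pd k \<mu> y * q0 $ i $ j) *\<^sub>R xi y" for k i j
  proof -
    have "normal_conn s k (\<lambda>w. II0 s w $ i $ j) y = pd k (\<lambda>w. \<mu> w * q0 $ i $ j) y *\<^sub>R xi y"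
      by (rule normal_conn_s[OF y]) (auto intro: smooth_on_mult smooth_on_const smooth_\<mu> open_D II0_s)
    then show ?thesis by (simp add: pd_mult[OF smooth_\<mu> smooth_on_const y])
  qed
  have c: "cov2 (normal_conn s) (ind_metric s) (II0 s) y k i j =
      (pd k \<mu> y * q0 $ i $ j - (\<Sum>m\<in>UNIV. christoffel (ind_metric s) y m k i * (\<mu> y * q0 $ m $ j))
        - (\<Sum>m\<in>UNIV. christoffel (ind_metric s) y m k j * (\<mu> y * q0 $ i $ m))) *\<^sub>R xi y" for k i j
    unfolding cov2_def nc by (simp add: II0_s[OF y] sum_2 algebra_simps)
  have tr: "trace_wrt (ind_metric s y) M = (1 / (\<mu> y)\<^sup>2) *\<^sub>R (M $ 1 $ 1 + M $ 2 $ 2)" for M :: "mink^2^2"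
    unfolding metric_s[OF y] using m by (intro trace_wrt_conformal) simp
  show "div2 (normal_conn s) (ind_metric s) (II0 s) y $ 1 = (pd 1 \<mu> y / (\<mu> y)\<^sup>2) *\<^sub>R xi y"
    "div2 (normal_conn s) (ind_metric s) (II0 s) y $ 2 = (- pd 2 \<mu> y / (\<mu> y)\<^sup>2) *\<^sub>R xi y"
    using m unfolding div2_def
    by (simp_all add: tr c christoffel_s[OF y] sum_2 q0_nth mat_nth scaleR_add_left[symmetric])
qed

text \<open>The derivatives of \<mu> produced by the double divergence occur in the
  \<open>r0\<close> term with the opposite sign, which leaves only \<kappa>. The power of \<mu> is
  \<open>\<mu>\<^sup>-\<^sup>4\<close> from two inverse metrics times \<mu> from
  \<open>II0\<close>.\<close>

lemma willmore_s:
  assumes y: "y \<in> D"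
  shows "willmore_expr s y = (- \<kappa> y / \<mu> y ^ 3) *\<^sub>R xi y"
proof -
  have m: "\<mu> y \<noteq> 0" using \<mu>_pos[OF y] by simp
  let ?\<alpha> = "div2 (normal_conn s) (ind_metric s) (II0 s)"
  have sm: "smooth_on D (\<lambda>w. pd 1 \<mu> w / (\<mu> w)\<^sup>2)" "smooth_on D (\<lambda>w. - pd 2 \<mu> w / (\<mu> w)\<^sup>2)" "smooth_on D (\<lambda>w. (\<mu> w)\<^sup>2)"
    by (auto intro!: smooth_on_divide smooth_on_minus smooth_on_power smooth_on_pd smooth_\<mu> open_D dest: \<mu>_pos)
  have pd2: "pd k (\<lambda>w. (\<mu> w)\<^sup>2) y = 2 * \<mu> y * pd k \<mu> y" for k
    by (simp add: power2_eq_square pd_mult[OF smooth_\<mu> smooth_\<mu> y])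
  have d1: "normal_conn s 1 (\<lambda>w. ?\<alpha> w $ 1) y = ((pd 1 (pd 1 \<mu>) y * (\<mu> y)\<^sup>2 - pd 1 \<mu> y * (2 * \<mu> y * pd 1 \<mu> y)) / ((\<mu> y)\<^sup>2)\<^sup>2) *\<^sub>R xi y"
    using m by (subst normal_conn_s[OF y sm(1) div2_s(1)])
      (simp_all add: pd_divide[OF smooth_on_pd[OF smooth_\<mu>] sm(3) y] pd2)
  have e2: "pd 2 (\<lambda>w. - pd 2 \<mu> w / (\<mu> w)\<^sup>2) y = (- pd 2 (pd 2 \<mu>) y * (\<mu> y)\<^sup>2 + pd 2 \<mu> y * (2 * \<mu> y * pd 2 \<mu> y)) / ((\<mu> y)\<^sup>2)\<^sup>2"
    using m by (subst pd_divide[OF smooth_on_minus[OF open_D smooth_on_pd[OF smooth_\<mu>]] sm(3) y])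
      (simp, simp only: pd2 pd_minus[OF smooth_on_pd[OF smooth_\<mu>] y], simp)
  have d2: "normal_conn s 2 (\<lambda>w. ?\<alpha> w $ 2) y = ((- pd 2 (pd 2 \<mu>) y * (\<mu> y)\<^sup>2 + pd 2 \<mu> y * (2 * \<mu> y * pd 2 \<mu> y)) / ((\<mu> y)\<^sup>2)\<^sup>2) *\<^sub>R xi y"
    unfolding e2[symmetric] by (rule normal_conn_s[OF y sm(2) div2_s(2)])
  have tr: "trace_wrt (ind_metric s y) M = (1 / (\<mu> y)\<^sup>2) *\<^sub>R (M $ 1 $ 1 + M $ 2 $ 2)" for M :: "mink^2^2"
    unfolding metric_s[OF y] using m by (intro trace_wrt_conformal) simp
  \<comment> \<open>The traced Christoffel symbols of a conformally flat metric vanish in dimension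
    two, so the divergence of a one-form is the flat one divided by
    \<open>\<mu>\<^sup>2\<close>.\<close>
  have dd: "div1 (normal_conn s) (ind_metric s) ?\<alpha> y = (1 / (\<mu> y)\<^sup>2) *\<^sub>R
      (normal_conn s 1 (\<lambda>w. ?\<alpha> w $ 1) y + normal_conn s 2 (\<lambda>w. ?\<alpha> w $ 2) y)"
    by (simp add: div1_def tr cov1_def sum_2 christoffel_s[OF y] mat_nth algebra_simps)
  have inv: "matrix_inv (ind_metric s y) $ a $ b = mat 1 $ a $ b / (\<mu> y)\<^sup>2" for a b
    using m by (simp add: metric_s[OF y] matrix_inv_conformal)
  have r22: "r0 s y $ 2 $ 2 = - r0 s y $ 1 $ 1" using r0_s[OF y] by simp
  have q: "(\<Sum>i\<in>UNIV. \<Sum>j\<in>UNIV. \<Sum>k\<in>UNIV. \<Sum>l\<in>UNIV.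
        (matrix_inv (ind_metric s y) $ i $ k * matrix_inv (ind_metric s y) $ j $ l * r0 s y $ i $ j) *\<^sub>R II0 s y $ k $ l) =
      (2 * r0 s y $ 1 $ 1 / (\<mu> y)^3) *\<^sub>R xi y"
    using m
    by (simp add: r22 inv II0_s[OF y] sum_2 mat_nth q0_nth scaleR_add_left[symmetric]) (simp add: field_simps power2_eq_square power3_eq_cube power4_eq_xxxx)
  show ?thesis
    unfolding willmore_expr_def dd d1 d2 q r0_s(1)[OF y] scaleR_add_left[symmetric] scaleR_scaleR
    using m by (intro arg_cong2[where f = scaleR] refl) (simp add: field_simps power2_eq_square power3_eq_cube)
qed

text \<open>In these coordinates \<open>q0\<close>, the metric and the shape operator are all
  diagonal, which gives the commutation; closedness of \<open>q0\<close> rests on a cancellation of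
  Christoffel terms.\<close>

lemma isothermic_s:
  assumes y: "y \<in> D"
  shows "trace_wrt (ind_metric s y) q0 = 0" "ext_cov (ind_metric s) (\<lambda>u. q0) y k i j = 0"
    "n \<in> lorentz_perp (central_sphere s y) \<Longrightarrow> bil q0 X (shape0 s y Y n) = bil q0 Y (shape0 s y X n)"
proof -
  have m: "\<mu> y \<noteq> 0" using \<mu>_pos[OF y] by simp
  show "trace_wrt (ind_metric s y) q0 = 0"
    using m by (simp add: metric_s[OF y] trace_wrt_conformal q0_nth)
  have 12: "ext_cov (ind_metric s) (\<lambda>u. q0) y 1 2 j = 0" for j
    using exhaust_2[of j] by (auto simp: S.ext_cov_eq[OF y] sum_2 q0_nth mat_nth christoffel_s[OF y])
  have "ext_cov (ind_metric s) (\<lambda>u. q0) y k i j = - ext_cov (ind_metric s) (\<lambda>u. q0) y i k j" for k i j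
    by (simp add: ext_cov_def)
  from this[of 2 1 j] 12[of j] show "ext_cov (ind_metric s) (\<lambda>u. q0) y k i j = 0"
    using exhaust_2[of k] exhaust_2[of i] by (auto simp: ext_cov_def)
  assume "n \<in> lorentz_perp (central_sphere s y)"
  then have n: "n = lorentz n (xi y) *\<^sub>R xi y"
    unfolding central_s[OF y] by (rule lorentz_perp_perp[OF unit[OF y]])
  define c where "c = lorentz n (xi y)"
  have shape: "shape0 s y Y n = (c / \<mu> y) *\<^sub>R vector [Y $ 1, - Y $ 2]" for Y
    unfolding shape0_def
  proof (rule the_equality)
    have r: "lorentz (bil (II0 s y) X Y) n = \<mu> y * c * (X $ 1 * Y $ 1 - X $ 2 * Y $ 2)" for X
      by (simp add: bil_def sum_2 II0_s[OF y] q0_nth lorentz_simps lorentz_commute[of "xi y" n] c_def algebra_simps)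
    have l: "bil (ind_metric s y) Z X = (\<mu> y)\<^sup>2 * (Z $ 1 * X $ 1 + Z $ 2 * X $ 2)" for Z X
      by (simp add: bil_def sum_2 metric_s[OF y] mat_nth algebra_simps)
    show "\<forall>X. bil (ind_metric s y) ((c / \<mu> y) *\<^sub>R vector [Y $ 1, - Y $ 2]) X = lorentz (bil (II0 s y) X Y) n"
      using m by (simp add: r l power2_eq_square field_simps)
    fix Z assume Z: "\<forall>X. bil (ind_metric s y) Z X = lorentz (bil (II0 s y) X Y) n"
    have "\<mu> y * (\<mu> y * Z $ 1) = \<mu> y * (c * Y $ 1)" "\<mu> y * (\<mu> y * Z $ 2) = \<mu> y * (- (c * Y $ 2))"
      using Z[rule_format, of "axis 1 1"] Z[rule_format, of "axis 2 1"] unfolding r l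
      by (simp_all add: axis_def power2_eq_square)
    then have "\<mu> y * Z $ 1 = c * Y $ 1" "\<mu> y * Z $ 2 = - (c * Y $ 2)"
      unfolding mult_cancel_left using m by simp_all
    then show "Z = (c / \<mu> y) *\<^sub>R vector [Y $ 1, - Y $ 2]"
      using m by (simp add: vec_eq_iff forall_2 field_simps power2_eq_square)
  qed
  show "bil q0 X (shape0 s y Y n) = bil q0 Y (shape0 s y X n)"
    by (simp add: shape bil_def sum_2 q0_nth algebra_simps)
qed

end

section \<open>Charts\<close>

lemma homeomorphism_open_image:
  assumes "homeomorphism U D x y" "open D" "open T" "T \<subseteq> U"
  shows "open (x ` T)"
proof -
  have "openin (top_of_set U) T" using assms(3,4) by (rule open_subset[rotated])
  from homeomorphism_imp_open_map[OF assms(1) this] show ?thesis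
    using openin_open_trans assms(2) by blast
qed

text \<open>On \<open>D\<close> the inverse of the new chart is \<open>Y\<close> followed by the
  inverse of \<open>x\<close>, so compatibility with the atlas reduces to the chain rule. With the
  identity as \<open>X\<close> the lemma merely shrinks a chart.\<close>

lemma coordinates_change:
  assumes A: "smooth_surface A" and c: "(U, x) \<in> coordinates A"
    and V: "open V" "V \<subseteq> x ` U" and D: "open D" "homeomorphism V D X Y"
    and sm: "smooth_on V X" "smooth_on D Y"
  defines "U' \<equiv> U \<inter> x -` V" and "x' \<equiv> X \<circ> x"
  shows "(U', x') \<in> coordinates A" "x' ` U' = D"
    "\<And>y. y \<in> D \<Longrightarrow> inv_into U' x' y = inv_into U x (Y y)"
proof -
  let ?i = "inv_into U x"
  have ch: "open U" "open (x ` U)" and hom: "homeomorphism U (x ` U) x ?i" and UA: "U \<subseteq> points A"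
    and comp: "\<And>d. d \<in> A \<Longrightarrow> compatible (U, x) d"
    using c by (auto simp: coordinates_def is_chart_def)
  have oU': "open U'"
    unfolding U'_def using continuous_on_open_vimage[OF ch(1), of x] hom V(1)
    by (metis homeomorphism_def inf_commute)
  have xU': "x ` U' = V" using V(2) by (auto simp: U'_def)
  have "homeomorphism U' V x ?i"
    by (rule homeomorphism_of_subsets[OF hom]) (use V xU' in \<open>auto simp: U'_def\<close>)
  then have hom': "homeomorphism U' D x' (?i \<circ> Y)"
    unfolding x'_def by (rule homeomorphism_compose[OF _ D(2)])
  show im: "x' ` U' = D" using hom' by (simp add: homeomorphism_def)
  have inj: "inj_on x' U'" using hom' by (metis homeomorphism_def inj_on_inverseI)
  show inv: "inv_into U' x' y = ?i (Y y)" if "y \<in> D" for y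
  proof (rule inv_into_f_eq[OF inj])
    show "?i (Y y) \<in> U'" "x' (?i (Y y)) = y" using hom' that by (auto simp: homeomorphism_def)
  qed
  have inv': "inv_into U' x' (x' q) = q" if "q \<in> U'" for q using inj that by simp
  have chart: "is_chart (U', x')"
  proof -
    have "homeomorphism U' D x' (inv_into U' x')"
      using hom' inv by (auto intro: homeomorphism_cong)
    then show ?thesis using oU' im D(1) by (simp add: is_chart_def)
  qed
  have "compatible (U', x') (W, w)" if d: "(W, w) \<in> A" for W w
  proof -
    let ?j = "inv_into W w"
    have W: "open W" "open (w ` W)" "homeomorphism W (w ` W) w ?j"
      using A d by (auto simp: smooth_surface_def is_chart_def)
    have cs: "smooth_on (x ` (U \<inter> W)) (w \<circ> ?i)" "smooth_on (w ` (U \<inter> W)) (x \<circ> ?j)"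
      using comp[OF d] by (auto simp: compatible_def)
    have jw: "?j (w q) = q" if "q \<in> W" for q using W(3) that by (auto simp: homeomorphism_def)
    have oE: "open (x' ` (U' \<inter> W))"
      by (rule homeomorphism_open_image[OF hom' D(1)]) (use oU' W in auto)
    have ED: "x' ` (U' \<inter> W) \<subseteq> D" using im by blast
    have YE: "Y ` (x' ` (U' \<inter> W)) \<subseteq> x ` (U \<inter> W)"
    proof (clarsimp)
      fix q assume "q \<in> U'" "q \<in> W"
      then show "Y (x' q) \<in> x ` (U \<inter> W)"
        using D(2) xU' by (auto simp: x'_def homeomorphism_def U'_def)
    qed
    have "smooth_on (x' ` (U' \<inter> W)) (\<lambda>y. (w \<circ> ?i) (Y y))"
      by (rule smooth_on_compose[OF cs(1) smooth_on_subset[OF sm(2) ED] oE YE])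
    then have 1: "smooth_on (x' ` (U' \<inter> W)) (w \<circ> inv_into U' x')"
      by (rule smooth_on_cong[OF _ oE]) (use ED in \<open>auto simp: inv\<close>)
    have oF: "open (w ` (U' \<inter> W))"
      by (rule homeomorphism_open_image[OF W(3,2)]) (use oU' W in auto)
    have FV: "(x \<circ> ?j) ` (w ` (U' \<inter> W)) \<subseteq> V" using xU' by (auto simp: jw)
    have "smooth_on (w ` (U' \<inter> W)) (\<lambda>y. X ((x \<circ> ?j) y))"
      by (rule smooth_on_compose[OF sm(1) smooth_on_subset[OF cs(2)] oF FV]) (auto simp: U'_def)
    then have 2: "smooth_on (w ` (U' \<inter> W)) (x' \<circ> ?j)" by (simp add: x'_def o_def)
    show ?thesis using 1 2 by (simp add: compatible_def)
  qed
  moreover have "U' \<subseteq> points A" using UA by (auto simp: U'_def)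
  ultimately show "(U', x') \<in> coordinates A" using chart by (auto simp: coordinates_def)
qed

text \<open>On the line spanned by \<open>lam y\<close> the coefficient of a vector is the ratio of
  last coordinates, which is smooth and positive here.\<close>

lemma flat_gaugeI:
  assumes "flat_form D lam xi" and L: "\<And>y. y \<in> D \<Longrightarrow> L y = span {lam y}" and s: "positive_section D L s"
  shows "flat_gauge D lam xi (\<lambda>y. snd (s y) / snd (lam y)) s"
proof -
  interpret flat_form D lam xi by fact
  have sm: "smooth_on D s" and sp: "\<And>y. y \<in> D \<Longrightarrow> snd (s y) > 0" using s by (auto simp: positive_section_def)
  show ?thesis
  proof
    show "smooth_on D (\<lambda>y. snd (s y) / snd (lam y))"
      by (intro smooth_on_divide smooth_on_snd sm smooth_lam open_D) (use snd_pos in force)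
    fix y assume y: "y \<in> D"
    show "snd (s y) / snd (lam y) > 0" using sp[OF y] snd_pos[OF y] by simp
    obtain c where "s y = c *\<^sub>R lam y"
      using s y L[OF y] by (auto simp: positive_section_def span_singleton)
    then show "s y = (snd (s y) / snd (lam y)) *\<^sub>R lam y" using snd_pos[OF y] by simp
  qed
qed

lemma flat_form_conclusion:
  assumes flat: "flat_form D lam xi" and span: "\<forall>y\<in>D. L y = span {lam y}" and D: "convex D" "D \<noteq> {}"
  shows "positive_section D L lam \<and> unit_normal D lam xi \<and>
    (\<forall>u\<in>D. ind_metric lam u = mat 1) \<and>
    (\<forall>u\<in>D. II0 lam u = (\<chi> i j. (q0 $ i $ j) *\<^sub>R xi u)) \<and>
    (\<exists>t. (\<forall>l. smooth_on D l \<longrightarrow> (\<forall>u\<in>D.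
       moebius_op lam l u = sym0 (ind_metric lam u) (hessian (ind_metric lam) l u) + (t / 2 * l u) *\<^sub>R q0)) \<and>
       isothermic_patch D L (\<lambda>u. q0) \<and> (willmore_patch D L \<longleftrightarrow> t = 0))"
proof -
  interpret flat_form D lam xi by fact
  have L: "L y = span {lam y}" if "y \<in> D" for y using span that by blast
  obtain c where c: "\<And>y. y \<in> D \<Longrightarrow> \<kappa> y = c" using \<kappa>_constant[OF D(1)] by blast
  have pos: "positive_section D L lam"
    using smooth_lam snd_pos L by (auto simp: positive_section_def intro: span_base)
  have moeb: "moebius_op lam l u = sym0 (ind_metric lam u) (hessian (ind_metric lam) l u) + (- c / 2 * l u) *\<^sub>R q0"
    if "u \<in> D" for l u
    unfolding moebius_op_def r0_lam[OF that] c[OF that] by (simp add: mult.commute)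
  have iso: "isothermic_patch D L (\<lambda>u. q0)"
    unfolding isothermic_patch_def
  proof (intro conjI allI impI ballI)
    show "smooth_on D (\<lambda>u. q0)" by (rule smooth_on_const)
    have "q0 \<noteq> 0" using q0_nth(1) by (metis zero_index zero_neq_one)
    then show "\<exists>u\<in>D. q0 \<noteq> 0" using D(2) by blast
    show "transpose q0 = q0" by (simp add: transpose_def vec_eq_iff q0_def)
    fix s u assume s: "positive_section D L s" and u: "u \<in> D"
    interpret S: flat_gauge D lam xi "\<lambda>y. snd (s y) / snd (lam y)" s by (rule flat_gaugeI[OF flat L s])
    show "trace_wrt (ind_metric s u) q0 = 0" "ext_cov (ind_metric s) (\<lambda>u. q0) u k i j = 0" for k i j
      using S.isothermic_s(1,2)[OF u] by simp_all
    show "bil q0 X (shape0 s u Y n) = bil q0 Y (shape0 s u X n)" if "n \<in> lorentz_perp (central_sphere s u)" for X Y n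
      by (rule S.isothermic_s(3)[OF u that])
  qed
  have willmore: "willmore_patch D L \<longleftrightarrow> - c = 0"
  proof
    assume W: "willmore_patch D L"
    obtain y where y: "y \<in> D" using D(2) by blast
    \<comment> \<open>Tested in the gauge \<open>lam\<close> itself, where the factor is 1, the
      equation already forces the constant to vanish.\<close>
    interpret S: flat_gauge D lam xi "\<lambda>y. snd (lam y) / snd (lam y)" lam by (rule flat_gaugeI[OF flat L pos])
    have "willmore_expr lam y = 0" using W pos y by (auto simp: willmore_patch_def)
    then have "(- c) *\<^sub>R xi y = 0" using S.willmore_s[OF y] snd_pos[OF y] c[OF y] by simp
    moreover have "xi y \<noteq> 0" using unit[OF y] by (auto simp: lorentz_simps)
    ultimately show "- c = 0" by simp
  next
    assume c0: "- c = 0"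
    show "willmore_patch D L"
      unfolding willmore_patch_def
    proof (intro allI impI ballI)
      fix s y assume s: "positive_section D L s" and y: "y \<in> D"
      interpret S: flat_gauge D lam xi "\<lambda>y. snd (s y) / snd (lam y)" s by (rule flat_gaugeI[OF flat L s])
      show "willmore_expr s y = 0" using S.willmore_s[OF y] c[OF y] c0 by simp
    qed
  qed
  show ?thesis using pos unit_normal_xi metric II0_lam moeb iso willmore by blast
qed

theorem proposition16p11:
  fixes A :: "'a::{t2_space, second_countable_topology} chart set"
    and \<Lambda> :: "'a \<Rightarrow> mink set"
    and p :: 'a
  assumes "smooth_surface A"
    and "immersion A \<Lambda>"
    and "strictly_moebius_flat A \<Lambda>"
    and "p \<in> points A"
    and "\<not> umbilic A \<Lambda> p"
  shows "\<exists>U x lam \<xi> t.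
    (U, x) \<in> coordinates A \<and> p \<in> U \<and>
    positive_section (x ` U) (in_chart \<Lambda> (U, x)) lam \<and>
    unit_normal (x ` U) lam \<xi> \<and>
    (\<forall>u\<in>x ` U. ind_metric lam u = mat 1) \<and>
    (\<forall>u\<in>x ` U. II0 lam u = (\<chi> i j. (q0 $ i $ j) *\<^sub>R \<xi> u)) \<and>
    (\<forall>l. smooth_on (x ` U) l \<longrightarrow> (\<forall>u\<in>x ` U.
       moebius_op lam l u = sym0 (ind_metric lam u) (hessian (ind_metric lam) l u) + (t / 2 * l u) *\<^sub>R q0)) \<and>
    isothermic_patch (x ` U) (in_chart \<Lambda> (U, x)) (\<lambda>u. q0) \<and>
    (willmore_patch (x ` U) (in_chart \<Lambda> (U, x)) \<longleftrightarrow> t = 0)"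
proof -
  obtain U x s where c: "(U, x) \<in> coordinates A" and p: "p \<in> U"
    and s: "positive_section (x ` U) (in_chart \<Lambda> (U, x)) s" and II0: "II0 s (x p) \<noteq> 0"
    using assms(5) unfolding umbilic_def by blast
  let ?S = "x ` U" and ?L = "in_chart \<Lambda> (U, x)"
  have oS: "open ?S" using c by (auto simp: coordinates_def is_chart_def)
  have imm: "immersed_patch ?S ?L" using assms(2) c by (auto simp: immersion_def)
  note sec = section_onI[OF imm oS order_refl s]
  have u0: "x p \<in> ?S" using p by blast
  obtain V \<mu> n where V: "open V" "x p \<in> V" "V \<subseteq> ?S" and \<mu>: "smooth_on V \<mu>" "\<And>u. u \<in> V \<Longrightarrow> \<mu> u > 0"
    and n: "smooth_on V n" "\<And>u. u \<in> V \<Longrightarrow> normal_at (\<lambda>w. \<mu> w *\<^sub>R s w) u (n u)"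
    and det: "\<And>u. u \<in> V \<Longrightarrow> lorentz (pd 1 (pd 1 (\<lambda>w. \<mu> w *\<^sub>R s w)) u) (n u) * lorentz (pd 2 (pd 2 (\<lambda>w. \<mu> w *\<^sub>R s w)) u) (n u)
       - (lorentz (pd 1 (pd 2 (\<lambda>w. \<mu> w *\<^sub>R s w)) u) (n u))\<^sup>2 = - det (ind_metric (\<lambda>w. \<mu> w *\<^sub>R s w) u)"
    using canonical_gauge[OF sec(1) u0 II0] by blast
  let ?l = "\<lambda>w. \<mu> w *\<^sub>R s w"
  have pos: "positive_section V ?L ?l"
    unfolding positive_section_def
  proof (intro conjI ballI)
    show "smooth_on V ?l"
      by (rule smooth_on_scaleR[OF V(1) \<mu>(1) smooth_on_subset[OF section_onD(2)[OF sec(1)] V(3)]])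
    fix u assume u: "u \<in> V"
    then have "u \<in> ?S" using V(3) by blast
    from sec(2)[OF this] s this show "?l u \<in> ?L u" "snd (?l u) > 0"
      using \<mu>(2)[OF u] by (auto simp: positive_section_def intro: span_scale span_base)
  qed
  note sl = section_onI[OF imm V(1,3) pos]
  interpret N: normal_section V ?l n
    by unfold_locales (use sl(1) n in auto)
  have detB: "N.B 1 1 w * N.B 2 2 w - (N.B 1 2 w)\<^sup>2 = - det (ind_metric ?l w)" if "w \<in> V" for w
    using det[OF that] by (simp add: N.B_def)
  have flat: "cotton ?l u 1 2 j = 0" if u: "u \<in> V" for u j
  proof -
    \<comment> \<open>Flatness is assumed for gauges on whole chart domains; restricting the chart
      to \<open>V\<close> by the identity makes \<open>?l\<close> such a gauge.\<close>
    have idh: "homeomorphism V V id id" by (simp add: homeomorphism_def continuous_on_id')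
    have ids: "smooth_on V id" using smooth_on_id[OF V(1)] by (simp add: id_def)
    note cc = coordinates_change[OF assms(1) c V(1,3,1) idh ids ids]
    have "positive_section V (in_chart \<Lambda> (U \<inter> x -` V, id \<circ> x)) ?l"
      using pos cc(3) by (simp add: positive_section_def in_chart_def)
    with bspec[OF assms(3)[unfolded strictly_moebius_flat_def] cc(1)] show ?thesis
      unfolding prod.case cc(2) using u by blast
  qed
  interpret N: parallel_section V ?l n
    by unfold_locales (rule detB, assumption, rule N.flat_imp_parallel[OF detB _ flat], assumption+)
  obtain V' b r X Y where V': "open V'" "x p \<in> V'" "V' \<subseteq> V" and r: "r > 0" and hom: "homeomorphism V' (ball b r) X Y"
    and XY: "smooth_on V' X" "smooth_on (ball b r) Y" and ff: "flat_form (ball b r) (\<lambda>y. ?l (Y y)) (\<lambda>y. n (Y y))"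
    by (rule N.flat_coordinates[OF V(2)])
  let ?D = "ball b r" and ?U = "U \<inter> x -` V'" and ?x = "X \<circ> x"
  have V'S: "V' \<subseteq> ?S" using V'(3) V(3) by blast
  note cc = coordinates_change[OF assms(1) c V'(1) V'S open_ball hom XY]
  have L: "\<forall>y\<in>?D. in_chart \<Lambda> (?U, ?x) y = span {?l (Y y)}"
  proof
    fix y assume y: "y \<in> ?D"
    have "Y y \<in> V" using hom y V'(3) by (auto simp: homeomorphism_def)
    then show "in_chart \<Lambda> (?U, ?x) y = span {?l (Y y)}" using sl(2) cc(3)[OF y] by (simp add: in_chart_def)
  qed
  have "convex ?D" "?D \<noteq> {}" using r by auto
  note fc = flat_form_conclusion[OF ff L this]
  have "p \<in> ?U" using p V'(2) by simp
  with cc(1) fc show ?thesis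
    unfolding cc(2)[symmetric] by (elim conjE exE) (intro exI conjI; assumption)
qed

end
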